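(* Let $a,b>-1$ with $\alpha:=a+b>-1$, let $n\ge 1$ be an integer and $x,y>0$. The kernels $H^{(n)}_{\mu\nu}$ (defined in the context from the Cauchy--Laguerre biorthogonal polynomials) are given by $$H^{(n)}_{01}(x,y)=e^{-x+y}\int_0^1 H_{a,n}(tx)\,\widetilde H_{b,n}(ty)\,dt,\qquad H^{(n)}_{00}(x,y)=e^{-x-y}\int_0^1 H_{a,n}(tx)\,H_{b,n}(ty)\,dt,$$ $$H^{(n)}_{11}(x,y)=e^{x+y}\int_0^1 \widetilde H_{a,n}(tx)\,\widetilde H_{b,n}(ty)\,dt-\frac{e^{x+y}}{x+y},\qquad H^{(n)}_{10}(x,y)=e^{x-y}\int_0^1 \widetilde H_{a,n}(tx)\,H_{b,n}(ty)\,dt,$$ where for $c\in\{a,b\}$ $$H_{c,n}(z)=\int_\gamma\frac{du}{2\pi i}\,\frac{\Gamma(u+c)\,\Gamma(n+\alpha-c+1-u)}{\Gamma(1-u)\,\Gamma(c+n+u)\,\Gamma(\alpha-c-u+1)}\,z^{-u},\qquad \widetilde H_{c,n}(z)=\int_\gamma\frac{du}{2\pi i}\,\frac{\Gamma(u)\,\Gamma(u+c)\,\Gamma(n+\alpha-c+1-u)}{\Gamma(\alpha-c+1-u)\,\Gamma(c+n+u)}\,z^{-u}.$$ Correspondingly, the kernels $K^{(n)}_{\mu\nu}$ are given by $$K^{(n)}_{00}(x,y)=\int_0^1 t^\alpha G_{a,n}(tx)G_{b,n}(ty)\,dt,\qquad K^{(n)}_{01}(x,y)=y^b e^{y}\int_0^1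 t^\alpha G_{a,n}(tx)\widetilde G_{b,n}(ty)\,dt,$$ $$K^{(n)}_{10}(x,y)=x^a e^{x}\int_0^1 t^\alpha \widetilde G_{a,n}(tx)G_{b,n}(ty)\,dt,\qquad K^{(n)}_{11}(x,y)=x^a y^b e^{x+y}\int_0^1 t^\alpha\widetilde G_{a,n}(tx)\widetilde G_{b,n}(ty)\,dt-\frac{e^{x+y}}{x+y},$$ where for $c\in\{a,b\}$ $$G_{c,n}(z)=\int_\gamma\frac{du}{2\pi i}\,\frac{\Gamma(u)\,\Gamma(n+\alpha+1-u)}{\Gamma(c+1-u)\,\Gamma(n+u)\,\Gamma(\alpha+1-u)}\,z^{-u},\qquad \widetilde G_{c,n}(z)=\int_\gamma\frac{du}{2\pi i}\,\frac{\Gamma(u-c)\,\Gamma(u)\,\Gamma(n+\alpha+1-u)}{\Gamma(\alpha+1-u)\,\Gamma(n+u)}\,z^{-u}.$$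
   Context: Cauchy--Laguerre biorthogonal polynomials: $p_j,q_j$ ($j\ge0$) are the polynomials of exact degree $j$, with identical positive leading coefficients ($p_j(x)=c_jx^j+\dots$, $q_j(y)=c_jy^j+\dots$, $c_j>0$), such that $$\int_0^\infty\!\!\int_0^\infty \frac{x^ay^be^{-x-y}}{x+y}\,p_\ell(x)q_m(y)\,dx\,dy=\delta_{\ell m}.$$ The kernels are, for $x,y>0$, $$K^{(n)}_{00}(x,y)=\sum_{j=0}^{n-1}p_j(x)q_j(y),\qquad K^{(n)}_{01}(x,y)=\int_0^\infty K^{(n)}_{00}(x,y')\frac{y'^be^{-y'}}{y+y'}\,dy',\qquad K^{(n)}_{10}(x,y)=\int_0^\infty K^{(n)}_{00}(x',y)\frac{x'^ae^{-x'}}{x+x'}\,dx',$$ $$K^{(n)}_{11}(x,y)=\int_0^\infty\!\!\int_0^\infty K^{(n)}_{00}(x',y')\frac{x'^ae^{-x'}}{x+x'}\frac{y'^be^{-y'}}{y+y'}\,dx'\,dy'-\frac1{x+y},$$ and $$H^{(n)}_{01}(x,y)=x^ae^{-x}K^{(n)}_{01}(x,y),\quad H^{(n)}_{00}(x,y)=x^ay^be^{-x-y}K^{(n)}_{00}(x,y),\quad H^{(n)}_{11}(x,y)=K^{(n)}_{11}(x,y),\quad H^{(n)}_{10}(x,y)=y^be^{-y}K^{(n)}_{10}(x,y).$$ These kernels determine all correlation functions of the eigenvalues $x_i$ of $M_1$ and $y_j$ of $M_2$ in the matrix model with density proportional to $\det(M_1)^a\det(M_2)^be^{-\mathrm{Tr}(M_1+M_2)}/\det(M_1+M_2)^n$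 on pairs of positive definite Hermitian $n\times n$ matrices: $\rho_{(k,\ell)}(x_1,\dots,x_k;y_1,\dots,y_\ell)$ is the determinant of the block matrix with blocks $[H^{(n)}_{01}(x_i,x_j)]$, $[H^{(n)}_{00}(x_i,y_j)]$ (top row), $[H^{(n)}_{11}(y_i,x_j)]$, $[H^{(n)}_{10}(y_i,y_j)]$ (bottom row). Contour convention: in each integral $\gamma$ is a contour originating at $-\infty$ in the lower half-plane and returning to $-\infty$ in the upper half-plane, leaving all poles of those numerator Gamma functions whose argument contains $+u$ inside the contour, and all poles of those numerator Gamma functions whose argument contains $-u$ outside. Powers are principal branches (cut along the negative axis). *)

theory Defs
  imports "HOL-Complex_Analysis.Complex_Analysis"
begin

section \<open>Cauchy--Laguerre biorthogonal polynomials and their kernels\<close>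

definition cauchy_laguerre_biorthogonal ::
    "real \<Rightarrow> real \<Rightarrow> (nat \<Rightarrow> real poly) \<Rightarrow> (nat \<Rightarrow> real poly) \<Rightarrow> bool" where
  "cauchy_laguerre_biorthogonal a b p q \<longleftrightarrow>
     (\<forall>j. degree (p j) = j \<and> degree (q j) = j \<and>
          lead_coeff (p j) = lead_coeff (q j) \<and> lead_coeff (p j) > 0) \<and>
     (\<forall>l m. (LBINT y:{0<..}. (LBINT x:{0<..}.
               x powr a * y powr b * exp (- x - y) / (x + y) * poly (p l) x * poly (q m) y))
            = (if l = m then 1 else 0))"

definition K00 :: "(nat \<Rightarrow> real poly) \<Rightarrow> (nat \<Rightarrow> real poly) \<Rightarrow> nat \<Rightarrow> real \<Rightarrow> real \<Rightarrow> real" where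
  "K00 p q n x y = (\<Sum>j<n. poly (p j) x * poly (q j) y)"

definition K01 ::
    "real \<Rightarrow> (nat \<Rightarrow> real poly) \<Rightarrow> (nat \<Rightarrow> real poly) \<Rightarrow> nat \<Rightarrow> real \<Rightarrow> real \<Rightarrow> real" where
  "K01 b p q n x y =
     (LBINT y':{0<..}. K00 p q n x y' * (y' powr b * exp (- y') / (y + y')))"

definition K10 ::
    "real \<Rightarrow> (nat \<Rightarrow> real poly) \<Rightarrow> (nat \<Rightarrow> real poly) \<Rightarrow> nat \<Rightarrow> real \<Rightarrow> real \<Rightarrow> real" where
  "K10 a p q n x y =
     (LBINT x':{0<..}. K00 p q n x' y * (x' powr a * exp (- x') / (x + x')))"

definition K11 ::
    "real \<Rightarrow> real \<Rightarrow> (nat \<Rightarrow> real poly) \<Rightarrow> (nat \<Rightarrow> real poly) \<Rightarrow> nat \<Rightarrow> real \<Rightarrow> real \<Rightarrow> real" where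
  "K11 a b p q n x y =
     (LBINT y':{0<..}. (LBINT x':{0<..}.
        K00 p q n x' y' * (x' powr a * exp (- x') / (x + x')) * (y' powr b * exp (- y') / (y + y'))))
     - 1 / (x + y)"

definition H01 ::
    "real \<Rightarrow> real \<Rightarrow> (nat \<Rightarrow> real poly) \<Rightarrow> (nat \<Rightarrow> real poly) \<Rightarrow> nat \<Rightarrow> real \<Rightarrow> real \<Rightarrow> real" where
  "H01 a b p q n x y = x powr a * exp (- x) * K01 b p q n x y"

definition H00 ::
    "real \<Rightarrow> real \<Rightarrow> (nat \<Rightarrow> real poly) \<Rightarrow> (nat \<Rightarrow> real poly) \<Rightarrow> nat \<Rightarrow> real \<Rightarrow> real \<Rightarrow> real" where
  "H00 a b p q n x y = x powr a * y powr b * exp (- x - y) * K00 p q n x y"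

definition H11 ::
    "real \<Rightarrow> real \<Rightarrow> (nat \<Rightarrow> real poly) \<Rightarrow> (nat \<Rightarrow> real poly) \<Rightarrow> nat \<Rightarrow> real \<Rightarrow> real \<Rightarrow> real" where
  "H11 a b p q n x y = K11 a b p q n x y"

definition H10 ::
    "real \<Rightarrow> real \<Rightarrow> (nat \<Rightarrow> real poly) \<Rightarrow> (nat \<Rightarrow> real poly) \<Rightarrow> nat \<Rightarrow> real \<Rightarrow> real \<Rightarrow> real" where
  "H10 a b p q n x y = y powr b * exp (- y) * K10 a p q n x y"


section \<open>Contours from $-\infty$ to $-\infty$\<close>

text \<open>
  A contour is parametrised by the whole real line. It starts at $-\infty$ in the lower
  half-plane and ends at $-\infty$ in the upper half-plane. Near both ends the imaginary part is
  bounded, and bounded away from $0$; otherwise the contour could approach the poles on the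
  negative axis, or leave the region where the integrands decay, so that the integrals diverge.
\<close>

definition left_loop :: "(real \<Rightarrow> complex) \<Rightarrow> bool" where
  "left_loop \<gamma> \<longleftrightarrow>
     (\<forall>s t. \<gamma> piecewise_C1_differentiable_on {s..t}) \<and>
     filterlim (\<lambda>t. Re (\<gamma> t)) at_bot at_bot \<and>
     filterlim (\<lambda>t. Re (\<gamma> t)) at_bot at_top \<and>
     (\<exists>d D. 0 < d \<and>
        (\<forall>\<^sub>F t in at_bot. - D \<le> Im (\<gamma> t) \<and> Im (\<gamma> t) \<le> - d) \<and>
        (\<forall>\<^sub>F t in at_top. d \<le> Im (\<gamma> t) \<and> Im (\<gamma> t) \<le> D))"

text \<open>
  The winding number of such a contour about a point is that of its truncation to $[s,t]$, closed
  up by the segment from $\gamma(t)$ back to $\gamma(s)$, for $s$ near $-\infty$ and $t$ near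
  $+\infty$. A point inside has winding number $1$: the contour passes from the lower to the upper
  half-plane with its interior on the left.
\<close>

definition closed_truncation :: "(real \<Rightarrow> complex) \<Rightarrow> real \<Rightarrow> real \<Rightarrow> real \<Rightarrow> complex" where
  "closed_truncation \<gamma> s t = subpath s t \<gamma> +++ linepath (\<gamma> t) (\<gamma> s)"

definition inside_loop :: "(real \<Rightarrow> complex) \<Rightarrow> complex \<Rightarrow> bool" where
  "inside_loop \<gamma> w \<longleftrightarrow> w \<notin> range \<gamma> \<and>
     (\<forall>\<^sub>F (s, t) in at_bot \<times>\<^sub>F at_top. winding_number (closed_truncation \<gamma> s t) w = 1)"

definition outside_loop :: "(real \<Rightarrow> complex) \<Rightarrow> complex \<Rightarrow> bool" where
  "outside_loop \<gamma> w \<longleftrightarrow> w \<notin> range \<gamma> \<and>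
     (\<forall>\<^sub>F (s, t) in at_bot \<times>\<^sub>F at_top. winding_number (closed_truncation \<gamma> s t) w = 0)"

definition separating_loop :: "(real \<Rightarrow> complex) \<Rightarrow> complex set \<Rightarrow> complex set \<Rightarrow> bool" where
  "separating_loop \<gamma> P Q \<longleftrightarrow>
     left_loop \<gamma> \<and> (\<forall>w\<in>P. inside_loop \<gamma> w) \<and> (\<forall>w\<in>Q. outside_loop \<gamma> w)"

text \<open>
  The analogue of \<^const>\<open>contour_integral\<close> for a path parametrised by the real line; the
  Henstock--Kurzweil integral over \<^const>\<open>UNIV\<close> is the limit of the integrals over
  $[s,t]$ as $s\to-\infty$ and $t\to+\infty$ independently.
\<close>

definition loop_integral :: "(real \<Rightarrow> complex) \<Rightarrow> (complex \<Rightarrow> complex) \<Rightarrow> complex" where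
  "loop_integral \<gamma> f = integral UNIV (\<lambda>t. f (\<gamma> t) * vector_derivative \<gamma> (at t))"


section \<open>The functions in the integral representations\<close>

definition poles_Gamma_plus :: "real \<Rightarrow> complex set"  \<comment> \<open>poles of $\Gamma(u+s)$\<close> where
  "poles_Gamma_plus s = {u. u + of_real s \<in> \<int>\<^sub>\<le>\<^sub>0}"

definition poles_Gamma_minus :: "real \<Rightarrow> complex set"  \<comment> \<open>poles of $\Gamma(s-u)$\<close> where
  "poles_Gamma_minus s = {u. of_real s - u \<in> \<int>\<^sub>\<le>\<^sub>0}"

text \<open>
  In the functions below, \<^term>\<open>Gamma\<close> in a denominator stands for multiplication with the
  reciprocal Gamma function also at a pole, because \<^term>\<open>Gamma\<close> is $0$ there and division by
  $0$ yields $0$. Poles of $\Gamma(n+\alpha+1-u)$ that the denominator cancels still count as poles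
  of a numerator factor in the conditions on the contour.
\<close>

definition H_contour :: "real \<Rightarrow> real \<Rightarrow> nat \<Rightarrow> (real \<Rightarrow> complex) \<Rightarrow> bool" where
  "H_contour \<alpha> c n \<gamma> \<longleftrightarrow>
     separating_loop \<gamma> (poles_Gamma_plus c) (poles_Gamma_minus (real n + \<alpha> - c + 1))"

definition H_fun :: "(real \<Rightarrow> complex) \<Rightarrow> real \<Rightarrow> real \<Rightarrow> nat \<Rightarrow> real \<Rightarrow> complex" where
  "H_fun \<gamma> \<alpha> c n z = 1 / (2 * of_real pi * \<i>) * loop_integral \<gamma> (\<lambda>u.
     Gamma (u + of_real c) * Gamma (of_real (real n + \<alpha> - c + 1) - u) /
     (Gamma (1 - u) * Gamma (of_real (c + real n) + u) * Gamma (of_real (\<alpha> - c) - u + 1))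
     * of_real z powr (- u))"

definition Ht_contour :: "real \<Rightarrow> real \<Rightarrow> nat \<Rightarrow> (real \<Rightarrow> complex) \<Rightarrow> bool" where
  "Ht_contour \<alpha> c n \<gamma> \<longleftrightarrow>
     separating_loop \<gamma> (poles_Gamma_plus 0 \<union> poles_Gamma_plus c)
       (poles_Gamma_minus (real n + \<alpha> - c + 1))"

definition Ht_fun :: "(real \<Rightarrow> complex) \<Rightarrow> real \<Rightarrow> real \<Rightarrow> nat \<Rightarrow> real \<Rightarrow> complex" where
  "Ht_fun \<gamma> \<alpha> c n z = 1 / (2 * of_real pi * \<i>) * loop_integral \<gamma> (\<lambda>u.
     Gamma u * Gamma (u + of_real c) * Gamma (of_real (real n + \<alpha> - c + 1) - u) /
     (Gamma (of_real (\<alpha> - c + 1) - u) * Gamma (of_real (c + real n) + u))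
     * of_real z powr (- u))"

definition G_contour :: "real \<Rightarrow> real \<Rightarrow> nat \<Rightarrow> (real \<Rightarrow> complex) \<Rightarrow> bool" where
  "G_contour \<alpha> c n \<gamma> \<longleftrightarrow>
     separating_loop \<gamma> (poles_Gamma_plus 0) (poles_Gamma_minus (real n + \<alpha> + 1))"

definition G_fun :: "(real \<Rightarrow> complex) \<Rightarrow> real \<Rightarrow> real \<Rightarrow> nat \<Rightarrow> real \<Rightarrow> complex" where
  "G_fun \<gamma> \<alpha> c n z = 1 / (2 * of_real pi * \<i>) * loop_integral \<gamma> (\<lambda>u.
     Gamma u * Gamma (of_real (real n + \<alpha> + 1) - u) /
     (Gamma (of_real (c + 1) - u) * Gamma (of_nat n + u) * Gamma (of_real (\<alpha> + 1) - u))
     * of_real z powr (- u))"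

definition Gt_contour :: "real \<Rightarrow> real \<Rightarrow> nat \<Rightarrow> (real \<Rightarrow> complex) \<Rightarrow> bool" where
  "Gt_contour \<alpha> c n \<gamma> \<longleftrightarrow>
     separating_loop \<gamma> (poles_Gamma_plus (- c) \<union> poles_Gamma_plus 0)
       (poles_Gamma_minus (real n + \<alpha> + 1))"

definition Gt_fun :: "(real \<Rightarrow> complex) \<Rightarrow> real \<Rightarrow> real \<Rightarrow> nat \<Rightarrow> real \<Rightarrow> complex" where
  "Gt_fun \<gamma> \<alpha> c n z = 1 / (2 * of_real pi * \<i>) * loop_integral \<gamma> (\<lambda>u.
     Gamma (u - of_real c) * Gamma u * Gamma (of_real (real n + \<alpha> + 1) - u) /
     (Gamma (of_real (\<alpha> + 1) - u) * Gamma (of_nat n + u))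
     * of_real z powr (- u))"

end

theory Submission
  imports Defs
begin

text \<open>
  Write $(v)_n$ for the Pochhammer symbol and let $A_k$ be the residue at $u=-k$ of
  $R(u) = (\alpha+1-u)_n/(u)_n$, so that $R(u) = (-1)^n + \sum_{k<n} A_k/(u+k)$
  (\<open>pochhammer_ratio_partial_fractions\<close>). Both sides of every formula turn out to be
  explicit in terms of the $A_k$.

  The right-hand sides. The quotients of Gamma functions in $G_c$ and $\tilde G_c$ are $R(u)$
  times $1/\Gamma(c+1-u)$ and $\Gamma(u-c)$ respectively. By partial fractions the loop integrals
  reduce to
  \[ \oint \frac{z^{-u}}{\Gamma(c+1-u)\,(u+k)} = \frac{z^k}{\Gamma(c+1+k)}, \qquad
     \oint \Gamma(u-c)\,z^{-u} = z^{-c}e^{-z}, \qquad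
     \oint \frac{\Gamma(u-c)\,z^{-u}}{u+k} = z^k\,\Gamma(-c-k,z) \]
  with the upper incomplete Gamma function $\Gamma(s,z)$, where $\oint$ includes the factor
  $1/(2\pi i)$. All admissible contours give the same value because each can be deformed into three
  sides of a rectangle that is open to the left (\<open>loop_has_integral\<close>). The first
  integral is then Cauchy's formula. For the other two the rectangle grows into a vertical line to
  the right of all poles; this avoids the case distinction between simple and double poles that
  residues would require. On the line the second integral is the Cahen--Mellin integral, and the
  third follows from it by $z^{-u-k}/(u+k) = \int_z^\infty w^{-u-k-1}\,dw$. The contours of $H_c$
  and $\tilde H_c$ are translates by $-c$, whence $H_c(z) = z^c G_c(z)$ and
  $\tilde H_c(z) = z^c\tilde G_c(z)$.

  The left-hand sides. Since $1/(x+y)$ is a Laplace transform, the moments of the weight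
  are $\Gamma(a+i+1)\,\Gamma(b+j+1)/(\alpha+1+i+j)$: a Cauchy matrix between diagonal ones. Its
  inverse has the entries $A_kA_l/(\alpha+1+k+l)$ up to the same diagonal factors
  (\<open>sum_pf_coeff_orthogonal\<close>), and biorthogonality identifies the coefficients of
  $K_{00}$ with this inverse. The other kernels arise on replacing powers by Stieltjes transforms,
  which are incomplete Gamma functions again.

  The integral over $[0,1]$ links the two. The functions $f_k(t) = (tx)^k/\Gamma(a+1+k)$ and
  $f_k(t) = (tx)^k\,\Gamma(-a-k,tx)$ both satisfy $t f_k' = k f_k - p$ with $p$ independent of $k$,
  namely $p=0$ or $p=(tx)^{-a}e^{-tx}$. Let $h_l$ be one of the two families for $b$ and $y$, with
  $q$ in place of $p$. Because $R$ vanishes at $\alpha+1+m$ for $m<n$, the function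
  \[ t^{\alpha+1} \sum_{k,l<n} \frac{A_kA_l}{\alpha+1+k+l}\, f_k(t)\,h_l(t) \]
  has the derivative
  $t^\alpha\,\bigl(\sum_k A_kf_k+(-1)^np\bigr)\bigl(\sum_l A_lh_l+(-1)^nq\bigr) - t^\alpha pq$
  (\<open>integral_product_of_mode_sums\<close>). The term $t^\alpha pq$ is nonzero only for
  $K_{11}$, where it is $x^{-a}y^{-b}e^{-t(x+y)}$ and accounts for the difference between
  $1/(x+y)$ and $e^{x+y}/(x+y)$.
\<close>


section \<open>Deformation of loops\<close>

text \<open>
  The real part is monotone along a segment, so $e^{\mathrm{Re}\,u}$ can be integrated exactly in the
  horizontal direction. The bound is therefore independent of the horizontal extent of the segment:
  one end point may run off to $-\infty$ while the other one stays fixed.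
\<close>

lemma contour_integral_linepath_exp_bound:
  assumes f: "(f has_contour_integral I) (linepath a b)"
    and bd: "\<And>u. u \<in> closed_segment a b \<Longrightarrow> cmod (f u) \<le> M * exp (Re u)"
    and M: "M \<ge> 0" and X: "Re a \<le> X" "Re b \<le> X"
  shows "cmod I \<le> M * exp X * (1 + \<bar>Im b - Im a\<bar>)"
proof -
  define \<Delta> where "\<Delta> = Re b - Re a"
  have I: "((\<lambda>x. f (linepath a b x) * (b - a)) has_integral I) {0..1}"
    using f by (simp add: has_contour_integral_linepath)
  let ?g = "\<lambda>x. M * (exp (Re a + x * \<Delta>) * \<bar>\<Delta>\<bar> + exp X * \<bar>Im b - Im a\<bar>)"
  have g: "(?g has_integral M * (sgn \<Delta> * (exp (Re b) - exp (Re a)) + exp X * \<bar>Im b - Im a\<bar>)) {0..1}"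
  proof -
    have "((\<lambda>x. exp (Re a + x * \<Delta>) * \<bar>\<Delta>\<bar>) has_integral
            (sgn \<Delta> * exp (Re a + 1 * \<Delta>) - sgn \<Delta> * exp (Re a + 0 * \<Delta>))) {0..1}"
      by (intro fundamental_theorem_of_calculus)
         (auto intro!: derivative_eq_intros simp: has_real_derivative_iff_has_vector_derivative[symmetric]
            abs_sgn mult_ac)
    hence "((\<lambda>x. exp (Re a + x * \<Delta>) * \<bar>\<Delta>\<bar>) has_integral (sgn \<Delta> * (exp (Re b) - exp (Re a)))) {0..1}"
      by (simp add: \<Delta>_def algebra_simps)
    moreover have "((\<lambda>x::real. exp X * \<bar>Im b - Im a\<bar>) has_integral (exp X * \<bar>Im b - Im a\<bar>)) {0..1}"
      using has_integral_const_real[of "exp X * \<bar>Im b - Im a\<bar>" 0 1] by simp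
    ultimately show ?thesis
      by (intro has_integral_mult_right[OF has_integral_add])
  qed
  have "norm (integral {0..1} (\<lambda>x. f (linepath a b x) * (b - a))) \<le> integral {0..1} ?g"
  proof (rule integral_norm_bound_integral)
    show "(\<lambda>x. f (linepath a b x) * (b - a)) integrable_on {0..1}" "?g integrable_on {0..1}"
      using I g by blast+
    fix x :: real assume x: "x \<in> {0..1}"
    let ?u = "linepath a b x"
    have u: "?u \<in> closed_segment a b"
      using x by (auto simp: linepath_in_path)
    have Re: "Re ?u = Re a + x * \<Delta>"
      by (simp add: linepath_def \<Delta>_def algebra_simps)
    have "Re ?u \<le> X"
    proof -
      have "Re ?u = (1 - x) * Re a + x * Re b" by (simp add: linepath_def)
      also have "\<dots> \<le> (1 - x) * X + x * X"
        using x X by (intro add_mono mult_left_mono) auto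
      finally show ?thesis by (simp add: algebra_simps)
    qed
    hence eX: "exp (Re ?u) \<le> exp X" by simp
    have "cmod (b - a) \<le> \<bar>\<Delta>\<bar> + \<bar>Im b - Im a\<bar>"
      using cmod_le[of "b - a"] by (simp add: \<Delta>_def)
    hence "cmod (f ?u * (b - a)) \<le> (M * exp (Re ?u)) * (\<bar>\<Delta>\<bar> + \<bar>Im b - Im a\<bar>)"
      unfolding norm_mult using bd[OF u] M by (intro mult_mono) auto
    also have "\<dots> = M * (exp (Re ?u) * \<bar>\<Delta>\<bar> + exp (Re ?u) * \<bar>Im b - Im a\<bar>)"
      by (simp add: algebra_simps)
    also have "\<dots> \<le> ?g x"
      using M eX by (intro mult_left_mono add_mono mult_right_mono) (auto simp: Re)
    finally show "norm (f ?u * (b - a)) \<le> ?g x" .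
  qed
  hence "cmod I \<le> M * (sgn \<Delta> * (exp (Re b) - exp (Re a)) + exp X * \<bar>Im b - Im a\<bar>)"
    using I g by (metis integral_unique)
  also have "\<dots> \<le> M * (exp X + exp X * \<bar>Im b - Im a\<bar>)"
  proof -
    have "exp (Re a) \<le> exp X" "exp (Re b) \<le> exp X" using X by auto
    hence "sgn \<Delta> * (exp (Re b) - exp (Re a)) \<le> exp X"
      using exp_gt_zero[of "Re a"] exp_gt_zero[of "Re b"] exp_gt_zero[of X]
      by (cases "\<Delta> > 0"; cases "\<Delta> < 0"; simp add: add_increasing2 algebra_simps)
    thus ?thesis using M by (intro mult_left_mono) auto
  qed
  finally show ?thesis using M by (simp add: algebra_simps)
qed

lemma valid_path_truncation:
  assumes "left_loop \<gamma>" "s < t"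
  shows "valid_path (subpath s t \<gamma>)"
proof -
  have eq: "subpath s t \<gamma> = \<gamma> \<circ> (\<lambda>x. (t - s) *\<^sub>R x + s)"
    by (auto simp: subpath_def)
  have "(\<lambda>x. (t - s) * x + s) ` {0..1} = {s..t}"
    using image_affinity_atLeastAtMost[of "t - s" s 0 1] assms(2) by (simp add: algebra_simps)
  hence "\<gamma> piecewise_C1_differentiable_on ((\<lambda>x. (t - s) * x + s) ` {0..1})"
    using assms(1) by (auto simp: left_loop_def)
  from piecewise_C1_differentiable_affine[OF this] show ?thesis
    by (simp add: valid_path_def eq)
qed

text \<open>
  The substitution undoes the reparametrisation in \<^const>\<open>subpath\<close>; it is valid off the finitely
  many points at which $\gamma$ is not continuously differentiable.
\<close>

lemma has_integral_truncation:
  assumes \<gamma>: "left_loop \<gamma>" and st: "s < t"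
    and f: "(f has_contour_integral I) (subpath s t \<gamma>)"
  shows "((\<lambda>u. f (\<gamma> u) * vector_derivative \<gamma> (at u)) has_integral I) {s..t}"
proof -
  define g where "g = subpath s t \<gamma>"
  have "((\<lambda>x. f (g x) * vector_derivative g (at x)) has_integral I) {0..1}"
    using f by (simp add: has_contour_integral g_def)
  hence "((\<lambda>x. f (g x) * vector_derivative g (at x)) has_integral I) (cbox 0 1)" by simp
  define m where "m = t - s"
  have m: "m > 0" "t = s + m" using st by (auto simp: m_def)
  from has_integral_affinity[OF \<open>(_ has_integral I) (cbox 0 1)\<close>, of "1 / m" "- s / m"]
  have aff: "((\<lambda>x. f (g ((x - s) / m)) * vector_derivative g (at ((x - s) / m)))
          has_integral m *\<^sub>R I) ((\<lambda>x. m * x + s) ` {0..1})"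
    using m by (simp add: diff_divide_distrib)
  have "(\<lambda>x. (t - s) * x + s) ` {0..1} = {s..t}"
    using image_affinity_atLeastAtMost[of "t - s" s 0 1] st by (simp add: algebra_simps)
  with aff m_def have "((\<lambda>x. f (g ((x - s) / (t - s))) * vector_derivative g (at ((x - s) / (t - s))))
          has_integral (t - s) *\<^sub>R I) {s..t}" by simp
  from has_integral_cmul[OF this, of "inverse (t - s)"]
  have *: "((\<lambda>x. inverse (t - s) *\<^sub>R (f (g ((x - s) / (t - s))) * vector_derivative g (at ((x - s) / (t - s)))))
          has_integral I) {s..t}" using st by simp
  have "\<gamma> piecewise_C1_differentiable_on {s..t}"
    using \<gamma> by (auto simp: left_loop_def)
  then obtain K where K: "finite K" "\<gamma> C1_differentiable_on {s..t} - K"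
    by (auto simp: piecewise_C1_differentiable_on_def)
  show ?thesis
  proof (rule has_integral_spike_finite[OF _ _ *])
    show "finite K" by fact
    fix x assume x: "x \<in> {s..t} - K"
    let ?y = "(x - s) / (t - s)"
    have y: "(t - s) * ?y + s = x" using st by (simp add: field_simps)
    from K x have "\<gamma> differentiable (at x)"
      by (auto simp: C1_differentiable_on_eq)
    hence "(\<gamma> has_vector_derivative vector_derivative \<gamma> (at x)) (at x)"
      by (simp add: vector_derivative_works)
    hence d: "(\<gamma> has_vector_derivative vector_derivative \<gamma> (at x)) (at ((t - s) * ?y + s))"
      using y by simp
    have "(g has_vector_derivative (t - s) *\<^sub>R vector_derivative \<gamma> (at x)) (at ?y)"
    proof -
      have "((\<lambda>w. (t - s) * w + s) has_vector_derivative (t - s)) (at ?y)"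
        by (auto intro!: derivative_eq_intros simp: has_real_derivative_iff_has_vector_derivative[symmetric])
      from vector_diff_chain_at[OF this d] show ?thesis
        by (simp add: g_def subpath_def o_def)
    qed
    hence "vector_derivative g (at ?y) = (t - s) *\<^sub>R vector_derivative \<gamma> (at x)"
      by (rule vector_derivative_at)
    moreover have "g ?y = \<gamma> x" using y by (simp add: g_def subpath_def)
    ultimately show "f (\<gamma> x) * vector_derivative \<gamma> (at x) =
          inverse (t - s) *\<^sub>R (f (g ?y) * vector_derivative g (at ?y))"
      using st by simp
  qed
qed

text \<open>
  Three sides of a rectangle that is open to the left: the standard loop to which all other loops
  are deformed.
\<close>

definition bracket :: "real \<Rightarrow> real \<Rightarrow> real \<Rightarrow> real \<Rightarrow> complex" where
  "bracket T \<sigma> X =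
     linepath (Complex X (- T)) (Complex \<sigma> (- T)) +++
     linepath (Complex \<sigma> (- T)) (Complex \<sigma> T) +++
     linepath (Complex \<sigma> T) (Complex X T)"

lemma bracket_simps [simp]:
  "valid_path (bracket T \<sigma> X)" "path (bracket T \<sigma> X)"
  "pathstart (bracket T \<sigma> X) = Complex X (- T)"
  "pathfinish (bracket T \<sigma> X) = Complex X T"
  by (auto simp: bracket_def intro!: valid_path_join)

lemma real_point_of_bracket:
  assumes "w \<in> path_image (bracket T \<sigma> X)" "Im w = 0" "T > 0"
  shows "Re w = \<sigma>"
proof -
  from assms(1) consider "w \<in> closed_segment (Complex X (- T)) (Complex \<sigma> (- T))"
    | "w \<in> closed_segment (Complex \<sigma> (- T)) (Complex \<sigma> T)"
    | "w \<in> closed_segment (Complex \<sigma> T) (Complex X T)"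
    by (auto simp: bracket_def path_image_join)
  thus ?thesis
  proof cases
    case 2 thus ?thesis by (auto simp: closed_segment_def complex_eq_iff algebra_simps)
  qed (use assms in \<open>auto simp: closed_segment_def complex_eq_iff algebra_simps\<close>)
qed

lemma segment_in_halfplane:
  fixes a b :: complex
  assumes "u \<in> closed_segment a b"
  shows "Re a \<le> X \<Longrightarrow> Re b \<le> X \<Longrightarrow> Re u \<le> X"
    and "d \<le> Im a \<Longrightarrow> d \<le> Im b \<Longrightarrow> d \<le> Im u"
    and "Im a \<le> D \<Longrightarrow> Im b \<le> D \<Longrightarrow> Im u \<le> D"
proof -
  have cv: "convex {z. Re z \<le> X}" "convex {z. Im z \<ge> d}" "convex {z. Im z \<le> D}"
    by (rule convex_halfspace_Re_le convex_halfspace_Im_ge convex_halfspace_Im_le)+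
  show "Re a \<le> X \<Longrightarrow> Re b \<le> X \<Longrightarrow> Re u \<le> X"
    using closed_segment_subset[OF _ _ cv(1), of a b] assms by auto
  show "d \<le> Im a \<Longrightarrow> d \<le> Im b \<Longrightarrow> d \<le> Im u"
    using closed_segment_subset[OF _ _ cv(2), of a b] assms by auto
  show "Im a \<le> D \<Longrightarrow> Im b \<le> D \<Longrightarrow> Im u \<le> D"
    using closed_segment_subset[OF _ _ cv(3), of a b] assms by auto
qed

lemma contour_integral_inverse_avoiding_left_ray:
  assumes "valid_path g" "\<And>u. u \<in> path_image g \<Longrightarrow> u - w \<notin> \<real>\<^sub>\<le>\<^sub>0"
  shows "((\<lambda>u. 1 / (u - w)) has_contour_integral (Ln (pathfinish g - w) - Ln (pathstart g - w))) g"
proof (rule contour_integral_primitive[OF _ assms(1) order_refl])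
  fix u assume "u \<in> path_image g"
  with assms(2) have "u - w \<notin> \<real>\<^sub>\<le>\<^sub>0" by blast
  thus "((\<lambda>u. Ln (u - w)) has_field_derivative 1 / (u - w)) (at u within path_image g)"
    by (auto intro!: derivative_eq_intros simp: divide_inverse)
qed

lemma contour_integral_inverse_avoiding_right_ray:
  assumes "valid_path g" "\<And>u. u \<in> path_image g \<Longrightarrow> w - u \<notin> \<real>\<^sub>\<le>\<^sub>0"
  shows "((\<lambda>u. 1 / (u - w)) has_contour_integral (Ln (w - pathfinish g) - Ln (w - pathstart g))) g"
proof (rule contour_integral_primitive[OF _ assms(1) order_refl])
  fix u assume "u \<in> path_image g"
  with assms(2) have "w - u \<notin> \<real>\<^sub>\<le>\<^sub>0" by blast
  moreover from this have "w - u \<noteq> 0" by auto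
  hence "- (1 / (w - u)) = 1 / (u - w)" by (simp add: field_simps)
  ultimately show "((\<lambda>u. Ln (w - u)) has_field_derivative 1 / (u - w)) (at u within path_image g)"
    by (auto intro!: derivative_eq_intros simp: divide_inverse)
qed

text \<open>
  Along the closing segment, which passes $w$ on the left, $\log(w-u)$ is a primitive of $1/(u-w)$;
  along $h$, which passes $w$ on the right, $\log(u-w)$ is one. At the two ends these branches differ
  by $i\pi$ with opposite signs, which makes one full turn.
\<close>

lemma winding_number_reroute:
  assumes g: "valid_path g" and h: "valid_path h"
    and hg: "pathstart h = pathfinish g" "pathfinish h = pathstart g"
    and w: "Im w = 0" "w \<notin> path_image g"
    and ends: "Im (pathstart g) < 0" "Im (pathfinish g) > 0"
       "Re (pathstart g) < Re w" "Re (pathfinish g) < Re w"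
    and right: "\<And>u. u \<in> path_image h \<Longrightarrow> Im u = 0 \<Longrightarrow> Re u > Re w"
  shows "winding_number (g +++ h) w = winding_number (g +++ linepath (pathfinish g) (pathstart g)) w - 1"
proof -
  define A B l where "A = pathstart g" and "B = pathfinish g" and "l = linepath B A"
  have h1: "((\<lambda>u. 1 / (u - w)) has_contour_integral (Ln (A - w) - Ln (B - w))) h"
    using contour_integral_inverse_avoiding_left_ray[OF h, of w] right w hg
    by (force simp: A_def B_def complex_nonpos_Reals_iff)
  have l1: "((\<lambda>u. 1 / (u - w)) has_contour_integral (Ln (w - A) - Ln (w - B))) l"
  proof -
    have "w - u \<notin> \<real>\<^sub>\<le>\<^sub>0" if "u \<in> path_image l" for u
      using segment_in_halfplane(1)[of u B A "max (Re A) (Re B)"] that ends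
      by (auto simp: l_def A_def B_def complex_nonpos_Reals_iff)
    thus ?thesis using contour_integral_inverse_avoiding_right_ray[of l w] by (simp add: l_def)
  qed
  have Ln: "Ln (w - A) = Ln (A - w) + \<i> * pi" "Ln (w - B) = Ln (B - w) - \<i> * pi"
    using Ln_minus[of "A - w"] Ln_minus[of "B - w"] ends w
    by (auto simp: A_def B_def complex_eq_iff)
  have g1: "(\<lambda>u. 1 / (u - w)) contour_integrable_on g"
    by (rule contour_integrable_inversediff) (use g w in auto)
  have wh: "w \<notin> path_image h" using right w(1) by force
  have wl: "w \<notin> path_image l"
    using segment_in_halfplane(1)[of w B A "max (Re A) (Re B)"] ends
    by (auto simp: l_def A_def B_def)
  have "winding_number (g +++ h) w =
        1 / (2 * pi * \<i>) * contour_integral (g +++ h) (\<lambda>u. 1 / (u - w))"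
    using g h hg w wh by (intro winding_number_valid_path) (auto simp: path_image_join)
  also have "\<dots> = 1 / (2 * pi * \<i>) * (contour_integral g (\<lambda>u. 1 / (u - w)) + (Ln (A - w) - Ln (B - w)))"
    using g1 h1 g h hg by (subst contour_integral_join) (auto simp: contour_integral_unique has_contour_integral_integrable)
  finally have 1: "winding_number (g +++ h) w = \<dots>" .
  have "winding_number (g +++ l) w =
        1 / (2 * pi * \<i>) * contour_integral (g +++ l) (\<lambda>u. 1 / (u - w))"
    using g w wl by (intro winding_number_valid_path) (auto simp: path_image_join l_def B_def)
  also have "\<dots> = 1 / (2 * pi * \<i>) * (contour_integral g (\<lambda>u. 1 / (u - w)) + (Ln (w - A) - Ln (w - B)))"
    using g1 l1 g by (subst contour_integral_join) (auto simp: contour_integral_unique has_contour_integral_integrable l_def B_def)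
  finally have 2: "winding_number (g +++ l) w = \<dots>" .
  have "winding_number (g +++ h) w = winding_number (g +++ l) w - 1"
    unfolding 1 2 Ln by (simp add: field_simps)
  thus ?thesis by (simp add: l_def A_def B_def)
qed

text \<open>
  The path misses a ray on the real axis that contains $w$ and reaches infinity.
\<close>

lemma winding_number_left_ray_zero:
  assumes g: "valid_path g" "pathfinish g = pathstart g"
    and off: "\<And>u. u \<in> path_image g \<Longrightarrow> Im u = 0 \<Longrightarrow> Re u \<ge> R"
    and w: "Im w = 0" "Re w < R"
  shows "winding_number g w = 0"
proof -
  define L where "L = {u. Im u = 0 \<and> Re u < R}"
  have L: "L = {u. Im u \<le> 0} \<inter> {u. Im u \<ge> 0} \<inter> {u. Re u < R}" by (auto simp: L_def)
  have "convex L"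
    unfolding L by (intro convex_Int convex_halfspace_Re_lt convex_halfspace_Im_le convex_halfspace_Im_ge)
  hence "connected L" by (rule convex_connected)
  moreover have "L \<inter> path_image g = {}" using off by (force simp: L_def)
  ultimately have "winding_number g constant_on L"
    using g by (intro winding_number_constant) (auto simp: valid_path_imp_path)
  then obtain c where c: "\<And>u. u \<in> L \<Longrightarrow> winding_number g u = c" by (auto simp: constant_on_def)
  obtain B where B: "\<And>z. B \<le> norm z \<Longrightarrow> winding_number g z = 0"
    using winding_number_zero_at_infinity[OF valid_path_imp_path[OF g(1)] g(2)] by blast
  define v :: complex where "v = of_real (min (R - 1) (- \<bar>B\<bar>))"
  have "v \<in> L" "B \<le> norm v" by (auto simp: L_def v_def norm_of_real)
  with c B have "c = 0" by metis
  thus ?thesis using c w by (auto simp: L_def)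
qed

text \<open>
  Hake's theorem on the real line: an integral that converges as both limits of integration tend to
  infinity independently exists in the sense of Henstock and Kurzweil.
\<close>

lemma has_integral_UNIV_limit:
  fixes F :: "real \<Rightarrow> 'a :: real_normed_vector"
  assumes "\<And>\<epsilon>. \<epsilon> > 0 \<Longrightarrow>
    \<forall>\<^sub>F (s, t) in at_bot \<times>\<^sub>F at_top. \<exists>I. (F has_integral I) {s..t} \<and> norm (I - V) < \<epsilon>"
  shows "(F has_integral V) UNIV"
proof -
  have not_box: "\<nexists>a b. (UNIV :: real set) = cbox a b"
    by (metis bounded_cbox not_bounded_UNIV)
  show ?thesis
  proof (subst has_integral_alt, subst if_not_P[OF not_box], intro allI impI)
    fix \<epsilon> :: real assume "\<epsilon> > 0"
    from assms[OF this] obtain P Q where PQ: "eventually P at_bot" "eventually Q at_top"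
      "\<And>s t. P s \<Longrightarrow> Q t \<Longrightarrow> \<exists>I. (F has_integral I) {s..t} \<and> norm (I - V) < \<epsilon>"
      unfolding eventually_prod_filter by auto
    then obtain s0 t0 where st: "\<And>s t. s \<le> s0 \<Longrightarrow> t \<ge> t0 \<Longrightarrow> \<exists>I. (F has_integral I) {s..t} \<and> norm (I - V) < \<epsilon>"
      unfolding eventually_at_bot_linorder eventually_at_top_linorder by blast
    show "\<exists>B>0. \<forall>a b. ball 0 B \<subseteq> cbox a b \<longrightarrow>
        (\<exists>z. ((\<lambda>x. if x \<in> UNIV then F x else 0) has_integral z) (cbox a b) \<and> norm (z - V) < \<epsilon>)"
    proof (intro exI[of _ "\<bar>s0\<bar> + \<bar>t0\<bar> + 1"] conjI allI impI)
      fix a b :: real assume *: "ball 0 (\<bar>s0\<bar> + \<bar>t0\<bar> + 1) \<subseteq> cbox a b"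
      have "s0 \<in> ball 0 (\<bar>s0\<bar> + \<bar>t0\<bar> + 1)" "t0 \<in> ball 0 (\<bar>s0\<bar> + \<bar>t0\<bar> + 1)" by auto
      with * have "s0 \<in> cbox a b" "t0 \<in> cbox a b" by blast+
      hence "a \<le> s0" "t0 \<le> b" by auto
      from st[OF this] show "\<exists>z. ((\<lambda>x. if x \<in> UNIV then F x else 0) has_integral z) (cbox a b) \<and> norm (z - V) < \<epsilon>"
        by simp
    qed auto
  qed
qed

text \<open>
  Deformation of a loop into brackets. Join the truncation of $\gamma$ to $[s,t]$ with a bracket
  that is traversed backwards. The resulting closed path has winding number 0 about each pole: far to
  the left it does not meet the real axis at all, so that the left ray of the axis is connected to
  infinity there; for the finitely many remaining poles, moving the closing segment to their right
  changes the winding number 1 of the closed truncation into 0. By Cauchy's theorem the truncation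
  and the bracket have the same integral up to the two joining segments, and these are negligible
  where $f$ decays.
  
  The height $T$ may depend on $\varepsilon$. Hence the lemma applies with $T$ fixed if $f$ decays
  only in horizontal strips, and with $T\to\infty$ if the value is an integral over a vertical line.
\<close>

lemma loop_has_integral:
  fixes f :: "complex \<Rightarrow> complex" and S :: "complex set"
  assumes \<gamma>: "left_loop \<gamma>"
    and S: "closed S" "\<And>w. w \<in> S \<Longrightarrow> Im w = 0" "\<And>w. w \<in> S \<Longrightarrow> Re w < \<sigma>"
      "\<And>X. finite {w \<in> S. Re w \<ge> X}"
    and inside: "\<And>w. w \<in> S \<Longrightarrow> inside_loop \<gamma> w"
    and holo: "f holomorphic_on - S"
    and decay: "\<And>d D. 0 < d \<Longrightarrow> d \<le> D \<Longrightarrow>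
        \<exists>M X. \<forall>u. Re u \<le> X \<and> d \<le> \<bar>Im u\<bar> \<and> \<bar>Im u\<bar> \<le> D \<longrightarrow> cmod (f u) \<le> M * exp (Re u)"
    and approx: "\<And>\<epsilon>. \<epsilon> > 0 \<Longrightarrow>
        \<exists>T>0. \<forall>\<^sub>F X in at_bot. cmod (contour_integral (bracket T \<sigma> X) f - V) < \<epsilon>"
  shows "((\<lambda>t. f (\<gamma> t) * vector_derivative \<gamma> (at t)) has_integral V) UNIV"
proof -
  define F where "F = (\<lambda>t. f (\<gamma> t) * vector_derivative \<gamma> (at t))"
  have open_S: "open (- S)" using S(1) by auto
  obtain d D where d: "d > 0" and
    ev_bot: "\<forall>\<^sub>F t in at_bot. - D \<le> Im (\<gamma> t) \<and> Im (\<gamma> t) \<le> - d" and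
    ev_top: "\<forall>\<^sub>F t in at_top. d \<le> Im (\<gamma> t) \<and> Im (\<gamma> t) \<le> D"
    using \<gamma> unfolding left_loop_def by blast
  have Re_bot: "filterlim (\<lambda>t. Re (\<gamma> t)) at_bot at_bot"
    and Re_top: "filterlim (\<lambda>t. Re (\<gamma> t)) at_bot at_top"
    using \<gamma> by (auto simp: left_loop_def)
  obtain s0 where s0: "\<And>t. t \<le> s0 \<Longrightarrow> - D \<le> Im (\<gamma> t) \<and> Im (\<gamma> t) \<le> - d"
    using ev_bot by (auto simp: eventually_at_bot_linorder)
  obtain t0 where t0: "\<And>t. t \<ge> t0 \<Longrightarrow> d \<le> Im (\<gamma> t) \<and> Im (\<gamma> t) \<le> D"
    using ev_top by (auto simp: eventually_at_top_linorder)
  have dD: "d \<le> D" using t0[of t0] by auto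
  have s0t0: "s0 < t0" using s0[of t0] t0[of t0] d by (cases "s0 < t0") auto
  have "continuous_on {s0..t0} \<gamma>"
    using \<gamma> by (auto simp: left_loop_def piecewise_C1_differentiable_on_def)
  hence "bounded (\<gamma> ` {s0..t0})"
    by (intro compact_imp_bounded compact_continuous_image) auto
  then obtain B where B: "\<And>t. t \<in> {s0..t0} \<Longrightarrow> cmod (\<gamma> t) \<le> B"
    unfolding bounded_iff by blast
  \<comment> \<open>To the left of R the loop does not cross the real axis, as both tails stay away from it.\<close>
  define R where "R = min (- B) \<sigma>"
  have R: "R \<le> \<sigma>" "\<And>t. Im (\<gamma> t) = 0 \<Longrightarrow> Re (\<gamma> t) \<ge> R"
  proof -
    show "R \<le> \<sigma>" by (simp add: R_def)
    fix t assume t: "Im (\<gamma> t) = 0"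
    hence "t \<in> {s0..t0}" using s0[of t] t0[of t] d by (cases "t \<le> s0"; cases "t \<ge> t0") auto
    from B[OF this] show "Re (\<gamma> t) \<ge> R"
      using abs_Re_le_cmod[of "\<gamma> t"] by (simp add: R_def)
  qed
  define S1 where "S1 = {w \<in> S. Re w \<ge> R}"
  have "finite S1" using S(4)[of R] by (simp add: S1_def)
  hence ev_wind: "\<forall>\<^sub>F (s, t) in at_bot \<times>\<^sub>F at_top.
      \<forall>w\<in>S1. winding_number (closed_truncation \<gamma> s t) w = 1"
    using inside unfolding case_prod_unfold
    by (intro eventually_ball_finite) (auto simp: S1_def inside_loop_def case_prod_unfold)
  have \<gamma>_S: "\<gamma> t \<notin> S" for t
    using inside[of "\<gamma> t"] by (auto simp: inside_loop_def)
  have main: "\<forall>\<^sub>F (s, t) in at_bot \<times>\<^sub>F at_top. \<exists>I. (F has_integral I) {s..t} \<and> cmod (I - V) < \<epsilon>"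
    if \<epsilon>: "\<epsilon> > 0" for \<epsilon>
  proof -
    obtain T where T: "T > 0" and
      ap: "\<forall>\<^sub>F X in at_bot. cmod (contour_integral (bracket T \<sigma> X) f - V) < \<epsilon> / 3"
      using approx[of "\<epsilon> / 3"] \<epsilon> by auto
    \<comment> \<open>a strip that contains both the tails of the loop and the horizontal sides of the bracket\<close>
    define d' D' where "d' = min d T" and "D' = max D T"
    have d'D': "0 < d'" "d' \<le> D'" "d' \<le> d" "d' \<le> T" "D \<le> D'" "T \<le> D'"
      using d dD T by (auto simp: d'_def D'_def)
    obtain M X0 where MX0: "\<And>u. Re u \<le> X0 \<Longrightarrow> d' \<le> \<bar>Im u\<bar> \<Longrightarrow> \<bar>Im u\<bar> \<le> D' \<Longrightarrow>
        cmod (f u) \<le> M * exp (Re u)"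
      using decay[OF d'D'(1,2)] by blast
    define M' where "M' = max M 0"
    have M': "M' \<ge> 0" "\<And>u. Re u \<le> X0 \<Longrightarrow> d' \<le> \<bar>Im u\<bar> \<Longrightarrow> \<bar>Im u\<bar> \<le> D' \<Longrightarrow>
        cmod (f u) \<le> M' * exp (Re u)"
    proof -
      fix u assume "Re u \<le> X0" "d' \<le> \<bar>Im u\<bar>" "\<bar>Im u\<bar> \<le> D'"
      from MX0[OF this] have "cmod (f u) \<le> M * exp (Re u)" .
      also have "\<dots> \<le> M' * exp (Re u)" by (intro mult_right_mono) (auto simp: M'_def)
      finally show "cmod (f u) \<le> M' * exp (Re u)" .
    qed (auto simp: M'_def)
    have "((\<lambda>X. M' * exp X * (1 + 2 * D')) \<longlongrightarrow> M' * 0 * (1 + 2 * D')) at_bot"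
      by (intro tendsto_intros exp_at_bot)
    hence "\<forall>\<^sub>F X in at_bot. M' * exp X * (1 + 2 * D') < \<epsilon> / 3"
      using \<epsilon> by (intro order_tendstoD(2)) auto
    hence "\<forall>\<^sub>F X in at_bot. cmod (contour_integral (bracket T \<sigma> X) f - V) < \<epsilon> / 3 \<and>
        M' * exp X * (1 + 2 * D') < \<epsilon> / 3 \<and> X \<le> X0 \<and> X < R"
      using ap by (intro eventually_conj eventually_le_at_bot eventually_gt_at_bot) 
         (auto simp: eventually_at_bot_dense)
    \<comment> \<open>X is fixed from now on, and both ends of the truncation lie further to the left.\<close>
    then obtain X where X: "cmod (contour_integral (bracket T \<sigma> X) f - V) < \<epsilon> / 3"
        "M' * exp X * (1 + 2 * D') < \<epsilon> / 3" "X \<le> X0" "X < R"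
      by (auto simp: eventually_at_bot_linorder)
    have ev_s: "\<forall>\<^sub>F s in at_bot. s \<le> s0 \<and> Re (\<gamma> s) \<le> X"
      using Re_bot by (auto simp: filterlim_at_bot intro!: eventually_conj eventually_le_at_bot)
    have ev_t: "\<forall>\<^sub>F t in at_top. t \<ge> t0 \<and> Re (\<gamma> t) \<le> X"
      using Re_top by (auto simp: filterlim_at_bot intro!: eventually_conj eventually_ge_at_top)
    have "\<forall>\<^sub>F (s, t) in at_bot \<times>\<^sub>F at_top. (s \<le> s0 \<and> Re (\<gamma> s) \<le> X) \<and> (t \<ge> t0 \<and> Re (\<gamma> t) \<le> X)"
      unfolding eventually_prod_filter case_prod_unfold using ev_s ev_t by (intro exI conjI) auto
    with ev_wind show ?thesis
    proof (eventually_elim, clarify, goal_cases)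
      case (1 s t)
      have st: "s < t" using 1 s0t0 by simp
      have ims: "- D \<le> Im (\<gamma> s)" "Im (\<gamma> s) \<le> - d" and imt: "d \<le> Im (\<gamma> t)" "Im (\<gamma> t) \<le> D"
        using s0[of s] t0[of t] 1 by auto
      define g l1 l2 br where "g = subpath s t \<gamma>" and "l1 = linepath (\<gamma> t) (Complex X T)"
        and "l2 = linepath (Complex X (- T)) (\<gamma> s)" and "br = bracket T \<sigma> X"
      define h where "h = l1 +++ reversepath br +++ l2"
      have g [simp]: "valid_path g" "pathstart g = \<gamma> s" "pathfinish g = \<gamma> t"
        using valid_path_truncation[OF \<gamma> st] by (auto simp: g_def pathstart_def pathfinish_def subpath_def)
      have gi: "path_image g \<subseteq> range \<gamma>" by (auto simp: g_def path_image_def subpath_def)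
      have h [simp]: "valid_path h" "pathstart h = \<gamma> t" "pathfinish h = \<gamma> s"
        by (auto simp: h_def l1_def l2_def br_def intro!: valid_path_join)
      have l1: "Re u \<le> X" "d' \<le> Im u" "Im u \<le> D'" if "u \<in> path_image l1" for u
        using segment_in_halfplane[of u "\<gamma> t" "Complex X T"] that d'D' imt 1(2-) by (auto simp: l1_def)
      have l2: "Re u \<le> X" "Im u \<le> - d'" "- D' \<le> Im u" if "u \<in> path_image l2" for u
        using segment_in_halfplane[of u "Complex X (-T)" "\<gamma> s"] that d'D' ims 1(2-) by (auto simp: l2_def)
      have hi: "path_image h = path_image l1 \<union> path_image br \<union> path_image l2"
        by (auto simp: h_def path_image_join l1_def l2_def br_def)
      have real_h: "Re u = \<sigma>" if "u \<in> path_image h" "Im u = 0" for u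
        using that l1[of u] l2[of u] d'D' real_point_of_bracket[OF _ _ T, of u \<sigma> X] by (auto simp: hi br_def)
      have im: "path_image g \<subseteq> - S" "path_image l1 \<subseteq> - S" "path_image br \<subseteq> - S" "path_image l2 \<subseteq> - S"
        using gi \<gamma>_S real_h S(2,3) by (auto simp: hi)
      have int: "f contour_integrable_on g" "f contour_integrable_on l1" "f contour_integrable_on br"
         "f contour_integrable_on l2"
        using contour_integrable_holomorphic_simple[OF holo open_S _ im(1)]
         contour_integrable_holomorphic_simple[OF holo open_S _ im(2)]
         contour_integrable_holomorphic_simple[OF holo open_S _ im(3)]
         contour_integrable_holomorphic_simple[OF holo open_S _ im(4)]
        by (auto simp: l1_def l2_def br_def)
      have "(f has_contour_integral 0) (g +++ h)"
      proof (rule Cauchy_theorem_global[OF open_S holo])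
        show "path_image (g +++ h) \<subseteq> - S"
          using im by (auto simp: path_image_join hi)
        fix w assume "w \<notin> - S"
        hence w: "w \<in> S" "Im w = 0" "Re w < \<sigma>" using S by auto
        show "winding_number (g +++ h) w = 0"
        proof (cases "Re w < R")
          case True
          show ?thesis
            using gi real_h R w True
            by (intro winding_number_left_ray_zero[of _ R]) (force intro!: valid_path_join simp: path_image_join)+
        next
          case False
          hence "w \<in> S1" using w by (auto simp: S1_def)
          hence "winding_number (g +++ linepath (\<gamma> t) (\<gamma> s)) w = 1"
            using 1(1) by (auto simp: closed_truncation_def g_def)
          moreover have "winding_number (g +++ h) w = winding_number (g +++ linepath (pathfinish g) (pathstart g)) w - 1"
            using w im ims imt d 1 X False real_h
            by (intro winding_number_reroute) auto
          ultimately show ?thesis by simp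
        qed
      qed (auto intro!: valid_path_join)
      hence "contour_integral (g +++ h) f = 0" by (rule contour_integral_unique)
      also have "contour_integral (g +++ h) f =
          contour_integral g f + contour_integral l1 f - contour_integral br f + contour_integral l2 f"
        using int by (simp add: h_def l1_def l2_def br_def contour_integrable_reversepath
           contour_integral_reversepath)
      finally have eq: "contour_integral g f = contour_integral br f - contour_integral l1 f - contour_integral l2 f"
        by (simp add: algebra_simps)
      have b1: "cmod (contour_integral l1 f) \<le> M' * exp X * (1 + \<bar>Im (Complex X T) - Im (\<gamma> t)\<bar>)"
        using has_contour_integral_integral[OF int(2)] l1 M' X d'D' 1(2-)
        by (intro contour_integral_linepath_exp_bound[of f]) (force simp: l1_def)+
      also have "\<dots> \<le> M' * exp X * (1 + 2 * D')"
        using M' imt T d'D' d by (intro mult_left_mono) auto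
      finally have b1: "cmod (contour_integral l1 f) < \<epsilon> / 3" using X by linarith
      have b2: "cmod (contour_integral l2 f) \<le> M' * exp X * (1 + \<bar>Im (\<gamma> s) - Im (Complex X (-T))\<bar>)"
        using has_contour_integral_integral[OF int(4)] l2 M' X d'D' 1(2-)
        by (intro contour_integral_linepath_exp_bound[of f]) (force simp: l2_def)+
      also have "\<dots> \<le> M' * exp X * (1 + 2 * D')"
        using M' ims T d'D' d by (intro mult_left_mono) auto
      finally have b2: "cmod (contour_integral l2 f) < \<epsilon> / 3" using X by linarith
      have "contour_integral g f - V = (contour_integral br f - V) - contour_integral l1 f - contour_integral l2 f"
        by (simp add: eq)
      also have "cmod \<dots> \<le> cmod (contour_integral br f - V) + cmod (contour_integral l1 f) + cmod (contour_integral l2 f)"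
        by (intro order_trans[OF norm_triangle_ineq4] add_mono norm_triangle_ineq4) auto
      also have "\<dots> < \<epsilon>" using X(1) b1 b2 by (simp add: br_def)
      finally have "cmod (contour_integral g f - V) < \<epsilon>" .
      moreover have "(F has_integral contour_integral g f) {s..t}"
        unfolding F_def using has_contour_integral_integral[OF int(1)]
        by (intro has_integral_truncation[OF \<gamma> st]) (simp add: g_def)
      ultimately show ?case by blast
    qed
  qed
  have "(F has_integral V) UNIV"
    by (rule has_integral_UNIV_limit) (use main in auto)
  thus ?thesis by (simp add: F_def)
qed


section \<open>Loops around the poles of a rational function\<close>

text \<open>
  Each step of length 1 to the left gains a factor $1/e$. The weight $\rho$ carries a possible
  dependence on the height along.
\<close>

lemma left_decay:
  fixes f :: "complex \<Rightarrow> complex" and \<rho> :: "real \<Rightarrow> real"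
  assumes base: "\<And>u. Im u \<in> A \<Longrightarrow> X - 1 \<le> Re u \<Longrightarrow> Re u \<le> X \<Longrightarrow> cmod (f u) \<le> C * \<rho> (Im u)"
    and step: "\<And>u. Im u \<in> A \<Longrightarrow> Re u \<le> X \<Longrightarrow> cmod (f (u - 1)) \<le> exp (- 1) * cmod (f u)"
    and C: "C \<ge> 0" "\<And>y. y \<in> A \<Longrightarrow> \<rho> y \<ge> 0"
    and u: "Im u \<in> A" "Re u \<le> X"
  shows "cmod (f u) \<le> C * exp (1 - X) * \<rho> (Im u) * exp (Re u)"
proof -
  have *: "cmod (f u) \<le> C * \<rho> (Im u) * exp (- real m)"
    if "Im u \<in> A" "X - 1 - real m \<le> Re u" "Re u \<le> X - real m" for m u
    using that
  proof (induction m arbitrary: u)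
    case 0
    thus ?case using base[of u] by simp
  next
    case (Suc m)
    have "cmod (f (u + 1 - 1)) \<le> exp (- 1) * cmod (f (u + 1))"
      using Suc.prems by (intro step) auto
    also have "\<dots> \<le> exp (- 1) * (C * \<rho> (Im (u + 1)) * exp (- real m))"
      using Suc.prems by (intro mult_left_mono Suc.IH) auto
    also have "\<dots> = C * \<rho> (Im u) * exp (- real (Suc m))"
      by (simp flip: exp_add)
    finally show ?case by simp
  qed
  define m where "m = nat \<lfloor>X - Re u\<rfloor>"
  have m: "real m \<le> X - Re u" "X - Re u \<le> real m + 1"
    using u by (auto simp: m_def)
  have "cmod (f u) \<le> C * \<rho> (Im u) * exp (- real m)"
    using m u by (intro *) auto
  also have "\<dots> \<le> C * \<rho> (Im u) * exp (1 - X + Re u)"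
    using m C u by (intro mult_left_mono) auto
  finally show ?thesis by (simp add: exp_add mult_ac)
qed

text \<open>
  A step from $u$ to $u-1$ multiplies the function by $z/(c+1-u)$, which is smaller than $1/e$ far to
  the left. There are no poles, so the strip may contain the real axis.
\<close>

lemma rGamma_powr_left_decay:
  assumes z: "z > 0"
  shows "\<exists>M X. M \<ge> 0 \<and> (\<forall>u. Re u \<le> X \<and> \<bar>Im u\<bar> \<le> D \<longrightarrow>
           cmod (rGamma (of_real (c + 1) - u) * of_real z powr (- u)) \<le> M * exp (Re u))"
proof -
  define h where "h = (\<lambda>u. rGamma (of_real (c + 1) - u) * of_real z powr (- u) :: complex)"
  \<comment> \<open>For Re u at most X, the factor z/(c+1-u) has modulus at most 1/e.\<close>
  define X where "X = c + 1 - exp 1 * z"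
  define W where "W = (\<lambda>(x, y). Complex x y) ` ({X - 1..X} \<times> {- D..D})"
  have "compact W"
    unfolding W_def by (intro compact_continuous_image compact_Times)
      (auto simp: case_prod_unfold intro!: continuous_intros)
  moreover have "continuous_on W h"
    using z unfolding h_def by (intro holomorphic_on_imp_continuous_on holomorphic_intros) auto
  ultimately have "bounded (h ` W)"
    by (intro compact_imp_bounded compact_continuous_image)
  then obtain C where C: "\<And>u. u \<in> W \<Longrightarrow> cmod (h u) \<le> C"
    unfolding bounded_iff by blast
  have step: "cmod (h (u - 1)) \<le> exp (- 1) * cmod (h u)" if "Re u \<le> X" for u
  proof -
    define v where "v = of_real (c + 1) - u"
    have "exp 1 * z \<le> Re v" using that by (simp add: v_def X_def)
    hence v: "exp 1 * z \<le> cmod v" using complex_Re_le_cmod order_trans by blast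
    have "exp 1 * z > 0" using z by simp
    with v have v0: "v \<noteq> 0" "cmod v > 0" by auto
    have "h (u - 1) = rGamma (of_real (c + 1) - (u - 1)) * of_real z powr (- (u - 1))"
      by (simp add: h_def)
    also have "of_real (c + 1) - (u - 1) = v + 1" by (simp add: v_def)
    also have "of_real z powr (- (u - 1)) = of_real z powr (- u) * (of_real z :: complex)"
      using z powr_add[of "of_real z :: complex" "- u" 1] by (simp add: algebra_simps)
    also have "rGamma (v + 1) = rGamma v / v" using v0 rGamma_plus1[of v] by (auto simp: field_simps)
    also have "rGamma v / v * (of_real z powr (- u) * of_real z) = h u * (of_real z / v)"
      by (simp add: h_def v_def)
    finally have "h (u - 1) = h u * (of_real z / v)" .
    hence "cmod (h (u - 1)) = cmod (h u) * (z / cmod v)"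
      using z by (simp add: norm_mult norm_divide)
    also have "\<dots> \<le> cmod (h u) * exp (- 1)"
      using v v0 by (intro mult_left_mono) (auto simp: exp_minus field_simps)
    finally show ?thesis by (simp add: mult_ac)
  qed
  have "cmod (h u) \<le> (max C 0 * exp (1 - X)) * exp (Re u)" if "Re u \<le> X \<and> \<bar>Im u\<bar> \<le> D" for u
  proof -
    have "cmod (h u) \<le> max C 0 * exp (1 - X) * 1 * exp (Re u)"
    proof (rule left_decay[where A = "{-D..D}" and \<rho> = "\<lambda>_. 1"])
      fix u assume "Im u \<in> {- D..D}" "X - 1 \<le> Re u" "Re u \<le> X"
      hence "u \<in> W" by (auto simp: W_def image_iff complex_eq_iff intro!: bexI[of _ "Re u"] bexI[of _ "Im u"])
      from C[OF this] show "cmod (h u) \<le> max C 0 * 1" by simp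
    qed (use step that in auto)
    thus ?thesis by simp
  qed
  thus ?thesis unfolding h_def by (intro exI[of _ "max C 0 * exp (1 - X)"] exI[of _ X]) auto
qed

lemma contour_integral_rectpath_bracket:
  assumes "f contour_integrable_on rectpath (Complex X (-T)) (Complex \<sigma> T)"
  shows "contour_integral (bracket T \<sigma> X) f =
           contour_integral (rectpath (Complex X (-T)) (Complex \<sigma> T)) f
           - contour_integral (linepath (Complex X T) (Complex X (-T))) f"
    and "f contour_integrable_on linepath (Complex X T) (Complex X (-T))"
  using assms by (simp_all add: rectpath_def bracket_def Let_def valid_path_join)

text \<open>
  If $f$ decays across the real axis too, then the fourth side of the rectangle may be added to the
  bracket.
\<close>

lemma loop_has_integral_rectangles:
  fixes f :: "complex \<Rightarrow> complex"
  assumes \<gamma>: "left_loop \<gamma>"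
    and S: "closed S" "\<And>w. w \<in> S \<Longrightarrow> Im w = 0" "\<And>w. w \<in> S \<Longrightarrow> Re w < \<sigma>"
      "\<And>X. finite {w \<in> S. Re w \<ge> X}"
    and inside: "\<And>w. w \<in> S \<Longrightarrow> inside_loop \<gamma> w"
    and holo: "f holomorphic_on - S"
    and decay: "\<And>D. \<exists>M X. \<forall>u. Re u \<le> X \<and> \<bar>Im u\<bar> \<le> D \<longrightarrow> cmod (f u) \<le> M * exp (Re u)"
    and V: "\<And>X. X < X0 \<Longrightarrow> (f has_contour_integral V) (rectpath (Complex X (-1)) (Complex \<sigma> 1))"
  shows "((\<lambda>t. f (\<gamma> t) * vector_derivative \<gamma> (at t)) has_integral V) UNIV"
proof (rule loop_has_integral[OF \<gamma> S inside holo])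
  show "\<exists>M X. \<forall>u. Re u \<le> X \<and> d \<le> \<bar>Im u\<bar> \<and> \<bar>Im u\<bar> \<le> D \<longrightarrow> cmod (f u) \<le> M * exp (Re u)" for d D
    using decay[of D] by blast
next
  fix \<epsilon> :: real assume \<epsilon>: "\<epsilon> > 0"
  obtain M X1 where M: "\<And>u. Re u \<le> X1 \<Longrightarrow> \<bar>Im u\<bar> \<le> 1 \<Longrightarrow> cmod (f u) \<le> M * exp (Re u)"
    using decay[of 1] by blast
  have M0: "M \<ge> 0"
    using order_trans[OF norm_ge_zero M[of "of_real X1"]] by (simp add: zero_le_mult_iff not_le)
  have "((\<lambda>X. M * exp X * 3) \<longlongrightarrow> M * 0 * 3) at_bot"
    by (intro tendsto_intros exp_at_bot)
  hence "\<forall>\<^sub>F X in at_bot. M * exp X * 3 < \<epsilon>" using \<epsilon> by (intro order_tendstoD(2)) auto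
  with eventually_gt_at_bot[of X0] eventually_le_at_bot[of X1]
  have "\<forall>\<^sub>F X in at_bot. cmod (contour_integral (bracket 1 \<sigma> X) f - V) < \<epsilon>"
  proof eventually_elim
    case (elim X)
    let ?l = "linepath (Complex X 1) (Complex X (-1))"
    note V' = V[OF elim(1)]
    note * = contour_integral_rectpath_bracket[OF has_contour_integral_integrable[OF V']]
    have "cmod (contour_integral ?l f) \<le> M * exp X * (1 + \<bar>Im (Complex X (-1)) - Im (Complex X 1)\<bar>)"
    proof (rule contour_integral_linepath_exp_bound[OF has_contour_integral_integral[OF *(2)]])
      fix u assume "u \<in> closed_segment (Complex X 1) (Complex X (-1))"
      hence "Re u \<le> X" "\<bar>Im u\<bar> \<le> 1"
        using segment_in_halfplane(1)[of u "Complex X 1" "Complex X (-1)" X]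
          segment_in_halfplane(2)[of u "Complex X 1" "Complex X (-1)" "-1"]
          segment_in_halfplane(3)[of u "Complex X 1" "Complex X (-1)" 1] by simp_all
      thus "cmod (f u) \<le> M * exp (Re u)" using elim by (intro M) auto
    qed (use M0 in auto)
    thus ?case using elim(3) unfolding *(1) contour_integral_unique[OF V'] by simp
  qed
  thus "\<exists>T>0. \<forall>\<^sub>F X in at_bot. cmod (contour_integral (bracket T \<sigma> X) f - V) < \<epsilon>"
    by (intro exI[of _ 1]) auto
qed

lemma loop_integral_rGamma_powr:
  fixes c z :: real
  assumes \<gamma>: "left_loop \<gamma>" and z: "z > 0" 
  defines "h \<equiv> \<lambda>u. rGamma (of_real (c + 1) - u) * of_real z powr (- u) :: complex"
  shows "((\<lambda>t. h (\<gamma> t) * vector_derivative \<gamma> (at t)) has_integral 0) UNIV"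
    and "inside_loop \<gamma> (- of_nat k) \<Longrightarrow>
         ((\<lambda>t. h (\<gamma> t) / (\<gamma> t + of_nat k) * vector_derivative \<gamma> (at t)) has_integral
           2 * of_real pi * \<i> * (rGamma (of_real (c + 1 + real k)) * of_real z ^ k)) UNIV"
proof -
  have holh: "h holomorphic_on A" for A
    unfolding h_def using z by (intro holomorphic_intros) auto
  have decay: "\<exists>M X. M \<ge> 0 \<and> (\<forall>u. Re u \<le> X \<and> \<bar>Im u\<bar> \<le> D \<longrightarrow> cmod (h u) \<le> M * exp (Re u))" for D
    unfolding h_def by (rule rGamma_powr_left_decay[OF z])
  show "((\<lambda>t. h (\<gamma> t) * vector_derivative \<gamma> (at t)) has_integral 0) UNIV"
  proof (rule loop_has_integral_rectangles[OF \<gamma>, where S = "{}" and \<sigma> = 1 and ?X0.0 = 0])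
    show "\<exists>M X. \<forall>u. Re u \<le> X \<and> \<bar>Im u\<bar> \<le> D \<longrightarrow> cmod (h u) \<le> M * exp (Re u)" for D
      using decay[of D] by blast
    show "(h has_contour_integral 0) (rectpath (Complex X (- 1)) (Complex 1 1))" for X
      using holh[of UNIV] by (intro Cauchy_theorem_convex_simple[of _ UNIV]) auto
  qed (use holh in auto)
  show "((\<lambda>t. h (\<gamma> t) / (\<gamma> t + of_nat k) * vector_derivative \<gamma> (at t)) has_integral
           2 * of_real pi * \<i> * (rGamma (of_real (c + 1 + real k)) * of_real z ^ k)) UNIV"
    if inside: "inside_loop \<gamma> (- of_nat k)"
  proof (rule loop_has_integral_rectangles[OF \<gamma>, where S = "{- of_nat k}" and \<sigma> = 1 and ?X0.0 = "- real k"])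
    fix D
    obtain M X where M: "M \<ge> 0" "\<And>u. Re u \<le> X \<Longrightarrow> \<bar>Im u\<bar> \<le> D \<Longrightarrow> cmod (h u) \<le> M * exp (Re u)"
      using decay[of D] by blast
    show "\<exists>M X. \<forall>u. Re u \<le> X \<and> \<bar>Im u\<bar> \<le> D \<longrightarrow> cmod (h u / (u + of_nat k)) \<le> M * exp (Re u)"
    proof (rule exI[of _ M], rule exI[of _ "min X (- real k - 1)"], intro allI impI, elim conjE)
      fix u assume u: "Re u \<le> min X (- real k - 1)" "\<bar>Im u\<bar> \<le> D"
      have "1 \<le> cmod (u + of_nat k)" using abs_Re_le_cmod[of "u + of_nat k"] u by simp
      hence "cmod (h u / (u + of_nat k)) \<le> M * exp (Re u) / 1"
        unfolding norm_divide using M u by (intro frac_le) auto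
      thus "cmod (h u / (u + of_nat k)) \<le> M * exp (Re u)" by simp
    qed
  next
    fix X assume X: "X < - real k"
    let ?R = "rectpath (Complex X (- 1)) (Complex 1 1)"
    have k: "- of_nat k \<in> box (Complex X (-1)) (Complex 1 1)"
      using X by (simp add: in_box_complex_iff)
    hence "- of_nat k \<notin> path_image ?R"
      using X by (subst path_image_rectpath_cbox_minus_box) auto
    moreover have "h (- of_nat k) = rGamma (of_real (c + 1 + real k)) * of_real z ^ k"
      using z by (simp add: h_def powr_nat')
    ultimately show "((\<lambda>u. h u / (u + of_nat k)) has_contour_integral
        2 * of_real pi * \<i> * (rGamma (of_real (c + 1 + real k)) * of_real z ^ k)) ?R"
      using Cauchy_integral_formula_convex_simple[of UNIV h "- of_nat k" ?R] holh[of UNIV]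
        winding_number_rectpath[OF k] by auto
  next
    show "(\<lambda>u. h u / (u + of_nat k)) holomorphic_on - {- of_nat k}"
      by (intro holomorphic_intros holh) (auto simp: add_eq_0_iff)
  qed (use inside in auto)
qed


section \<open>Decay of the Gamma function\<close>

lemma norm_Gamma_le:
  assumes "Re v > 0"
  shows "cmod (Gamma v) \<le> Gamma (Re v)"
proof -
  have 1: "((\<lambda>t. of_real t powr (v - 1) / of_real (exp t)) has_integral Gamma v) {0..}"
    by (rule Gamma_integral_complex[OF assms])
  have 2: "((\<lambda>t. t powr (Re v - 1) / exp t) has_integral Gamma (Re v)) {0..}"
    by (rule Gamma_integral_real[OF assms])
  have "norm (integral {0..} (\<lambda>t. of_real t powr (v - 1) / of_real (exp t) :: complex))
          \<le> integral {0..} (\<lambda>t. t powr (Re v - 1) / exp t)"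
    using 1 2 by (intro integral_norm_bound_integral)
      (auto simp: norm_divide norm_powr_real_powr norm_exp_eq_Re)
  thus ?thesis using 1 2 by (simp add: integral_unique)
qed

lemma not_nonpos_Int_if_Im: "Im v \<noteq> 0 \<Longrightarrow> v \<notin> \<int>\<^sub>\<le>\<^sub>0"
  by (auto elim!: nonpos_Ints_cases)

lemma not_nonpos_Int_if_Re: "Re v > 0 \<Longrightarrow> v \<notin> \<int>\<^sub>\<le>\<^sub>0"
  by (auto elim!: nonpos_Ints_cases)

text \<open>
  The functional equation moves $v$ into the right half-plane at the cost of dividing by a Pochhammer
  symbol. All its factors have modulus at least $|\mathrm{Im}\,v|$; one of them is kept for the
  decay, and $d$ bounds the others from below.
\<close>

lemma Gamma_strip_bound:
  fixes x1 x2 d :: real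
  assumes d: "d > 0"
  shows "\<exists>C\<ge>0. \<forall>v. x1 \<le> Re v \<and> Re v \<le> x2 \<and> d \<le> \<bar>Im v\<bar> \<longrightarrow> cmod (Gamma v) \<le> C / \<bar>Im v\<bar>"
proof -
  define N where "N = nat \<lceil>1 - x1\<rceil>"
  have N: "x1 + real (Suc N) \<ge> 1" by (simp add: N_def) linarith
  have "compact ((\<lambda>x. Gamma x :: real) ` {x1 + real (Suc N)..x2 + real (Suc N)})"
    using N by (intro compact_continuous_image continuous_intros) (auto elim!: nonpos_Ints_cases)
  from compact_imp_bounded[OF this] obtain B where
    "\<forall>y\<in>(\<lambda>x. Gamma x :: real) ` {x1 + real (Suc N)..x2 + real (Suc N)}. norm y \<le> B"
    unfolding bounded_iff by blast
  hence B: "\<And>x. x \<in> {x1 + real (Suc N)..x2 + real (Suc N)} \<Longrightarrow> \<bar>Gamma x\<bar> \<le> B" by auto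
  have "cmod (Gamma v) \<le> (\<bar>B\<bar> / d ^ N) / \<bar>Im v\<bar>"
    if v: "x1 \<le> Re v" "Re v \<le> x2" "d \<le> \<bar>Im v\<bar>" for v
  proof -
    have "v \<notin> \<int>\<^sub>\<le>\<^sub>0" using v d by (intro not_nonpos_Int_if_Im) auto
    hence P: "pochhammer v (Suc N) = Gamma (v + of_nat (Suc N)) / Gamma v" and G0: "Gamma v \<noteq> 0"
      using pochhammer_Gamma[of v "Suc N"] by (auto simp: Gamma_eq_zero_iff simp del: of_nat_Suc pochhammer_Suc)
    have "cmod (pochhammer v (Suc N)) = (\<Prod>j\<in>{0..<Suc N}. cmod (v + of_nat j))"
      by (simp add: pochhammer_prod prod_norm)
    also have "\<dots> \<ge> (\<Prod>j\<in>{0..<Suc N}. \<bar>Im v\<bar>)"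
      using abs_Im_le_cmod[of "v + of_nat j" for j] by (intro prod_mono) auto
    finally have "\<bar>Im v\<bar> * \<bar>Im v\<bar> ^ N \<le> cmod (pochhammer v (Suc N))" by simp
    moreover have "d ^ N * \<bar>Im v\<bar> \<le> \<bar>Im v\<bar> * \<bar>Im v\<bar> ^ N"
      using v d power_mono[of d "\<bar>Im v\<bar>" N] by (simp add: mult.commute mult_left_mono)
    ultimately have le: "d ^ N * \<bar>Im v\<bar> \<le> cmod (pochhammer v (Suc N))" by linarith
    have pos: "d ^ N * \<bar>Im v\<bar> > 0" using v d by auto
    have "Gamma v = Gamma (v + of_nat (Suc N)) / pochhammer v (Suc N)"
    proof -
      have "pochhammer v (Suc N) \<noteq> 0" using le pos by (metis norm_zero not_le)
      moreover have "Gamma v * pochhammer v (Suc N) = Gamma (v + of_nat (Suc N))"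
        unfolding P using G0 by simp
      ultimately show ?thesis by (rule eq_divide_imp)
    qed
    hence "cmod (Gamma v) = cmod (Gamma (v + of_nat (Suc N))) / cmod (pochhammer v (Suc N))"
      by (simp add: norm_divide)
    also have "\<dots> \<le> \<bar>B\<bar> / (d ^ N * \<bar>Im v\<bar>)"
    proof (intro frac_le pos le)
      have "cmod (Gamma (v + of_nat (Suc N))) \<le> Gamma (Re (v + of_nat (Suc N)))"
        using v N by (intro norm_Gamma_le) auto
      also have "\<dots> \<le> \<bar>B\<bar>" using B[of "Re (v + of_nat (Suc N))"] v by auto
      finally show "cmod (Gamma (v + of_nat (Suc N))) \<le> \<bar>B\<bar>" .
    qed auto
    finally show ?thesis by simp
  qed
  moreover have "\<bar>B\<bar> / d ^ N \<ge> 0" using d by simp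
  ultimately show ?thesis by blast
qed

text \<open>
  In comparison with \<open>rGamma_powr_left_decay\<close> the real axis with the poles has to be avoided, but
  the bound holds at every height and tends to 0 with growing height. The latter is what permits
  $T\to\infty$ in a bracket.
\<close>

lemma Gamma_powr_left_decay:
  fixes z d \<sigma> c :: real
  assumes z: "z > 0" and d: "d > 0"
  shows "\<exists>M\<ge>0. \<forall>u. Re u \<le> \<sigma> \<and> d \<le> \<bar>Im u\<bar> \<longrightarrow>
           cmod (Gamma (u - of_real c) * of_real z powr (- u)) \<le> M * exp (Re u) / \<bar>Im u\<bar>"
proof -
  define h where "h = (\<lambda>u. Gamma (u - of_real c) * of_real z powr (- u) :: complex)"
  \<comment> \<open>For Re u at most X, the step from u to u-1 multiplies by z/(u-1-c), of modulus at most 1/e.\<close>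
  define X where "X = min (c + 1 - exp 1 * z) \<sigma>"
  obtain C where C: "C \<ge> 0" "\<And>v. X - 1 - c \<le> Re v \<Longrightarrow> Re v \<le> \<sigma> - c \<Longrightarrow> d \<le> \<bar>Im v\<bar> \<Longrightarrow> cmod (Gamma v) \<le> C / \<bar>Im v\<bar>"
    using Gamma_strip_bound[OF d, of "X - 1 - c" "\<sigma> - c"] by blast
  have "compact ((\<lambda>x. z powr (- x)) ` {X - 1..\<sigma>})"
    using z by (intro compact_continuous_image continuous_intros) auto
  from compact_imp_bounded[OF this] obtain B where
    "\<forall>y\<in>(\<lambda>x. z powr (- x)) ` {X - 1..\<sigma>}. norm y \<le> B"
    unfolding bounded_iff by blast
  hence B: "\<And>x. X - 1 \<le> x \<Longrightarrow> x \<le> \<sigma> \<Longrightarrow> z powr (-x) \<le> B" by auto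
  have B0: "B \<ge> 0" using order_trans[OF powr_ge_zero B[of \<sigma>]] by (auto simp: X_def)
  have base: "cmod (h u) \<le> C * B * (1 / \<bar>Im u\<bar>)"
    if "X - 1 \<le> Re u" "Re u \<le> \<sigma>" "d \<le> \<bar>Im u\<bar>" for u
  proof -
    have "cmod (h u) = cmod (Gamma (u - of_real c)) * z powr (- Re u)"
      using z by (simp add: h_def norm_mult norm_powr_real_powr)
    also have "\<dots> \<le> C / \<bar>Im (u - of_real c)\<bar> * B"
      using that C(1) C(2)[of "u - of_real c"] B[of "Re u"] by (intro mult_mono) auto
    finally show ?thesis by simp
  qed
  have step: "cmod (h (u - 1)) \<le> exp (- 1) * cmod (h u)" if u: "Re u \<le> X" "d \<le> \<bar>Im u\<bar>" for u
  proof -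
    define v where "v = u - 1 - of_real c"
    have "exp 1 * z \<le> - Re v" using u by (simp add: v_def X_def)
    also have "\<dots> \<le> cmod v" using abs_Re_le_cmod[of v] by linarith
    finally have v: "exp 1 * z \<le> cmod v" .
    have "v \<notin> \<int>\<^sub>\<le>\<^sub>0" using u d by (intro not_nonpos_Int_if_Im) (auto simp: v_def)
    hence G: "Gamma (v + 1) = v * Gamma v" by (rule Gamma_plus1)
    have "Im v = Im u" by (simp add: v_def)
    hence v0: "v \<noteq> 0" using u d by auto
    have "h (u - 1) = Gamma v * of_real z powr (- (u - 1))"
      by (simp add: h_def v_def)
    also have "of_real z powr (- (u - 1)) = of_real z powr (- u) * (of_real z :: complex)"
      using z powr_add[of "of_real z :: complex" "- u" 1] by (simp add: algebra_simps)
    also have "Gamma v = Gamma (v + 1) / v" using G v0 by simp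
    also have "v + 1 = u - of_real c" by (simp add: v_def)
    also have "Gamma (u - of_real c) / v * (of_real z powr (- u) * of_real z) = h u * (of_real z / v)"
      by (simp add: h_def)
    finally have "h (u - 1) = h u * (of_real z / v)" .
    hence "cmod (h (u - 1)) = cmod (h u) * (z / cmod v)"
      using z by (simp add: norm_mult norm_divide)
    also have "\<dots> \<le> cmod (h u) * exp (- 1)"
      using v v0 by (intro mult_left_mono) (auto simp: exp_minus field_simps)
    finally show ?thesis by (simp add: mult_ac)
  qed
  have "cmod (h u) \<le> (C * B * exp (1 - X)) * exp (Re u) / \<bar>Im u\<bar>" if u: "Re u \<le> \<sigma>" "d \<le> \<bar>Im u\<bar>" for u
  proof (cases "Re u \<le> X")
    case True
    have "cmod (h u) \<le> C * B * exp (1 - X) * (1 / \<bar>Im u\<bar>) * exp (Re u)"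
      by (rule left_decay[where A = "{y. d \<le> \<bar>y\<bar>}" and \<rho> = "\<lambda>y. 1 / \<bar>y\<bar>" and C = "C * B"])
         (use base step True u C(1) B0 in \<open>auto simp: X_def\<close>)
    thus ?thesis by (simp add: mult_ac)
  next
    case False
    have "cmod (h u) \<le> C * B * (1 / \<bar>Im u\<bar>)" using False u by (intro base) auto
    also have "\<dots> \<le> (C * B * (1 / \<bar>Im u\<bar>)) * exp (1 - X + Re u)"
      using False C(1) B0 mult_left_mono[of 1 "exp (1 - X + Re u)" "C * B * (1 / \<bar>Im u\<bar>)"] by auto
    finally show ?thesis by (simp add: exp_add mult_ac)
  qed
  moreover have "C * B * exp (1 - X) \<ge> 0" using C(1) B0 by simp
  ultimately show ?thesis unfolding h_def by blast
qed

lemma integrable_inverse_1_plus_square: "integrable lborel (\<lambda>t::real. inverse (1 + t\<^sup>2))"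
proof -
  have "set_integrable lborel (einterval (-\<infinity>) \<infinity>) (\<lambda>t::real. inverse (1 + t\<^sup>2))"
  proof (rule interval_integral_FTC_nonneg(1)[where F = arctan and A = "- pi/2" and B = "pi/2"])
    show "isCont (\<lambda>t. inverse (1 + t\<^sup>2)) x" for x :: real
      by (intro continuous_intros) (auto simp: add_nonneg_eq_0_iff)
    show "((arctan \<circ> real_of_ereal) \<longlongrightarrow> - pi / 2) (at_right (- \<infinity>))"
      using tendsto_arctan_at_bot by (simp add: ereal_tendsto_simps)
    show "((arctan \<circ> real_of_ereal) \<longlongrightarrow> pi / 2) (at_left \<infinity>)"
      using tendsto_arctan_at_top by (simp add: ereal_tendsto_simps)
  qed (auto intro!: derivative_eq_intros)
  thus ?thesis by (simp add: einterval_def set_integrable_def)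
qed

text \<open>
  Two steps of the functional equation show that $\Gamma(\tau+it)$ decays like $t^{-2}$.
\<close>

lemma integrable_Gamma_vertical:
  assumes \<tau>: "\<tau> > 0"
  shows "integrable lborel (\<lambda>t. Gamma (Complex \<tau> t))"
proof -
  define K where "K = Gamma (\<tau> + 2) / min 1 (\<tau>\<^sup>2)"
  have "integrable lborel (\<lambda>t. K * inverse (1 + t\<^sup>2))"
    by (intro integrable_mult_right integrable_inverse_1_plus_square)
  thus ?thesis
  proof (rule Bochner_Integration.integrable_bound)
    have "continuous_on UNIV (\<lambda>t. Gamma (Complex \<tau> t))"
      using \<tau> by (intro continuous_on_compose2[OF continuous_on_Gamma[of "{u. Re u > 0}"]])
        (auto simp: Complex_eq intro!: continuous_intros dest: not_nonpos_Int_if_Re)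
    thus "(\<lambda>t. Gamma (Complex \<tau> t)) \<in> borel_measurable lborel"
      by (simp add: borel_measurable_continuous_onI)
    show "AE t in lborel. norm (Gamma (Complex \<tau> t)) \<le> norm (K * inverse (1 + t\<^sup>2))"
    proof (rule AE_I2)
      fix t :: real
      let ?v = "Complex \<tau> t"
      have v: "?v \<notin> \<int>\<^sub>\<le>\<^sub>0" "?v + 1 \<notin> \<int>\<^sub>\<le>\<^sub>0" using \<tau> by (auto intro!: not_nonpos_Int_if_Re)
      have G: "Gamma (?v + 2) = (?v + 1) * (?v * Gamma ?v)"
        using Gamma_plus1[OF v(1)] Gamma_plus1[OF v(2)] by (simp add: add.assoc)
      have "(cmod ?v)\<^sup>2 * cmod (Gamma ?v) \<le> cmod (?v + 1) * (cmod ?v * cmod (Gamma ?v))"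
      proof -
        have "cmod ?v \<le> cmod (?v + 1)"
          using \<tau> by (simp add: cmod_def power2_eq_square algebra_simps)
        hence "cmod ?v * (cmod ?v * cmod (Gamma ?v)) \<le> cmod (?v + 1) * (cmod ?v * cmod (Gamma ?v))"
          by (intro mult_right_mono) auto
        thus ?thesis by (simp add: power2_eq_square mult_ac)
      qed
      also have "\<dots> = cmod (Gamma (?v + 2))" by (simp add: G norm_mult)
      also have "\<dots> \<le> Gamma (Re (?v + 2))" using \<tau> by (intro norm_Gamma_le) auto
      finally have 1: "(\<tau>\<^sup>2 + t\<^sup>2) * cmod (Gamma ?v) \<le> Gamma (\<tau> + 2)"
        by (simp add: cmod_power2)
      have "min 1 (\<tau>\<^sup>2) * (1 + t\<^sup>2) \<le> \<tau>\<^sup>2 + t\<^sup>2"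
        using mult_right_mono[of "\<tau>\<^sup>2" 1 "t\<^sup>2"] by (auto simp: algebra_simps min_def)
      hence "min 1 (\<tau>\<^sup>2) * (1 + t\<^sup>2) * cmod (Gamma ?v) \<le> (\<tau>\<^sup>2 + t\<^sup>2) * cmod (Gamma ?v)"
        by (rule mult_right_mono) auto
      with 1 have "min 1 (\<tau>\<^sup>2) * (1 + t\<^sup>2) * cmod (Gamma ?v) \<le> Gamma (\<tau> + 2)" by linarith
      moreover have "min 1 (\<tau>\<^sup>2) > 0" "1 + t\<^sup>2 > 0" using \<tau> by (auto simp: add_pos_nonneg)
      ultimately have "cmod (Gamma ?v) \<le> K * inverse (1 + t\<^sup>2)"
        using pos_le_divide_eq[of "min 1 (\<tau>\<^sup>2) * (1 + t\<^sup>2)" "cmod (Gamma ?v)" "Gamma (\<tau> + 2)"]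
        by (simp add: K_def mult_ac divide_inverse zero_less_mult_iff del: min_less_iff_conj)
      thus "norm (Gamma ?v) \<le> norm (K * inverse (1 + t\<^sup>2))" by simp
    qed
  qed
qed


section \<open>From loops to vertical lines\<close>

text \<open>
  The horizontal sides are of size $O(1/T)$ uniformly in $X$. Hence the bracket can be chosen before
  its left end is sent to $-\infty$.
\<close>

lemma bracket_tendsto_vertical:
  fixes f :: "complex \<Rightarrow> complex"
  assumes S: "closed S" "\<And>w. w \<in> S \<Longrightarrow> Im w = 0" "\<And>w. w \<in> S \<Longrightarrow> Re w < \<sigma>"
    and holo: "f holomorphic_on - S"
    and bound: "M \<ge> 0" "\<And>u. Re u \<le> \<sigma> \<Longrightarrow> 1 \<le> \<bar>Im u\<bar> \<Longrightarrow> cmod (f u) \<le> M * exp (Re u) / \<bar>Im u\<bar>"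
    and int: "integrable lborel (\<lambda>t. f (Complex \<sigma> t))"
    and \<epsilon>: "\<epsilon> > 0"
  shows "\<exists>T>0. \<forall>X\<le>\<sigma>. cmod (contour_integral (bracket T \<sigma> X) f - \<i> * (LBINT t. f (Complex \<sigma> t))) < \<epsilon>"
proof -
  define J where "J = (LBINT t. f (Complex \<sigma> t))"
  have J: "((\<lambda>t. f (Complex \<sigma> t)) has_integral J) UNIV"
    unfolding J_def by (rule has_integral_integral_lborel[OF int])
  have not_box: "\<nexists>a b. (UNIV :: real set) = cbox a b"
    by (metis bounded_cbox not_bounded_UNIV)
  obtain B where B: "B > 0" "\<And>a b. ball 0 B \<subseteq> cbox a b \<Longrightarrow>
      \<exists>z. ((\<lambda>t. f (Complex \<sigma> t)) has_integral z) (cbox a b) \<and> norm (z - J) < \<epsilon> / 3"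
    using has_integral_altD[OF J not_box, of "\<epsilon> / 3"] \<epsilon> by auto
  \<comment> \<open>T makes the two horizontal sides, each at most M exp(\<sigma>)/T, and the missing tails of the vertical line small.\<close>
  define T where "T = max B (max 1 (3 * (M * exp \<sigma> + 1) / \<epsilon>))"
  have T: "T \<ge> B" "T \<ge> 1" "3 * (M * exp \<sigma> + 1) / \<epsilon> \<le> T"
    by (auto simp: T_def)
  hence T3: "M / T * exp \<sigma> < \<epsilon> / 3"
    using \<epsilon> by (auto simp: field_simps)
  have "cmod (contour_integral (bracket T \<sigma> X) f - \<i> * J) < \<epsilon>" if X: "X \<le> \<sigma>" for X
  proof -
    define l1 l2 l3 where "l1 = linepath (Complex X (- T)) (Complex \<sigma> (- T))"
      and "l2 = linepath (Complex \<sigma> (- T)) (Complex \<sigma> T)"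
      and "l3 = linepath (Complex \<sigma> T) (Complex X T)"
    have l13: "Re u \<le> \<sigma> \<and> \<bar>Im u\<bar> = T" if "u \<in> path_image l1 \<union> path_image l3" for u
      using that X T(2) segment_in_halfplane(1)[of u "Complex X (- T)" "Complex \<sigma> (- T)" \<sigma>]
        segment_in_halfplane(1)[of u "Complex \<sigma> T" "Complex X T" \<sigma>]
        segment_in_halfplane(2)[of u "Complex X (- T)" "Complex \<sigma> (- T)" "- T"]
        segment_in_halfplane(3)[of u "Complex X (- T)" "Complex \<sigma> (- T)" "- T"]
        segment_in_halfplane(2)[of u "Complex \<sigma> T" "Complex X T" T]
        segment_in_halfplane(3)[of u "Complex \<sigma> T" "Complex X T" T]
      by (auto simp: l1_def l3_def)
    have l2: "Re u = \<sigma>" if "u \<in> path_image l2" for u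
      using that by (auto simp: l2_def closed_segment_def complex_eq_iff algebra_simps)
    have "path_image l1 \<subseteq> - S" "path_image l2 \<subseteq> - S" "path_image l3 \<subseteq> - S"
      using l13 l2 S(2,3) T(2) by force+
    hence ci: "f contour_integrable_on l1" "f contour_integrable_on l2" "f contour_integrable_on l3"
      using contour_integrable_holomorphic_simple[OF holo] S(1)
      by (auto simp: l1_def l2_def l3_def open_Compl)
    have bd: "cmod (f u) \<le> M / T * exp (Re u)" if "u \<in> path_image l1 \<union> path_image l3" for u
      using bound(2)[of u] l13[OF that] T by auto
    have "cmod (contour_integral l1 f) \<le> M / T * exp \<sigma> * (1 + \<bar>Im (Complex \<sigma> (- T)) - Im (Complex X (- T))\<bar>)"
      using has_contour_integral_integral[OF ci(1)] bd bound(1) T X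
      by (intro contour_integral_linepath_exp_bound[of f]) (auto simp: l1_def)
    also have "\<dots> = M / T * exp \<sigma>" by simp
    finally have b1: "cmod (contour_integral l1 f) < \<epsilon> / 3" using T3 by linarith
    have "cmod (contour_integral l3 f) \<le> M / T * exp \<sigma> * (1 + \<bar>Im (Complex X T) - Im (Complex \<sigma> T)\<bar>)"
      using has_contour_integral_integral[OF ci(3)] bd bound(1) T X
      by (intro contour_integral_linepath_exp_bound[of f]) (auto simp: l3_def)
    also have "\<dots> = M / T * exp \<sigma>" by simp
    finally have b3: "cmod (contour_integral l3 f) < \<epsilon> / 3" using T3 by linarith
    have "ball 0 B \<subseteq> cbox (- T) T" using T by (auto simp: dist_real_def)
    from B(2)[OF this] obtain I where I: "((\<lambda>t. f (Complex \<sigma> t)) has_integral I) {- T..T}" "norm (I - J) < \<epsilon> / 3"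
      by auto
    have "(f has_contour_integral (\<i> * I)) l2"
      unfolding l2_def using I(1) T
      by (subst has_contour_integral_linepath_same_Re_iff[where c = \<sigma> and a = "- T" and b = T]) auto
    hence "contour_integral l2 f = \<i> * I" by (rule contour_integral_unique)
    hence b2: "cmod (contour_integral l2 f - \<i> * J) < \<epsilon> / 3"
      using I(2) by (simp add: norm_mult flip: right_diff_distrib)
    have "contour_integral (bracket T \<sigma> X) f - \<i> * J =
        contour_integral l1 f + ((contour_integral l2 f - \<i> * J) + contour_integral l3 f)"
      using ci by (simp add: bracket_def l1_def l2_def l3_def valid_path_join)
    also have "cmod \<dots> \<le> cmod (contour_integral l1 f) + (cmod (contour_integral l2 f - \<i> * J) + cmod (contour_integral l3 f))"
      by (intro order_trans[OF norm_triangle_ineq] add_mono norm_triangle_ineq) auto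
    finally show ?thesis using b1 b2 b3 by linarith
  qed
  moreover have "T > 0" using T by linarith
  ultimately show ?thesis unfolding J_def by blast
qed

lemma loop_has_integral_vertical:
  fixes f :: "complex \<Rightarrow> complex"
  assumes \<gamma>: "left_loop \<gamma>"
    and S: "closed S" "\<And>w. w \<in> S \<Longrightarrow> Im w = 0" "\<And>w. w \<in> S \<Longrightarrow> Re w < \<sigma>"
      "\<And>X. finite {w \<in> S. Re w \<ge> X}"
    and inside: "\<And>w. w \<in> S \<Longrightarrow> inside_loop \<gamma> w"
    and holo: "f holomorphic_on - S"
    and bound: "\<And>d. d > 0 \<Longrightarrow> \<exists>M\<ge>0. \<forall>u. Re u \<le> \<sigma> \<and> d \<le> \<bar>Im u\<bar> \<longrightarrow>
        cmod (f u) \<le> M * exp (Re u) / \<bar>Im u\<bar>"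
    and int: "integrable lborel (\<lambda>t. f (Complex \<sigma> t))"
  shows "((\<lambda>t. f (\<gamma> t) * vector_derivative \<gamma> (at t)) has_integral (\<i> * (LBINT t. f (Complex \<sigma> t)))) UNIV"
proof (rule loop_has_integral[OF \<gamma> S(1,2,3,4) inside holo])
  fix d D :: real assume d: "0 < d"
  from bound[OF d] obtain M where M: "M \<ge> 0" "\<And>u. Re u \<le> \<sigma> \<Longrightarrow> d \<le> \<bar>Im u\<bar> \<Longrightarrow>
        cmod (f u) \<le> M * exp (Re u) / \<bar>Im u\<bar>" by blast
  show "\<exists>M X. \<forall>u. Re u \<le> X \<and> d \<le> \<bar>Im u\<bar> \<and> \<bar>Im u\<bar> \<le> D \<longrightarrow> cmod (f u) \<le> M * exp (Re u)"
  proof (rule exI[of _ "M / d"], rule exI[of _ \<sigma>], intro allI impI, elim conjE)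
    fix u assume u: "Re u \<le> \<sigma>" "d \<le> \<bar>Im u\<bar>"
    have "cmod (f u) \<le> M * exp (Re u) / \<bar>Im u\<bar>" using u by (rule M)
    also have "\<dots> \<le> M * exp (Re u) / d" using u d M(1) by (intro frac_le) auto
    finally show "cmod (f u) \<le> M / d * exp (Re u)" by simp
  qed
next
  fix \<epsilon> :: real assume \<epsilon>: "\<epsilon> > 0"
  obtain M where M: "M \<ge> 0" "\<And>u. Re u \<le> \<sigma> \<Longrightarrow> 1 \<le> \<bar>Im u\<bar> \<Longrightarrow>
        cmod (f u) \<le> M * exp (Re u) / \<bar>Im u\<bar>" using bound[of 1] by auto
  obtain T where T: "T > 0" "\<And>X. X \<le> \<sigma> \<Longrightarrow>
      cmod (contour_integral (bracket T \<sigma> X) f - \<i> * (LBINT t. f (Complex \<sigma> t))) < \<epsilon>"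
    using bracket_tendsto_vertical[OF S(1,2,3) holo M int \<epsilon>] by blast
  have "\<forall>\<^sub>F X in at_bot. cmod (contour_integral (bracket T \<sigma> X) f - \<i> * (LBINT t. f (Complex \<sigma> t))) < \<epsilon>"
    using eventually_le_at_bot[of \<sigma>] by eventually_elim (rule T)
  with T show "\<exists>T>0. \<forall>\<^sub>F X in at_bot. cmod (contour_integral (bracket T \<sigma> X) f - \<i> * (LBINT t. f (Complex \<sigma> t))) < \<epsilon>"
    by blast
qed


section \<open>The Cahen--Mellin integral\<close>

lemma residue_Gamma_powr:
  assumes z: "(z::real) > 0"
  shows "residue (\<lambda>v. Gamma v * of_real z powr (- v)) (- of_nat m) = (- 1) ^ m / fact m * of_real z ^ m"
proof (rule residue_simple')
  show "open (- (\<int>\<^sub>\<le>\<^sub>0 - {-of_nat m}) :: complex set)"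
    by (intro open_Compl closed_subset_Ints) auto
  show "(\<lambda>v. Gamma v * of_real z powr (- v)) holomorphic_on (- (\<int>\<^sub>\<le>\<^sub>0 - {-of_nat m}) - {- of_nat m})"
    using z by (intro holomorphic_intros) auto
  have "((\<lambda>w. Gamma w * (w - (-of_nat m))) \<longlongrightarrow> (- 1) ^ m / fact m) (at (- of_nat m :: complex))"
    using Gamma_residues[of m] by simp
  moreover have "((\<lambda>w. of_real z powr (- w)) \<longlongrightarrow> of_real z powr (- (- of_nat m))) (at (- of_nat m :: complex))"
    using z by (intro tendsto_intros) auto
  hence "((\<lambda>w. of_real z powr (- w)) \<longlongrightarrow> of_real z ^ m) (at (- of_nat m :: complex))"
    using z by (simp add: powr_nat')
  ultimately have "((\<lambda>w. Gamma w * (w - (-of_nat m)) * of_real z powr (- w)) \<longlongrightarrow> (- 1) ^ m / fact m * of_real z ^ m) (at (- of_nat m :: complex))"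
    by (rule tendsto_mult)
  thus "((\<lambda>w. Gamma w * of_real z powr (- w) * (w - (-of_nat m))) \<longlongrightarrow> (- 1) ^ m / fact m * of_real z ^ m) (at (- of_nat m :: complex))"
    by (simp add: mult_ac)
qed auto

text \<open>
  On the vertical lines half-way between the poles, a step to the left divides by a number of modulus
  at least $(N+1)/2$.
\<close>

lemma Gamma_powr_between_poles:
  assumes z: "z > 0" and u: "Re u = 1 / 2 - real N"
  shows "cmod (Gamma u * of_real z powr (- u)) \<le> Gamma (1 / 2) * z powr (- 1 / 2) * ((2 * z) ^ N / fact N)"
  using u
proof (induction N arbitrary: u)
  case 0
  hence u: "Re u = 1 / 2" by simp
  have "cmod (of_real z powr (- u)) = z powr Re (- u)" using z by (simp add: norm_powr_real_powr)
  also have "Re (- u) = - 1 / 2" using u by simp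
  finally have "cmod (of_real z powr (- u)) = z powr (- 1 / 2)" .
  moreover have "cmod (Gamma u) \<le> Gamma (1 / 2)" using norm_Gamma_le[of u] unfolding u by simp
  ultimately show ?case unfolding norm_mult by (simp add: mult_right_mono)
next
  case (Suc N)
  define K where "K = Gamma (1 / 2 :: real) * z powr (- 1 / 2)"
  have K: "K \<ge> 0" by (simp add: K_def)
  have u: "u \<notin> \<int>\<^sub>\<le>\<^sub>0"
  proof
    assume "u \<in> \<int>\<^sub>\<le>\<^sub>0"
    then obtain m where "u = - of_nat m" by (auto elim!: nonpos_Ints_cases')
    with Suc.prems have "real (2 * m) = real (2 * N + 1)" by simp
    hence "2 * m = 2 * N + 1" by (simp only: of_nat_eq_iff)
    thus False by presburger
  qed
  hence u0: "u \<noteq> 0" by auto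
  have "real (Suc N) / 2 \<le> \<bar>Re u\<bar>" using Suc.prems by (simp add: field_simps)
  hence cu: "real (Suc N) / 2 \<le> cmod u" using abs_Re_le_cmod[of u] by linarith
  have zp: "of_real z powr (- u) = of_real z powr (- (u + 1)) * (of_real z :: complex)"
    using z powr_add[of "of_real z :: complex" "- (u + 1)" 1] by simp
  have "Gamma u = Gamma (u + 1) / u" using Gamma_plus1[OF u] u0 by simp
  hence "Gamma u * of_real z powr (- u) = (Gamma (u + 1) * of_real z powr (- (u + 1))) * (of_real z / u)"
    unfolding zp by simp
  hence "cmod (Gamma u * of_real z powr (- u)) = cmod (Gamma (u + 1) * of_real z powr (- (u + 1))) * (z / cmod u)"
    using z by (simp only: norm_mult norm_divide norm_of_real abs_of_pos)
  also have "\<dots> \<le> (K * ((2 * z) ^ N / fact N)) * (z / (real (Suc N) / 2))"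
    using Suc.prems z K cu unfolding K_def
    by (intro mult_mono Suc.IH frac_le) (auto simp del: of_nat_Suc)
  also have "\<dots> = K * ((2 * z) ^ Suc N / fact (Suc N))"
    by (simp add: field_simps)
  finally show ?case unfolding K_def .
qed

lemma nonpos_Ints_discrete:
  "closed (\<int>\<^sub>\<le>\<^sub>0 :: complex set)"
  "w \<in> \<int>\<^sub>\<le>\<^sub>0 \<Longrightarrow> Im w = 0" "w \<in> \<int>\<^sub>\<le>\<^sub>0 \<Longrightarrow> Re w \<le> 0"
  "finite {w \<in> (\<int>\<^sub>\<le>\<^sub>0 :: complex set). Re w \<ge> X}"
proof -
  show "closed (\<int>\<^sub>\<le>\<^sub>0 :: complex set)" by (rule closed_nonpos_Ints)
  show "w \<in> \<int>\<^sub>\<le>\<^sub>0 \<Longrightarrow> Im w = 0" "w \<in> \<int>\<^sub>\<le>\<^sub>0 \<Longrightarrow> Re w \<le> 0"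
    by (auto elim!: nonpos_Ints_cases)
  have "{w \<in> (\<int>\<^sub>\<le>\<^sub>0 :: complex set). Re w \<ge> X} \<subseteq> (\<lambda>n. - of_nat n) ` {..nat \<lceil>- X\<rceil>}"
    by (auto elim!: nonpos_Ints_cases' intro!: imageI) linarith
  thus "finite {w \<in> (\<int>\<^sub>\<le>\<^sub>0 :: complex set). Re w \<ge> X}"
    by (rule finite_subset) auto
qed

lemma integrable_Gamma_powr_vertical:
  assumes "\<tau> > 0" "z > 0"
  shows "integrable lborel (\<lambda>t. Gamma (Complex \<tau> t) * of_real z powr (- Complex \<sigma> t))"
proof (rule Bochner_Integration.integrable_bound)
  show "integrable lborel (\<lambda>t. Gamma (Complex \<tau> t) * of_real (z powr (- \<sigma>)))"
    by (intro integrable_mult_left integrable_Gamma_vertical assms)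
  have "(\<lambda>t. Gamma (Complex \<tau> t)) \<in> borel_measurable lborel"
    using integrable_Gamma_vertical[OF assms(1)] by (rule borel_measurable_integrable)
  moreover have "continuous_on UNIV (\<lambda>t. of_real z powr (- Complex \<sigma> t))"
    using assms by (auto simp: Complex_eq intro!: continuous_intros)
  hence "(\<lambda>t. of_real z powr (- Complex \<sigma> t)) \<in> borel_measurable lborel"
    by (simp add: borel_measurable_continuous_onI)
  ultimately show "(\<lambda>t. Gamma (Complex \<tau> t) * of_real z powr (- Complex \<sigma> t)) \<in> borel_measurable lborel"
    by (rule borel_measurable_times)
qed (use assms in \<open>simp add: norm_mult norm_powr_real_powr\<close>)

text \<open>
  Brackets approximate the vertical line; closed on the left by a vertical side between two poles,
  they enclose the poles $0,-1,\dots,-N$, whose residues $(-z)^m/m!$ add up to the exponential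
  series.
\<close>

lemma Cahen_Mellin_integral:
  fixes \<tau> z :: real
  assumes \<tau>: "\<tau> > 0" and z: "z > 0"
  shows "(LBINT t. Gamma (Complex \<tau> t) * of_real z powr (- Complex \<tau> t)) = of_real (2 * pi * exp (- z))"
proof -
  define f where "f = (\<lambda>v. Gamma v * of_real z powr (- v) :: complex)"
  define V where "V = \<i> * (LBINT t. f (Complex \<tau> t))"
  define W where "W = 2 * of_real pi * \<i> * exp (- of_real z :: complex)"
  have holo: "f holomorphic_on - \<int>\<^sub>\<le>\<^sub>0"
    unfolding f_def using z by (intro holomorphic_intros) auto
  \<comment> \<open>For fixed height T the left side of the rectangle disappears as it moves past more and more poles.\<close>
  have "cmod (W - V) \<le> \<epsilon>" if \<epsilon>: "\<epsilon> > 0" for \<epsilon>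
  proof -
    obtain M where M: "M \<ge> 0" "\<And>u. Re u \<le> \<tau> \<Longrightarrow> 1 \<le> \<bar>Im u\<bar> \<Longrightarrow> cmod (f u) \<le> M * exp (Re u) / \<bar>Im u\<bar>"
      using Gamma_powr_left_decay[OF z, of 1 \<tau> 0] by (auto simp: f_def)
    have "\<exists>T>0. \<forall>X\<le>\<tau>. cmod (contour_integral (bracket T \<tau> X) f - V) < \<epsilon>"
      unfolding V_def
    proof (rule bracket_tendsto_vertical[OF _ _ _ holo M _ \<epsilon>])
      show "integrable lborel (\<lambda>t. f (Complex \<tau> t))"
        unfolding f_def by (rule integrable_Gamma_powr_vertical[OF \<tau> z])
    qed (use nonpos_Ints_discrete \<tau> in \<open>force+\<close>)
    then obtain T where T: "T > 0" "\<And>X. X \<le> \<tau> \<Longrightarrow> cmod (contour_integral (bracket T \<tau> X) f - V) < \<epsilon>"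
      by blast
    define K where "K = Gamma (1 / 2 :: real) * z powr (- 1 / 2)"
    define X where "X = (\<lambda>N::nat. 1 / 2 - real (Suc N))"
    define R where "R = (\<lambda>N. rectpath (Complex (X N) (- T)) (Complex \<tau> T))"
    define s where "s = (\<lambda>N. 2 * of_real pi * \<i> * (\<Sum>m\<le>N. (- of_real z) ^ m / fact m :: complex))"
    have Rs: "f contour_integrable_on R N" "contour_integral (R N) f = s N" for N
    proof -
      let ?U = "{u. Re u > - real (Suc N)}" and ?P = "(\<lambda>m. - of_nat m) ` {..N} :: complex set"
      have UP: "?U - ?P \<subseteq> - \<int>\<^sub>\<le>\<^sub>0"
        by (auto elim!: nonpos_Ints_cases')
      have holo': "f holomorphic_on ?U - ?P"
        by (rule holomorphic_on_subset[OF holo UP])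
      have box: "p \<in> box (Complex (X N) (- T)) (Complex \<tau> T)" if "p \<in> ?P" for p
        using that T \<tau> by (auto simp: in_box_complex_iff X_def)
      have lt: "X N < \<tau>" "- T < T" using T \<tau> by (auto simp: X_def)
      have img: "path_image (R N) \<subseteq> ?U - ?P"
        using lt box
        by (auto simp: R_def path_image_rectpath_cbox_minus_box in_cbox_complex_iff X_def)
      have openU: "open ?U" by (rule open_halfspace_Re_gt)
      have convU: "convex ?U" by (rule convex_halfspace_Re_gt)
      have inj: "inj_on (\<lambda>m. - of_nat m :: complex) {..N}" by (auto simp: inj_on_def)
      show "f contour_integrable_on R N"
        by (rule contour_integrable_holomorphic_simple[OF holo' _ _ img])
           (use openU in \<open>auto simp: R_def intro!: open_Diff finite_imp_closed simp del: of_nat_Suc\<close>)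
      have "contour_integral (R N) f = 2 * pi * \<i> * (\<Sum>p\<in>?P. winding_number (R N) p * residue f p)"
      proof (rule Residue_theorem[OF openU convex_connected[OF convU] _ holo' _ _ img])
        show "\<forall>w. w \<notin> ?U \<longrightarrow> winding_number (R N) w = 0"
          using img by (auto intro!: winding_number_zero_outside[OF _ convU] simp: R_def)
      qed (auto simp: R_def)
      also have "(\<Sum>p\<in>?P. winding_number (R N) p * residue f p) = (\<Sum>p\<in>?P. residue f p)"
        using box by (intro sum.cong) (auto simp: R_def winding_number_rectpath)
      also have "\<dots> = (\<Sum>m\<le>N. residue f (- of_nat m))"
        by (subst sum.reindex[OF inj]) simp
      also have "\<dots> = (\<Sum>m\<le>N. (- of_real z) ^ m / fact m)"
        unfolding f_def residue_Gamma_powr[OF z] by (simp add: power_minus' power_minus[of "of_real z"])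
      finally show "contour_integral (R N) f = s N" by (simp add: s_def)
    qed
    have left: "cmod (contour_integral (bracket T \<tau> (X N)) f - s N) \<le> K * ((2 * z) ^ Suc N / fact (Suc N)) * (2 * T)" for N
    proof -
      let ?l = "linepath (Complex (X N) T) (Complex (X N) (- T))"
      note * = contour_integral_rectpath_bracket[OF Rs(1)[of N, unfolded R_def]]
      have "cmod (contour_integral ?l f) \<le> K * ((2 * z) ^ Suc N / fact (Suc N)) * cmod (Complex (X N) (- T) - Complex (X N) T)"
      proof (rule contour_integral_bound_linepath[OF *(2)])
        fix u assume "u \<in> closed_segment (Complex (X N) T) (Complex (X N) (- T))"
        hence "Re u = 1 / 2 - real (Suc N)"
          by (auto simp: closed_segment_def complex_eq_iff algebra_simps X_def)
        from Gamma_powr_between_poles[OF z this] show "cmod (f u) \<le> K * ((2 * z) ^ Suc N / fact (Suc N))"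
          unfolding f_def K_def .
      qed (use z in \<open>simp add: K_def\<close>)
      also have "Complex (X N) (- T) - Complex (X N) T = - of_real (2 * T) * \<i>"
        by (simp add: complex_eq_iff)
      also have "cmod \<dots> = 2 * T" using T by (simp add: norm_mult)
      finally show ?thesis unfolding *(1) Rs(2)[of N, unfolded R_def] by simp
    qed
    have "(\<lambda>N. (2 * z) ^ Suc N / fact (Suc N)) \<longlonglongrightarrow> 0"
      using summable_LIMSEQ_zero[OF summable_exp[of "2 * z"]]
      by (subst filterlim_sequentially_Suc) (simp add: field_simps)
    hence "(\<lambda>N. K * ((2 * z) ^ Suc N / fact (Suc N)) * (2 * T)) \<longlonglongrightarrow> K * 0 * (2 * T)"
      by (intro tendsto_intros)
    hence lim0: "(\<lambda>N. K * ((2 * z) ^ Suc N / fact (Suc N)) * (2 * T)) \<longlonglongrightarrow> 0" by simp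
    have "(\<lambda>N. contour_integral (bracket T \<tau> (X N)) f - s N) \<longlonglongrightarrow> 0"
      by (rule Lim_null_comparison[OF always_eventually[OF allI[OF left]] lim0])
    moreover have "s \<longlonglongrightarrow> W"
      unfolding s_def W_def using exp_converges[of "- of_real z :: complex"]
      by (intro tendsto_intros) (simp add: sums_def_le scaleR_conv_of_real field_simps)
    ultimately have "(\<lambda>N. contour_integral (bracket T \<tau> (X N)) f - s N + s N) \<longlonglongrightarrow> 0 + W"
      by (rule tendsto_add)
    hence "(\<lambda>N. contour_integral (bracket T \<tau> (X N)) f - V) \<longlonglongrightarrow> W - V"
      by (intro tendsto_intros) simp
    thus "cmod (W - V) \<le> \<epsilon>"
    proof (rule Lim_norm_ubound[rotated])
      show "\<forall>\<^sub>F N in sequentially. cmod (contour_integral (bracket T \<tau> (X N)) f - V) \<le> \<epsilon>"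
        using \<tau> by (intro always_eventually allI less_imp_le T) (auto simp: X_def)
    qed auto
  qed
  hence "cmod (W - V) \<le> 0" by (rule field_le_epsilon[where y = 0, simplified])
  hence "V = W" by simp
  hence "\<i> * (LBINT t. f (Complex \<tau> t)) = \<i> * of_real (2 * pi * exp (- z))"
    by (simp add: V_def W_def mult_ac flip: exp_of_real)
  thus ?thesis by (simp only: mult_left_cancel[OF complex_i_not_zero] f_def)
qed


section \<open>Loop integrals with values in incomplete Gamma functions\<close>

text \<open>
  The upper incomplete Gamma function $\Gamma(s,z)$, which for $z>0$ is defined at all real $s$.
\<close>

definition upper_Gamma :: "real \<Rightarrow> real \<Rightarrow> real" where
  "upper_Gamma s z = (LBINT w:{z<..}. w powr (s - 1) * exp (- w))"

lemma powr_tail_integral: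
  fixes s :: complex and z :: real
  assumes s: "Re s > 0" and z: "z > 0"
  shows "set_integrable lborel {z<..} (\<lambda>w. w powr (- Re s - 1))"
    and "(LBINT w:{z<..}. of_real w powr (- s - 1)) = of_real z powr (- s) / s"
proof -
  define r where "r = Re s"
  have r: "r > 0" using s by (simp add: r_def)
  have s0: "s \<noteq> 0" using s by auto
  have ein: "einterval (ereal z) \<infinity> = {z<..}" by (auto simp: einterval_def)
  have at_z: "at_right (ereal z) = filtermap ereal (at_right z)"
    by (simp add: at_right_ereal)
  have lim: "((\<lambda>w. w powr (- r)) \<longlongrightarrow> 0) at_top"
    using r by (intro tendsto_neg_powr filterlim_ident) auto
  have "set_integrable lborel (einterval (ereal z) \<infinity>) (\<lambda>w. w powr (- r - 1))"
  proof (rule interval_integral_FTC_nonneg(1)[where F = "\<lambda>w. - (w powr (- r) / r)" and A = "- (z powr (- r) / r)" and B = 0])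
    fix w assume "ereal z < ereal w"
    with z show "((\<lambda>w. - (w powr (- r) / r)) has_real_derivative w powr (- r - 1)) (at w)"
      using r by (auto intro!: derivative_eq_intros)
    from z \<open>ereal z < ereal w\<close> show "isCont (\<lambda>w. w powr (- r - 1)) w"
      by (intro continuous_intros) auto
  next
    show "(((\<lambda>w. - (w powr (- r) / r)) \<circ> real_of_ereal) \<longlongrightarrow> - (z powr (- r) / r)) (at_right (ereal z))"
      using z r by (auto simp: ereal_tendsto_simps intro!: tendsto_eq_intros)
    show "(((\<lambda>w. - (w powr (- r) / r)) \<circ> real_of_ereal) \<longlongrightarrow> 0) (at_left \<infinity>)"
      using tendsto_minus[OF tendsto_divide[OF lim tendsto_const[of r]]] r by (simp add: ereal_tendsto_simps)
  qed (use z in auto)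
  thus int: "set_integrable lborel {z<..} (\<lambda>w. w powr (- Re s - 1))"
    unfolding ein by (simp add: r_def)
  have nrm: "cmod (of_real w powr (- s - 1)) = w powr (- r - 1)" if "w > 0" for w
    using that by (simp add: norm_powr_real_powr r_def)
  have nrm': "cmod (of_real w powr (- s)) = w powr (- r)" if "w > 0" for w
    using that by (simp add: norm_powr_real_powr r_def)
  have cont: "isCont (\<lambda>w. of_real w powr (- s - 1) :: complex) w" if "w > 0" for w
    using that by (intro continuous_intros) auto
  have int': "set_integrable lborel {z<..} (\<lambda>w. of_real w powr (- s - 1) :: complex)"
  proof (rule set_integrable_bound[OF int])
    show "set_borel_measurable lborel {z<..} (\<lambda>w. of_real w powr (- s - 1) :: complex)"
    proof -
      have "(\<lambda>w. indicator {z<..} w *\<^sub>R (of_real w powr (- s - 1) :: complex)) \<in> borel_measurable borel"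
        using z cont by (intro borel_measurable_continuous_on_indicator continuous_at_imp_continuous_on) auto
      thus ?thesis by (simp add: set_borel_measurable_def)
    qed
  qed (use z nrm in \<open>auto simp: r_def\<close>)
  have "(LBINT w=ereal z..\<infinity>. of_real w powr (- s - 1) :: complex) = 0 - (- (of_real z powr (- s) / s))"
  proof (rule interval_integral_FTC_integrable[where F = "\<lambda>w. - (of_real w powr (- s) / s)"])
    fix w assume "ereal z < ereal w"
    with z have w: "w > 0" by simp
    have "((\<lambda>w. - (w powr (- s) / s)) has_field_derivative of_real w powr (- s - 1)) (at (of_real w))"
      using w s0 by (auto intro!: derivative_eq_intros)
    from has_vector_derivative_real_field[OF this] 
    show "((\<lambda>w. - (of_real w powr (- s) / s)) has_vector_derivative of_real w powr (- s - 1)) (at w)" by simp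
    show "isCont (\<lambda>w. of_real w powr (- s - 1) :: complex) w" using cont[OF w] .
  next
    show "set_integrable lborel (einterval (ereal z) \<infinity>) (\<lambda>w. of_real w powr (- s - 1) :: complex)"
      unfolding ein by (rule int')
    show "(((\<lambda>w. - (of_real w powr (- s) / s)) \<circ> real_of_ereal) \<longlongrightarrow> - (of_real z powr (- s) / s)) (at_right (ereal z))"
    proof -
      have "isCont (\<lambda>w. - (of_real w powr (- s) / s)) z"
        using z s0 by (intro continuous_intros) auto
      from tendsto_within_subset[OF isContD[OF this] subset_UNIV] show ?thesis
        by (simp add: ereal_tendsto_simps)
    qed
    have "((\<lambda>w. of_real w powr (- s) :: complex) \<longlongrightarrow> 0) at_top"
      by (rule Lim_null_comparison[OF _ lim]) (use eventually_gt_at_top[of 0] in \<open>eventually_elim, simp add: nrm'\<close>)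
    from tendsto_minus[OF tendsto_divide[OF this tendsto_const[of s]]] s0
    show "(((\<lambda>w. - (of_real w powr (- s) / s)) \<circ> real_of_ereal) \<longlongrightarrow> 0) (at_left \<infinity>)"
      by (simp add: ereal_tendsto_simps)
  qed auto
  thus "(LBINT w:{z<..}. of_real w powr (- s - 1)) = of_real z powr (- s) / s"
    by (simp add: interval_lebesgue_integral_def ein)
qed

text \<open>
  Separating modulus and phase makes the joint measurability in $w$ and $t$ evident.
\<close>

lemma powr_Complex_split:
  assumes "w > 0"
  shows "(of_real w :: complex) powr (- Complex x t - 1) =
         of_real (w powr (- x - 1)) * (of_real (cos (t * ln w)) - \<i> * of_real (sin (t * ln w)))"
proof -
  have "(of_real w :: complex) powr (- Complex x t - 1) =
        of_real w powr of_real (- x - 1) * of_real w powr (- (\<i> * of_real t))"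
    by (subst powr_add[symmetric]) (simp add: Complex_eq algebra_simps)
  also have "of_real w powr of_real (- x - 1) = (of_real (w powr (- x - 1)) :: complex)"
    using assms by (simp only: powr_of_real)
  also have "(of_real w :: complex) powr (- (\<i> * of_real t)) = exp (\<i> * of_real (- (t * ln w)))"
    using assms by (simp add: powr_def Ln_of_real mult_ac)
  also have "\<dots> = of_real (cos (t * ln w)) - \<i> * of_real (sin (t * ln w))"
    by (simp add: exp_eq_polar cis_conv_exp[symmetric] complex_eq_iff)
  finally show ?thesis .
qed

text \<open>
  Since $\mathrm{Re}(u+k)>0$ on the line,
  $z^{-u}/(u+k) = z^k\int_z^\infty w^{-u-k-1}\,dw$. After exchanging the integrals, the inner one is
  the Cahen--Mellin integral at $w$.
\<close>

lemma Gamma_powr_pole_vertical_integral: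
  fixes \<tau> \<sigma> z :: real and k :: nat
  assumes \<tau>: "\<tau> > 0" and \<sigma>: "\<sigma> > 0" and z: "z > 0"
  shows "integrable lborel (\<lambda>t. Gamma (Complex \<tau> t) * of_real z powr (- Complex \<sigma> t) / (Complex \<sigma> t + of_nat k))"
    and "(LBINT t. Gamma (Complex \<tau> t) * of_real z powr (- Complex \<sigma> t) / (Complex \<sigma> t + of_nat k)) =
         of_real (2 * pi * (z ^ k * upper_Gamma (\<tau> - \<sigma> - real k) z))"
proof -
  define \<rho> where "\<rho> = \<sigma> + real k"
  have \<rho>: "\<rho> > 0" using \<sigma> by (simp add: \<rho>_def)
  define G where "G = (\<lambda>t. Gamma (Complex \<tau> t))"
  have Gi: "integrable lborel G" unfolding G_def by (rule integrable_Gamma_vertical[OF \<tau>])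
  hence Gm [measurable]: "G \<in> borel_measurable borel" by auto
  define F where "F = (\<lambda>t w. indicator {z<..} w *\<^sub>R (G t * (of_real (w powr (- \<rho> - 1)) *
      (of_real (cos (t * ln w)) - \<i> * of_real (sin (t * ln w)) :: complex))))"
  have F: "F t w = indicator {z<..} w *\<^sub>R (G t * of_real w powr (- Complex \<rho> t - 1))" for t w
    using z powr_Complex_split[of w \<rho> t] by (auto simp: F_def indicator_def)
  have nF: "norm (F t w) = norm (G t) * (indicator {z<..} w * w powr (- \<rho> - 1))" for t w
    using z by (auto simp: F norm_mult norm_powr_real_powr indicator_def)
  have tail: "integrable lborel (\<lambda>w. indicator {z<..} w * w powr (- \<rho> - 1))"
    using powr_tail_integral(1)[of "of_real \<rho>" z] \<rho> z by (simp add: set_integrable_def)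
  have Fm: "case_prod F \<in> borel_measurable (lborel \<Otimes>\<^sub>M lborel)"
    unfolding F_def case_prod_unfold by measurable
  have Fi: "integrable (lborel \<Otimes>\<^sub>M lborel) (case_prod F)"
  proof (rule lborel_pair.Fubini_integrable[OF Fm])
    show "integrable lborel (\<lambda>t. \<integral>w. norm (case (t, w) of (t, w) \<Rightarrow> F t w) \<partial>lborel)"
      using Gi by (simp add: nF)
    show "AE t in lborel. integrable lborel (\<lambda>w. case (t, w) of (t, w) \<Rightarrow> F t w)"
    proof (rule AE_I2)
      fix t
      have "integrable lborel (\<lambda>w. norm (G t) * (indicator {z<..} w * w powr (- \<rho> - 1)))"
        by (intro integrable_mult_right tail)
      thus "integrable lborel (\<lambda>w. case (t, w) of (t, w) \<Rightarrow> F t w)"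
      proof (rule Bochner_Integration.integrable_bound)
        show "(\<lambda>w. case (t, w) of (t, w) \<Rightarrow> F t w) \<in> borel_measurable lborel"
          unfolding F_def prod.case by measurable
      qed (simp add: nF)
    qed
  qed
  have inner_w: "(LBINT w. F t w) = G t * of_real z powr (- Complex \<sigma> t) / (Complex \<sigma> t + of_nat k) / of_real (z ^ k)" for t
  proof -
    have s: "Complex \<rho> t = Complex \<sigma> t + of_nat k" by (simp add: \<rho>_def complex_eq_iff)
    have "(LBINT w. F t w) = G t * (LBINT w:{z<..}. of_real w powr (- Complex \<rho> t - 1))"
      unfolding F set_lebesgue_integral_def by (simp flip: scaleR_right_distrib mult_scaleR_right)
    also have "(LBINT w:{z<..}. of_real w powr (- Complex \<rho> t - 1)) = of_real z powr (- Complex \<rho> t) / Complex \<rho> t"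
      using \<rho> z by (intro powr_tail_integral) auto
    also have "of_real z powr (- Complex \<rho> t) = of_real z powr (- Complex \<sigma> t) / (of_real (z ^ k) :: complex)"
      using z powr_diff[of "of_real z :: complex" "- Complex \<sigma> t" "of_nat k"]
      by (simp add: s powr_nat')
    finally show ?thesis unfolding s by simp
  qed
  have "integrable lborel (\<lambda>t. LBINT w. F t w)"
    using lborel_pair.integrable_fst'[OF Fi] by simp
  hence "integrable lborel (\<lambda>t. (LBINT w. F t w) * of_real (z ^ k))"
    by (rule integrable_mult_left)
  thus "integrable lborel (\<lambda>t. Gamma (Complex \<tau> t) * of_real z powr (- Complex \<sigma> t) / (Complex \<sigma> t + of_nat k))"
    unfolding inner_w using z by (simp add: G_def)
  have inner_t: "(LBINT t. F t w) = of_real (2 * pi * (indicator {z<..} w *\<^sub>R (w powr (\<tau> - \<sigma> - real k - 1) * exp (- w))))" for w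
  proof (cases "w > z")
    case True
    hence w: "w > 0" using z by simp
    have "F t w = Gamma (Complex \<tau> t) * of_real w powr (- Complex \<tau> t) * of_real (w powr (\<tau> - \<sigma> - real k - 1))" for t
    proof -
      have "of_real w powr (- Complex \<rho> t - 1) =
          (of_real w :: complex) powr (- Complex \<tau> t) * of_real w powr of_real (\<tau> - \<sigma> - real k - 1)"
        by (subst powr_add[symmetric], intro arg_cong2[where f = "(powr)"] refl)
           (simp add: \<rho>_def complex_eq_iff)
      also have "(of_real w :: complex) powr of_real (\<tau> - \<sigma> - real k - 1) = of_real (w powr (\<tau> - \<sigma> - real k - 1))"
        using w by (simp only: powr_of_real)
      finally show ?thesis using True by (simp add: F G_def)
    qed
    hence "(LBINT t. F t w) = of_real (2 * pi * exp (- w)) * of_real (w powr (\<tau> - \<sigma> - real k - 1))"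
      using Cahen_Mellin_integral[OF \<tau> w] by simp
    thus ?thesis using True by simp
  qed (simp add: F)
  have "(LBINT t. Gamma (Complex \<tau> t) * of_real z powr (- Complex \<sigma> t) / (Complex \<sigma> t + of_nat k)) =
        (LBINT t. (LBINT w. F t w) * of_real (z ^ k))"
    unfolding inner_w using z by (simp add: G_def)
  also have "\<dots> = (LBINT t. LBINT w. F t w) * of_real (z ^ k)" by simp
  also have "(LBINT t. LBINT w. F t w) = (LBINT w. LBINT t. F t w)"
    by (rule lborel_pair.Fubini_integral[OF Fi, symmetric])
  also have "\<dots> = of_real (2 * pi * upper_Gamma (\<tau> - \<sigma> - real k) z)"
    unfolding inner_t upper_Gamma_def set_lebesgue_integral_def by (simp only: integral_complex_of_real integral_mult_right_zero)
  finally show "(LBINT t. Gamma (Complex \<tau> t) * of_real z powr (- Complex \<sigma> t) / (Complex \<sigma> t + of_nat k)) =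
         of_real (2 * pi * (z ^ k * upper_Gamma (\<tau> - \<sigma> - real k) z))" by (simp add: mult_ac)
qed

lemma poles_Gamma_plus_discrete:
  shows "closed (poles_Gamma_plus s)"
    and "w \<in> poles_Gamma_plus s \<Longrightarrow> Im w = 0" "w \<in> poles_Gamma_plus s \<Longrightarrow> Re w \<le> - s"
    and "finite {w \<in> poles_Gamma_plus s. Re w \<ge> X}"
proof -
  have eq: "poles_Gamma_plus s = (+) (- of_real s) ` \<int>\<^sub>\<le>\<^sub>0"
    by (auto simp: poles_Gamma_plus_def image_iff intro!: bexI[of _ "_ + of_real s"])
  show "closed (poles_Gamma_plus s)"
    unfolding eq by (intro closed_translation closed_nonpos_Ints)
  show "w \<in> poles_Gamma_plus s \<Longrightarrow> Im w = 0" "w \<in> poles_Gamma_plus s \<Longrightarrow> Re w \<le> - s"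
    using nonpos_Ints_discrete(2,3)[of "w + of_real s"] by (auto simp: poles_Gamma_plus_def)
  have "{w \<in> poles_Gamma_plus s. Re w \<ge> X} = (+) (- of_real s) ` {w \<in> \<int>\<^sub>\<le>\<^sub>0. Re w \<ge> X + s}"
    unfolding eq by auto
  thus "finite {w \<in> poles_Gamma_plus s. Re w \<ge> X}"
    using nonpos_Ints_discrete(4)[of "X + s"] by simp
qed

text \<open>
  The vertical line is placed to the right of $c$ and of $0$, hence of all poles. If $c$ is an integer,
  then $-k$ may coincide with a pole of $\Gamma(u-c)$; the argument does not see whether it does.
\<close>

lemma loop_integral_Gamma_powr:
  fixes c z :: real
  assumes \<gamma>: "left_loop \<gamma>" and z: "z > 0"
    and inside: "\<And>w. w \<in> poles_Gamma_plus (- c) \<Longrightarrow> inside_loop \<gamma> w"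
  defines "h \<equiv> \<lambda>u. Gamma (u - of_real c) * of_real z powr (- u) :: complex"
  shows "((\<lambda>t. h (\<gamma> t) * vector_derivative \<gamma> (at t)) has_integral
           2 * of_real pi * \<i> * of_real (z powr (- c) * exp (- z))) UNIV"
    and "inside_loop \<gamma> (- of_nat k) \<Longrightarrow>
         ((\<lambda>t. h (\<gamma> t) / (\<gamma> t + of_nat k) * vector_derivative \<gamma> (at t)) has_integral
           2 * of_real pi * \<i> * of_real (z ^ k * upper_Gamma (- c - real k) z)) UNIV"
proof -
  let ?P = "poles_Gamma_plus (- c)"
  have holh: "h holomorphic_on - ?P"
    unfolding h_def using z by (intro holomorphic_intros) (auto simp: poles_Gamma_plus_def)
  have bd: "\<exists>M\<ge>0. \<forall>u. Re u \<le> \<sigma> \<and> d \<le> \<bar>Im u\<bar> \<longrightarrow> cmod (h u) \<le> M * exp (Re u) / \<bar>Im u\<bar>" if "d > 0" for d \<sigma>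
    unfolding h_def by (rule Gamma_powr_left_decay[OF z that])
  have hC: "h (Complex \<sigma> t) = Gamma (Complex (\<sigma> - c) t) * of_real z powr (- Complex \<sigma> t)" for \<sigma> t
  proof -
    have "Complex \<sigma> t - of_real c = Complex (\<sigma> - c) t" by (simp add: complex_eq_iff)
    thus ?thesis by (simp add: h_def)
  qed
  have "((\<lambda>t. h (\<gamma> t) * vector_derivative \<gamma> (at t)) has_integral (\<i> * (LBINT t. h (Complex (c + 1) t)))) UNIV"
    by (rule loop_has_integral_vertical[OF \<gamma> poles_Gamma_plus_discrete(1,2) _ poles_Gamma_plus_discrete(4) inside holh bd])
       (use poles_Gamma_plus_discrete(3)[of _ "- c"] z in \<open>force simp: hC intro!: integrable_Gamma_powr_vertical\<close>)+
  also have "(LBINT t. h (Complex (c + 1) t)) = (LBINT t. (Gamma (Complex 1 t) * of_real z powr (- Complex 1 t)) * of_real (z powr (- c)))"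
  proof -
    have "(of_real z :: complex) powr (- Complex (c + 1) t) = of_real z powr (- Complex 1 t) * of_real (z powr (- c))" for t
    proof -
      have "(of_real z :: complex) powr (- Complex (c + 1) t) = of_real z powr (- Complex 1 t) * of_real z powr of_real (- c)"
        by (subst powr_add[symmetric]) (simp add: Complex_eq algebra_simps)
      also have "(of_real z :: complex) powr of_real (- c) = of_real (z powr (- c))"
        using z by (simp only: powr_of_real)
      finally show ?thesis .
    qed
    thus ?thesis by (simp add: hC mult_ac)
  qed
  also have "\<dots> = of_real (2 * pi * exp (- z)) * of_real (z powr (- c))"
    using Cahen_Mellin_integral[of 1 z] z by simp
  finally show "((\<lambda>t. h (\<gamma> t) * vector_derivative \<gamma> (at t)) has_integral
           2 * of_real pi * \<i> * of_real (z powr (- c) * exp (- z))) UNIV"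
    by (simp add: mult_ac)
  show "((\<lambda>t. h (\<gamma> t) / (\<gamma> t + of_nat k) * vector_derivative \<gamma> (at t)) has_integral
           2 * of_real pi * \<i> * of_real (z ^ k * upper_Gamma (- c - real k) z)) UNIV"
    if k: "inside_loop \<gamma> (- of_nat k)"
  proof -
    define \<sigma> where "\<sigma> = max c 0 + 1"
    have \<sigma>: "\<sigma> > 0" "\<sigma> - c > 0" by (auto simp: \<sigma>_def)
    define S where "S = insert (- of_nat k) ?P"
    note v = Gamma_powr_pole_vertical_integral[OF \<sigma>(2,1) z, of k]
    have "((\<lambda>t. h (\<gamma> t) / (\<gamma> t + of_nat k) * vector_derivative \<gamma> (at t)) has_integral
            (\<i> * (LBINT t. h (Complex \<sigma> t) / (Complex \<sigma> t + of_nat k)))) UNIV"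
    proof (rule loop_has_integral_vertical[OF \<gamma>, where S = S])
      show "closed S" unfolding S_def by (intro closed_insert poles_Gamma_plus_discrete)
      show "Im w = 0" "inside_loop \<gamma> w" "Re w < \<sigma>" if "w \<in> S" for w
        using that k inside[of w] poles_Gamma_plus_discrete(2,3)[of w "- c"] by (auto simp: S_def \<sigma>_def)
      have "{w \<in> S. Re w \<ge> X} \<subseteq> insert (- of_nat k) {w \<in> ?P. Re w \<ge> X}" for X by (auto simp: S_def)
      thus "finite {w \<in> S. Re w \<ge> X}" for X
        by (rule finite_subset) (use poles_Gamma_plus_discrete(4) in auto)
      show "(\<lambda>u. h u / (u + of_nat k)) holomorphic_on - S"
        using holh by (intro holomorphic_intros) (auto simp: S_def add_eq_0_iff2 elim: holomorphic_on_subset)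
      show "integrable lborel (\<lambda>t. h (Complex \<sigma> t) / (Complex \<sigma> t + of_nat k))"
        unfolding hC by (rule v)
    next
      fix d :: real assume d: "d > 0"
      then obtain M where M: "M \<ge> 0" "\<And>u. Re u \<le> \<sigma> \<Longrightarrow> d \<le> \<bar>Im u\<bar> \<Longrightarrow> cmod (h u) \<le> M * exp (Re u) / \<bar>Im u\<bar>"
        using bd[of d \<sigma>] by blast
      have "cmod (h u / (u + of_nat k)) \<le> M / d * exp (Re u) / \<bar>Im u\<bar>" if u: "Re u \<le> \<sigma>" "d \<le> \<bar>Im u\<bar>" for u
      proof -
        have "d \<le> cmod (u + of_nat k)" using abs_Im_le_cmod[of "u + of_nat k"] u by simp
        hence "cmod (h u / (u + of_nat k)) \<le> (M * exp (Re u) / \<bar>Im u\<bar>) / d"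
          unfolding norm_divide using M u d by (intro frac_le) auto
        thus ?thesis by (simp add: mult_ac)
      qed
      thus "\<exists>M\<ge>0. \<forall>u. Re u \<le> \<sigma> \<and> d \<le> \<bar>Im u\<bar> \<longrightarrow> cmod (h u / (u + of_nat k)) \<le> M * exp (Re u) / \<bar>Im u\<bar>"
        using M(1) d by (intro exI[of _ "M / d"]) auto
    qed
    thus ?thesis unfolding hC v(2) by (simp add: mult_ac)
  qed
qed


section \<open>Partial fractions and the inverse of the Cauchy matrix\<close>

lemma prod_differences_except:
  fixes n k :: nat
  assumes "k < n"
  shows "(\<Prod>j\<in>{..<n}-{k}. of_nat j - of_nat k :: 'a :: field_char_0) = (- 1) ^ k * fact k * fact (n - 1 - k)"
proof -
  have S: "{..<n} - {k} = {..<k} \<union> {Suc k..<n}" using assms by auto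
  have "(\<Prod>j\<in>{..<n}-{k}. of_nat j - of_nat k :: 'a) =
      (\<Prod>j<k. of_nat j - of_nat k) * (\<Prod>j\<in>{Suc k..<n}. of_nat j - of_nat k)"
    unfolding S by (rule prod.union_disjoint) auto
  also have "(\<Prod>j<k. of_nat j - of_nat k :: 'a) = pochhammer (- of_nat k) k"
    by (simp add: pochhammer_prod lessThan_atLeast0)
  also have "(\<Prod>j\<in>{Suc k..<n}. of_nat j - of_nat k :: 'a) = (\<Prod>i\<in>{1..n - 1 - k}. of_nat i)"
    using assms by (intro prod.reindex_bij_witness[of _ "\<lambda>i. i + k" "\<lambda>j. j - k"]) (auto simp: of_nat_diff)
  finally show ?thesis by (simp add: pochhammer_same fact_prod)
qed

text \<open>
  Lagrange interpolation at the nodes $0,-1,\dots,1-n$: the difference of the two sides, multiplied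
  by $(u)_n$, is a polynomial of degree less than $n$ that vanishes at all nodes.
\<close>

lemma Lagrange_partial_fractions:
  fixes p :: "'a :: field_char_0 poly"
  assumes deg: "degree p < n" and u: "\<And>k. k < n \<Longrightarrow> u + of_nat k \<noteq> 0"
  shows "poly p u / pochhammer u n =
    (\<Sum>k<n. poly p (- of_nat k) / ((- 1) ^ k * fact k * fact (n - 1 - k)) / (u + of_nat k))"
proof -
  define W where "W = (\<lambda>k. \<Prod>j\<in>{..<n}-{k}. [:of_nat j, 1:] :: 'a poly)"
  define w where "w = (\<lambda>k. (- 1) ^ k * fact k * fact (n - 1 - k) :: 'a)"
  define q where "q = p - (\<Sum>k<n. smult (poly p (- of_nat k) / w k) (W k))"
  have W: "poly (W k) x = (\<Prod>j\<in>{..<n}-{k}. x + of_nat j)" for k x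
    by (simp add: W_def poly_prod add.commute)
  have "degree (W k) \<le> n - 1" if "k < n" for k
  proof -
    have "degree (W k) \<le> sum (degree \<circ> (\<lambda>j. [:of_nat j, 1:] :: 'a poly)) ({..<n}-{k})"
      unfolding W_def by (rule degree_prod_sum_le) auto
    thus ?thesis using that by simp
  qed
  hence "degree (\<Sum>k<n. smult (poly p (- of_nat k) / w k) (W k)) \<le> n - 1"
    by (intro degree_sum_le) (auto intro: order_trans[OF degree_smult_le])
  hence degq: "degree q < n"
    unfolding q_def using deg by (intro degree_diff_less) auto
  have root: "poly q (- of_nat m) = 0" if m: "m < n" for m
  proof -
    have "poly (W k) (- of_nat m) = (if k = m then w m else 0)" if "k < n" for k
    proof (cases "k = m")
      case True
      thus ?thesis using prod_differences_except[OF m, where 'a = 'a] by (simp add: W w_def add.commute)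
    next
      case False
      have "(\<Prod>j\<in>{..<n}-{k}. - of_nat m + of_nat j :: 'a) = 0"
        using m False by (intro prod_zero) (auto intro!: bexI[of _ m])
      thus ?thesis using False by (simp add: W)
    qed
    hence "poly q (- of_nat m) = poly p (- of_nat m) - (\<Sum>k<n. poly p (- of_nat k) / w k * (if k = m then w m else 0))"
      by (simp add: q_def poly_sum)
    also have "(\<Sum>k<n. poly p (- of_nat k) / w k * (if k = m then w m else 0)) =
        (\<Sum>k<n. if k = m then poly p (- of_nat m) else 0)"
      by (intro sum.cong) (auto simp: w_def)
    finally show ?thesis using m by simp
  qed
  have "q = 0"
  proof (rule ccontr)
    assume "q \<noteq> 0"
    hence "card {x. poly q x = 0} \<le> degree q" "finite {x. poly q x = 0}"
      by (auto intro: card_poly_roots_bound poly_roots_finite)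
    moreover have "(\<lambda>m. - of_nat m) ` {..<n} \<subseteq> {x. poly q x = 0}" using root by auto
    ultimately have "card ((\<lambda>m. - of_nat m :: 'a) ` {..<n}) \<le> degree q"
      by (meson card_mono order_trans)
    thus False using degq by (simp add: card_image inj_on_def)
  qed
  hence "poly p u = poly (\<Sum>k<n. smult (poly p (- of_nat k) / w k) (W k)) u"
    by (simp add: q_def)
  also have "\<dots> = (\<Sum>k<n. poly p (- of_nat k) / w k * poly (W k) u)"
    by (simp add: poly_sum)
  finally have "poly p u / pochhammer u n = (\<Sum>k<n. poly p (- of_nat k) / w k * (poly (W k) u / pochhammer u n))"
    by (simp add: sum_divide_distrib)
  also have "\<dots> = (\<Sum>k<n. poly p (- of_nat k) / w k / (u + of_nat k))"
  proof (intro sum.cong refl)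
    fix k assume k: "k \<in> {..<n}"
    have "pochhammer u n = (\<Prod>j<n. u + of_nat j)"
      by (simp add: pochhammer_prod lessThan_atLeast0)
    also have "\<dots> = (u + of_nat k) * poly (W k) u"
      using k by (simp add: W prod.remove)
    finally have P: "pochhammer u n = (u + of_nat k) * poly (W k) u" .
    have "poly (W k) u \<noteq> 0" using u by (auto simp: W)
    thus "poly p (- of_nat k) / w k * (poly (W k) u / pochhammer u n) = poly p (- of_nat k) / w k / (u + of_nat k)"
      by (simp add: P)
  qed
  finally show ?thesis by (simp add: w_def)
qed

text \<open>
  The residue of $(\alpha+1-u)_n/(u)_n$ at $u=-k$.
\<close>

definition pf_coeff :: "'a :: field_char_0 \<Rightarrow> nat \<Rightarrow> nat \<Rightarrow> 'a" where
  "pf_coeff \<alpha> n k = (- 1) ^ k * pochhammer (\<alpha> + 1 + of_nat k) n / (fact k * fact (n - 1 - k))"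

lemma of_real_pf_coeff: "of_real (pf_coeff \<alpha> n k) = (pf_coeff (of_real \<alpha>) n k :: 'a :: {real_field, field_char_0})"
proof -
  have "of_real (pochhammer x n) = (pochhammer (of_real x) n :: 'a)" for x
    by (simp add: pochhammer_prod)
  thus ?thesis by (simp add: pf_coeff_def)
qed

lemma pochhammer_minus_poly:
  fixes \<beta> :: "'a :: field_char_0" and A :: "nat set"
  assumes "finite A"
  defines "N \<equiv> \<Prod>j\<in>A. [:\<beta> + of_nat j, - 1:]"
  shows "poly N x = (\<Prod>j\<in>A. \<beta> + of_nat j - x)" "degree N = card A" "lead_coeff N = (- 1) ^ card A"
proof -
  show "poly N x = (\<Prod>j\<in>A. \<beta> + of_nat j - x)" by (simp add: N_def poly_prod)
  show "degree N = card A" unfolding N_def by (subst degree_prod_eq_sum_degree) auto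
  show "lead_coeff N = (- 1) ^ card A" unfolding N_def by (subst lead_coeff_prod) simp
qed

text \<open>
  Subtracting $(-1)^n$ times the denominator from the numerator cancels the leading terms.
\<close>

lemma pochhammer_ratio_partial_fractions:
  fixes \<alpha> u :: "'a :: field_char_0"
  assumes n: "n \<ge> 1" and u: "\<And>k. k < n \<Longrightarrow> u + of_nat k \<noteq> 0"
  shows "pochhammer (\<alpha> + 1 - u) n / pochhammer u n = (- 1) ^ n + (\<Sum>k<n. pf_coeff \<alpha> n k / (u + of_nat k))"
proof -
  define N where "N = (\<Prod>j\<in>{..<n}. [:\<alpha> + 1 + of_nat j, - 1:])"
  define D where "D = (\<Prod>j\<in>{..<n}. [:of_nat j, 1:] :: 'a poly)"
  note N' = pochhammer_minus_poly[of "{..<n}" "\<alpha> + 1", folded N_def, simplified]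
  have N: "poly N x = pochhammer (\<alpha> + 1 - x) n" for x
    by (simp add: N' pochhammer_prod lessThan_atLeast0 algebra_simps)
  have D: "poly D x = pochhammer x n" for x
    by (simp add: D_def poly_prod pochhammer_prod lessThan_atLeast0 add.commute)
  have degD: "degree D = n" unfolding D_def by (subst degree_prod_eq_sum_degree) auto
  have "lead_coeff D = 1" unfolding D_def by (subst lead_coeff_prod) simp
  hence leadD: "coeff D n = 1" using degD by simp
  define p where "p = N - smult ((- 1) ^ n) D"
  have "degree p \<le> n" unfolding p_def using N'(2) degD
    by (intro degree_diff_le) (auto intro: order_trans[OF degree_smult_le])
  moreover have "coeff p n = 0" using N'(2,3) leadD by (simp add: p_def)
  ultimately have deg: "degree p < n" using n
    by (metis degree_0 leading_coeff_0_iff le_neq_implies_less less_le_trans zero_less_one)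
  have "pochhammer u n \<noteq> 0"
  proof
    assume "pochhammer u n = 0"
    then obtain k where "k < n" "u = - of_nat k" by (auto simp: pochhammer_eq_0_iff)
    with u[of k] show False by simp
  qed
  hence "pochhammer (\<alpha> + 1 - u) n / pochhammer u n = (- 1) ^ n + poly p u / pochhammer u n"
    by (simp add: p_def N D field_simps)
  also have "poly p u / pochhammer u n =
      (\<Sum>k<n. poly p (- of_nat k) / ((- 1) ^ k * fact k * fact (n - 1 - k)) / (u + of_nat k))"
    by (rule Lagrange_partial_fractions[OF deg]) (rule u)
  also have "\<dots> = (\<Sum>k<n. pf_coeff \<alpha> n k / (u + of_nat k))"
  proof (intro sum.cong refl)
    fix k assume k: "k \<in> {..<n}"
    have "pochhammer (- of_nat k :: 'a) n = 0" using k by (simp add: pochhammer_of_nat_eq_0_iff)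
    hence "poly p (- of_nat k) = pochhammer (\<alpha> + 1 + of_nat k) n" by (simp add: p_def N D)
    moreover have "(- 1 :: 'a) ^ k * (- 1) ^ k = 1" by (simp flip: power_mult_distrib)
    ultimately show "poly p (- of_nat k) / ((- 1) ^ k * fact k * fact (n - 1 - k)) / (u + of_nat k) = pf_coeff \<alpha> n k / (u + of_nat k)"
      by (simp add: pf_coeff_def divide_simps mult_ac)
  qed
  finally show ?thesis .
qed

text \<open>
  The numerator of the decomposed fraction vanishes at $u=\alpha+1+m$.
\<close>

lemma sum_pf_coeff:
  fixes \<alpha> :: real
  assumes "\<alpha> > -1" "m < n"
  shows "(\<Sum>k<n. pf_coeff \<alpha> n k / (\<alpha> + 1 + real k + real m)) = - ((- 1) ^ n)"
proof -
  have "pochhammer (\<alpha> + 1 - (\<alpha> + 1 + real m)) n / pochhammer (\<alpha> + 1 + real m) n =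
     (- 1) ^ n + (\<Sum>k<n. pf_coeff \<alpha> n k / (\<alpha> + 1 + real m + real k))"
    using assms by (intro pochhammer_ratio_partial_fractions) auto
  moreover have "pochhammer (\<alpha> + 1 - (\<alpha> + 1 + real m)) n = 0"
    using assms by (simp add: pochhammer_of_nat_eq_0_iff)
  ultimately show ?thesis by (simp add: add_ac)
qed

text \<open>
  Drop the factor with index $l$ from the numerator $\prod_j(\alpha+1+j-u)$. The residues are then
  divided by $\alpha+1+k+l$, and at $u=\alpha+1+m$ the fraction vanishes unless $m=l$, where it is
  $1/A_l$. Hence the matrix $A_kA_l/(\alpha+1+k+l)$ is the inverse of the Cauchy matrix
  $1/(\alpha+1+k+m)$.
\<close>

lemma sum_pf_coeff_orthogonal:
  fixes \<alpha> :: real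
  assumes \<alpha>: "\<alpha> > -1" and l: "l < n" and m: "m < n"
  shows "(\<Sum>k<n. pf_coeff \<alpha> n k * pf_coeff \<alpha> n l / ((\<alpha> + 1 + real k + real l) * (\<alpha> + 1 + real k + real m))) = (if l = m then 1 else 0)"
proof -
  define N where "N = (\<Prod>j\<in>{..<n}-{l}. [:\<alpha> + 1 + of_nat j, - 1:] :: real poly)"
  note N' = pochhammer_minus_poly[of "{..<n}-{l}" "\<alpha> + 1 :: real", folded N_def, simplified]
  have deg: "degree N < n" using N'(2) l by simp
  have "poly N (\<alpha> + 1 + real m) / pochhammer (\<alpha> + 1 + real m) n =
    (\<Sum>k<n. poly N (- real k) / ((- 1) ^ k * fact k * fact (n - 1 - k)) / (\<alpha> + 1 + real m + real k))"
    using \<alpha> by (intro Lagrange_partial_fractions[OF deg]) auto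
  also have "\<dots> = (\<Sum>k<n. pf_coeff \<alpha> n k / ((\<alpha> + 1 + real k + real l) * (\<alpha> + 1 + real k + real m)))"
  proof (intro sum.cong refl)
    fix k
    have "pochhammer (\<alpha> + 1 + real k) n = (\<Prod>j<n. \<alpha> + 1 + real j + real k)"
      by (simp add: pochhammer_prod lessThan_atLeast0 add_ac)
    also have "\<dots> = (\<alpha> + 1 + real k + real l) * poly N (- real k)"
      using l by (simp add: N' prod.remove add_ac)
    finally have "poly N (- real k) = pochhammer (\<alpha> + 1 + real k) n / (\<alpha> + 1 + real k + real l)"
      using \<alpha> by (simp add: field_simps)
    moreover have "(- 1 :: real) ^ k * (- 1) ^ k = 1" by (simp flip: power_mult_distrib)
    ultimately show "poly N (- real k) / ((- 1) ^ k * fact k * fact (n - 1 - k)) / (\<alpha> + 1 + real m + real k) =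
        pf_coeff \<alpha> n k / ((\<alpha> + 1 + real k + real l) * (\<alpha> + 1 + real k + real m))"
      by (simp add: pf_coeff_def divide_simps mult_ac add_ac)
  qed
  finally have eq: "poly N (\<alpha> + 1 + real m) / pochhammer (\<alpha> + 1 + real m) n = \<dots>" .
  have pos: "pochhammer (\<alpha> + 1 + real l) n > 0" using \<alpha> by (intro pochhammer_pos) auto
  have "poly N (\<alpha> + 1 + real m) = (\<Prod>j\<in>{..<n}-{l}. real j - real m)"
    by (simp add: N')
  hence val: "poly N (\<alpha> + 1 + real m) = (if l = m then (- 1) ^ l * fact l * fact (n - 1 - l) else 0)"
    using prod_differences_except[OF l, where 'a = real] m by (auto intro!: bexI[of _ m])
  have "(\<Sum>k<n. pf_coeff \<alpha> n k * pf_coeff \<alpha> n l / ((\<alpha> + 1 + real k + real l) * (\<alpha> + 1 + real k + real m))) =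
      pf_coeff \<alpha> n l * (poly N (\<alpha> + 1 + real m) / pochhammer (\<alpha> + 1 + real m) n)"
    unfolding eq by (simp add: sum_distrib_left mult_ac)
  also have "\<dots> = (if l = m then 1 else 0)"
  proof (cases "l = m")
    case True
    have "(e * P / F) * (e * F / P) = e * e" if "P \<noteq> 0" "F \<noteq> 0" for e P F :: real
      using that by simp
    from this[of "pochhammer (\<alpha> + 1 + real l) n" "fact l * fact (n - 1 - l)" "(- 1) ^ l"] 
    show ?thesis using pos True val by (simp add: pf_coeff_def mult.assoc flip: power_mult_distrib)
  qed (use val in simp)
  finally show ?thesis .
qed


section \<open>Evaluation of the functions defined by loop integrals\<close>

lemma Gamma_quotient_pochhammer:
  assumes "u \<notin> \<int>\<^sub>\<le>\<^sub>0"
  shows "Gamma u / Gamma (of_nat n + u) = 1 / pochhammer (u :: complex) n"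
  using assms pochhammer_Gamma[of u n] by (simp add: Gamma_eq_zero_iff add.commute)

text \<open>
  At a zero of the polynomial, \<^term>\<open>Gamma v\<close> is the value 0 at a pole, and the quotient by it is
  0 as well.
\<close>

lemma Gamma_shift_quotient_pochhammer:
  assumes "of_nat n + v \<notin> \<int>\<^sub>\<le>\<^sub>0"
  shows "Gamma (of_nat n + v) / Gamma v = pochhammer (v :: complex) n"
proof (cases "v \<in> \<int>\<^sub>\<le>\<^sub>0")
  case True
  then obtain m where m: "v = - of_nat m" by (auto elim!: nonpos_Ints_cases')
  have "m < n"
  proof (rule ccontr)
    assume "\<not> m < n"
    hence "of_nat n + v = - of_nat (m - n)" by (simp add: m of_nat_diff)
    thus False using assms by simp
  qed
  thus ?thesis using True by (simp add: m pochhammer_of_nat_eq_0_iff Gamma_eq_zero_iff)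
qed (simp add: pochhammer_Gamma add.commute)

text \<open>
  The loop integrals of the individual partial fractions, hence the building blocks of $G_c$ and
  $\tilde G_c$.
\<close>

definition G_mode :: "real \<Rightarrow> nat \<Rightarrow> real \<Rightarrow> real" where
  "G_mode c k z = z ^ k * rGamma (c + 1 + real k)"

definition Gt_mode :: "real \<Rightarrow> nat \<Rightarrow> real \<Rightarrow> real" where
  "Gt_mode c k z = z ^ k * upper_Gamma (- c - real k) z"

definition G_val :: "real \<Rightarrow> real \<Rightarrow> nat \<Rightarrow> real \<Rightarrow> real" where
  "G_val \<alpha> c n z = (\<Sum>k<n. pf_coeff \<alpha> n k * G_mode c k z)"

definition Gt_val :: "real \<Rightarrow> real \<Rightarrow> nat \<Rightarrow> real \<Rightarrow> real" where
  "Gt_val \<alpha> c n z = (\<Sum>k<n. pf_coeff \<alpha> n k * Gt_mode c k z) + (- 1) ^ n * (z powr (- c) * exp (- z))"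

text \<open>
  The quotient is a rational function on the loop: by the separation property the loop misses
  all points at which a numerator factor has a pole.
\<close>

lemma separating_loop_integrand:
  assumes \<gamma>: "separating_loop \<gamma> P Q"
    and P: "poles_Gamma_plus 0 \<subseteq> P" and Q: "poles_Gamma_minus (real n + \<alpha> + 1) \<subseteq> Q" and n: "n \<ge> 1"
  shows "Gamma (\<gamma> t) * Gamma (of_real (real n + \<alpha> + 1) - \<gamma> t) / (Gamma (of_nat n + \<gamma> t) * Gamma (of_real (\<alpha> + 1) - \<gamma> t)) =
         (- 1) ^ n + (\<Sum>k<n. of_real (pf_coeff \<alpha> n k) / (\<gamma> t + of_nat k))"
proof -
  have "\<gamma> t \<notin> P" "\<gamma> t \<notin> Q"
    using \<gamma> by (auto simp: separating_loop_def inside_loop_def outside_loop_def)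
  hence u: "\<gamma> t \<notin> \<int>\<^sub>\<le>\<^sub>0" and v: "of_real (real n + \<alpha> + 1) - \<gamma> t \<notin> \<int>\<^sub>\<le>\<^sub>0"
    using P Q by (auto simp: poles_Gamma_plus_def poles_Gamma_minus_def)
  have eq: "of_real (real n + \<alpha> + 1) - \<gamma> t = of_nat n + (of_real \<alpha> + 1 - \<gamma> t)" by simp
  have nz: "\<gamma> t + of_nat k \<noteq> 0" for k
  proof
    assume "\<gamma> t + of_nat k = 0"
    hence "\<gamma> t = - of_nat k" by (simp add: add_eq_0_iff2)
    thus False using u by simp
  qed
  have "Gamma (\<gamma> t) * Gamma (of_real (real n + \<alpha> + 1) - \<gamma> t) / (Gamma (of_nat n + \<gamma> t) * Gamma (of_real (\<alpha> + 1) - \<gamma> t)) =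
     (Gamma (\<gamma> t) / Gamma (of_nat n + \<gamma> t)) * (Gamma (of_nat n + (of_real \<alpha> + 1 - \<gamma> t)) / Gamma (of_real \<alpha> + 1 - \<gamma> t))"
    unfolding eq by simp
  also have "\<dots> = pochhammer (of_real \<alpha> + 1 - \<gamma> t) n / pochhammer (\<gamma> t) n"
    using u v unfolding eq by (simp add: Gamma_quotient_pochhammer Gamma_shift_quotient_pochhammer)
  also have "\<dots> = (- 1) ^ n + (\<Sum>k<n. pf_coeff (of_real \<alpha>) n k / (\<gamma> t + of_nat k))"
    by (rule pochhammer_ratio_partial_fractions[OF n]) (rule nz)
  finally show ?thesis by (simp add: of_real_pf_coeff)
qed

lemma loop_integral_partial_fractions:
  fixes h :: "complex \<Rightarrow> complex"
  assumes \<gamma>: "separating_loop \<gamma> P Q"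
    and PQ: "poles_Gamma_plus 0 \<subseteq> P" "poles_Gamma_minus (real n + \<alpha> + 1) \<subseteq> Q" and n: "n \<ge> 1"
    and V0: "((\<lambda>t. h (\<gamma> t) * vector_derivative \<gamma> (at t)) has_integral V0) UNIV"
    and V: "\<And>k. ((\<lambda>t. h (\<gamma> t) / (\<gamma> t + of_nat k) * vector_derivative \<gamma> (at t)) has_integral V k) UNIV"
  shows "loop_integral \<gamma> (\<lambda>u. Gamma u * Gamma (of_real (real n + \<alpha> + 1) - u) /
             (Gamma (of_nat n + u) * Gamma (of_real (\<alpha> + 1) - u)) * h u) =
           (- 1) ^ n * V0 + (\<Sum>k<n. of_real (pf_coeff \<alpha> n k) * V k)"
proof -
  define d where "d = (\<lambda>t. vector_derivative \<gamma> (at t))"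
  have "((\<lambda>t. (- 1) ^ n * (h (\<gamma> t) * d t) +
      (\<Sum>k<n. of_real (pf_coeff \<alpha> n k) * (h (\<gamma> t) / (\<gamma> t + of_nat k) * d t))) has_integral
      (- 1) ^ n * V0 + (\<Sum>k<n. of_real (pf_coeff \<alpha> n k) * V k)) UNIV"
    unfolding d_def by (intro has_integral_add has_integral_mult_right has_integral_sum V0 V) auto
  also have "(\<lambda>t. (- 1) ^ n * (h (\<gamma> t) * d t) +
      (\<Sum>k<n. of_real (pf_coeff \<alpha> n k) * (h (\<gamma> t) / (\<gamma> t + of_nat k) * d t))) =
    (\<lambda>t. ((- 1) ^ n + (\<Sum>k<n. of_real (pf_coeff \<alpha> n k) / (\<gamma> t + of_nat k))) * (h (\<gamma> t) * d t))"
    by (simp add: distrib_right sum_distrib_right)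
  finally show ?thesis
    unfolding loop_integral_def separating_loop_integrand[OF \<gamma> PQ n] d_def mult.assoc by (rule integral_unique)
qed

lemma G_fun_eq:
  assumes \<gamma>: "G_contour \<alpha> c n \<gamma>" and n: "n \<ge> 1" and z: "z > 0"
  shows "G_fun \<gamma> \<alpha> c n z = of_real (G_val \<alpha> c n z)"
proof -
  define h where "h = (\<lambda>u. rGamma (of_real (c + 1) - u) * of_real z powr (- u) :: complex)"
  define K :: complex where "K = 2 * of_real pi * \<i>"
  have K: "K \<noteq> 0" by (simp add: K_def)
  have L: "left_loop \<gamma>" and ins: "inside_loop \<gamma> (- of_nat k)" for k
    using \<gamma> by (auto simp: G_contour_def separating_loop_def poles_Gamma_plus_def)
  have loops: "((\<lambda>t. h (\<gamma> t) * vector_derivative \<gamma> (at t)) has_integral 0) UNIV"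
    "((\<lambda>t. h (\<gamma> t) / (\<gamma> t + of_nat k) * vector_derivative \<gamma> (at t)) has_integral
       K * (rGamma (of_real (c + 1 + real k)) * of_real z ^ k)) UNIV" for k
    unfolding h_def K_def by (intro loop_integral_rGamma_powr L z ins)+
  have "G_fun \<gamma> \<alpha> c n z = 1 / K * loop_integral \<gamma> (\<lambda>u. Gamma u * Gamma (of_real (real n + \<alpha> + 1) - u) /
             (Gamma (of_nat n + u) * Gamma (of_real (\<alpha> + 1) - u)) * h u)"
  proof -
    have "A * B / (C * D * E) * p = A * B / (D * E) * (inverse C * p)" for A B C D E p :: complex
      by (simp add: divide_inverse mult_ac)
    thus ?thesis unfolding G_fun_def h_def K_def rGamma_inverse_Gamma by (simp only:)
  qed
  also have "\<dots> = 1 / K * ((- 1) ^ n * 0 + (\<Sum>k<n. of_real (pf_coeff \<alpha> n k) * (K * (rGamma (of_real (c + 1 + real k)) * of_real z ^ k))))"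
    by (subst loop_integral_partial_fractions[OF \<gamma>[unfolded G_contour_def] order_refl order_refl n loops]) (rule refl)
  also have "\<dots> = of_real (G_val \<alpha> c n z)"
    unfolding G_val_def G_mode_def rGamma_complex_of_real using K by (simp add: sum_distrib_left mult_ac)
  finally show ?thesis .
qed

lemma Gt_fun_eq:
  assumes \<gamma>: "Gt_contour \<alpha> c n \<gamma>" and n: "n \<ge> 1" and z: "z > 0"
  shows "Gt_fun \<gamma> \<alpha> c n z = of_real (Gt_val \<alpha> c n z)"
proof -
  define h where "h = (\<lambda>u. Gamma (u - of_real c) * of_real z powr (- u) :: complex)"
  define K :: complex where "K = 2 * of_real pi * \<i>"
  have K: "K \<noteq> 0" by (simp add: K_def)
  have L: "left_loop \<gamma>" and ins: "inside_loop \<gamma> (- of_nat k)"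
    and ins': "\<And>w. w \<in> poles_Gamma_plus (- c) \<Longrightarrow> inside_loop \<gamma> w" for k
    using \<gamma> by (auto simp: Gt_contour_def separating_loop_def poles_Gamma_plus_def)
  have loops: "((\<lambda>t. h (\<gamma> t) * vector_derivative \<gamma> (at t)) has_integral
      K * of_real (z powr (- c) * exp (- z))) UNIV"
    "((\<lambda>t. h (\<gamma> t) / (\<gamma> t + of_nat k) * vector_derivative \<gamma> (at t)) has_integral
       K * of_real (z ^ k * upper_Gamma (- c - real k) z)) UNIV" for k
    unfolding h_def K_def by (intro loop_integral_Gamma_powr L z ins ins'; assumption)+
  have "Gt_fun \<gamma> \<alpha> c n z = 1 / K * loop_integral \<gamma> (\<lambda>u. Gamma u * Gamma (of_real (real n + \<alpha> + 1) - u) /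
             (Gamma (of_nat n + u) * Gamma (of_real (\<alpha> + 1) - u)) * h u)"
  proof -
    have "A * B * C / (E * D) * p = B * C / (D * E) * (A * p)" for A B C D E p :: complex
      by (simp add: divide_inverse mult_ac)
    thus ?thesis unfolding Gt_fun_def h_def K_def by (simp only:)
  qed
  also have "\<dots> = 1 / K * ((- 1) ^ n * (K * of_real (z powr (- c) * exp (- z))) +
      (\<Sum>k<n. of_real (pf_coeff \<alpha> n k) * (K * of_real (z ^ k * upper_Gamma (- c - real k) z))))"
    by (subst loop_integral_partial_fractions[OF \<gamma>[unfolded Gt_contour_def] Un_upper2 order_refl n loops]) (rule refl)
  also have "\<dots> = of_real (Gt_val \<alpha> c n z)"
    unfolding Gt_val_def Gt_mode_def using K by (simp add: distrib_left sum_distrib_left mult_ac)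
  finally show ?thesis .
qed

lemma left_loop_translate:
  assumes "left_loop \<gamma>"
  shows "left_loop (\<lambda>t. \<gamma> t + of_real c)"
proof -
  have lim: "filterlim (\<lambda>t. Re (\<gamma> t) + c) at_bot F" if "filterlim (\<lambda>t. Re (\<gamma> t)) at_bot F" for F
    unfolding filterlim_at_bot
  proof
    fix Z
    have "\<forall>\<^sub>F t in F. Re (\<gamma> t) \<le> Z - c" using that by (auto simp: filterlim_at_bot)
    thus "\<forall>\<^sub>F t in F. Re (\<gamma> t) + c \<le> Z" by eventually_elim simp
  qed
  have "(+) (of_real c) \<circ> \<gamma> piecewise_C1_differentiable_on {s..t}" for s t
    unfolding piecewise_C1_differentiable_on_translation_eq using assms by (auto simp: left_loop_def)
  hence "(\<lambda>t. \<gamma> t + of_real c) piecewise_C1_differentiable_on {s..t}" for s t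
    by (simp add: o_def add.commute)
  thus ?thesis using assms lim by (auto simp: left_loop_def)
qed

lemma closed_truncation_translate:
  "closed_truncation (\<lambda>t. \<gamma> t + d) s t = (\<lambda>x. closed_truncation \<gamma> s t x + d)"
  by (auto simp: closed_truncation_def joinpaths_def subpath_def linepath_def algebra_simps scaleR_conv_of_real)

lemma winding_number_translate:
  "winding_number (\<lambda>x. g x + d) (w + d) = winding_number g w"
  by (subst (1 2) winding_number_offset) simp

lemma separating_loop_translate:
  assumes "separating_loop \<gamma> P Q"
  shows "separating_loop (\<lambda>t. \<gamma> t + of_real c) ((\<lambda>w. w + of_real c) ` P) ((\<lambda>w. w + of_real c) ` Q)"
proof -
  have "inside_loop (\<lambda>t. \<gamma> t + of_real c) (w + of_real c) \<longleftrightarrow> inside_loop \<gamma> w"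
    "outside_loop (\<lambda>t. \<gamma> t + of_real c) (w + of_real c) \<longleftrightarrow> outside_loop \<gamma> w" for w
    by (auto simp: inside_loop_def outside_loop_def closed_truncation_translate winding_number_translate)
  thus ?thesis using assms by (auto simp: separating_loop_def left_loop_translate)
qed

lemma loop_integral_translate:
  "loop_integral (\<lambda>t. \<gamma> t + d) f = loop_integral \<gamma> (\<lambda>u. f (u + d))"
proof -
  have "vector_derivative (\<lambda>t. \<gamma> t + d) (at t) = vector_derivative \<gamma> (at t)" for t
    by (simp add: vector_derivative_def has_vector_derivative_add_const)
  thus ?thesis by (simp add: loop_integral_def)
qed

text \<open>
  The substitution $u \mapsto u+c$ turns the conditions on the contours of $H_c$ and $\tilde H_c$ into
  those on the contours of $G_c$ and $\tilde G_c$.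
\<close>

lemma poles_Gamma_translate:
  "(\<lambda>w. w + of_real c) ` poles_Gamma_plus s = poles_Gamma_plus (s - c)"
  "(\<lambda>w. w + of_real c) ` poles_Gamma_minus s = poles_Gamma_minus (s + c)"
proof -
  show "(\<lambda>w. w + of_real c) ` poles_Gamma_plus s = poles_Gamma_plus (s - c)"
    by (auto simp: poles_Gamma_plus_def image_iff intro!: exI[of _ "_ - of_real c"]) (auto simp: algebra_simps)
  show "(\<lambda>w. w + of_real c) ` poles_Gamma_minus s = poles_Gamma_minus (s + c)"
    by (auto simp: poles_Gamma_minus_def image_iff intro!: exI[of _ "_ - of_real c"]) (auto simp: algebra_simps)
qed

lemma loop_integral_translate_powr:
  assumes "z > 0" and "\<And>u. F u = g u * of_real z powr (- u)" and "\<And>u. f u = g (u - of_real c) * of_real z powr (- u)"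
  shows "loop_integral \<gamma> F = of_real (z powr c) * loop_integral (\<lambda>t. \<gamma> t + of_real c) f"
proof -
  have "F u = of_real (z powr c) * f (u + of_real c)" for u
    using assms powr_diff[of "of_real z :: complex" "- u" "of_real c"] by (simp add: powr_of_real)
  thus ?thesis
    unfolding loop_integral_translate by (simp add: loop_integral_def mult.assoc)
qed

lemma H_fun_eq:
  assumes \<gamma>: "H_contour \<alpha> c n \<gamma>" and n: "n \<ge> 1" and z: "z > 0"
  shows "H_fun \<gamma> \<alpha> c n z = of_real (z powr c * G_val \<alpha> c n z)"
proof -
  define \<gamma>' where "\<gamma>' = (\<lambda>t. \<gamma> t + of_real c)"
  have e: "real n + \<alpha> - c + 1 + c = real n + \<alpha> + 1" "c - c = 0" by auto
  have \<gamma>': "G_contour \<alpha> c n \<gamma>'"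
    using separating_loop_translate[OF \<gamma>[unfolded H_contour_def], of c]
    unfolding poles_Gamma_translate e G_contour_def \<gamma>'_def .
  have "H_fun \<gamma> \<alpha> c n z = of_real (z powr c) * G_fun \<gamma>' \<alpha> c n z"
    unfolding H_fun_def G_fun_def \<gamma>'_def
    by (subst loop_integral_translate_powr[OF z refl, where c = c and f = "\<lambda>u. Gamma u * Gamma (of_real (real n + \<alpha> + 1) - u) /
      (Gamma (of_real (c + 1) - u) * Gamma (of_nat n + u) * Gamma (of_real (\<alpha> + 1) - u)) * of_real z powr (- u)"])
      (simp_all add: algebra_simps)
  thus ?thesis using n z \<gamma>' by (simp add: G_fun_eq)
qed

lemma Ht_fun_eq:
  assumes \<gamma>: "Ht_contour \<alpha> c n \<gamma>" and n: "n \<ge> 1" and z: "z > 0"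
  shows "Ht_fun \<gamma> \<alpha> c n z = of_real (z powr c * Gt_val \<alpha> c n z)"
proof -
  define \<gamma>' where "\<gamma>' = (\<lambda>t. \<gamma> t + of_real c)"
  have e: "real n + \<alpha> - c + 1 + c = real n + \<alpha> + 1" "c - c = 0" "0 - c = - c" by auto
  have \<gamma>': "Gt_contour \<alpha> c n \<gamma>'"
    using separating_loop_translate[OF \<gamma>[unfolded Ht_contour_def], of c]
    unfolding image_Un poles_Gamma_translate e Gt_contour_def \<gamma>'_def .
  have "Ht_fun \<gamma> \<alpha> c n z = of_real (z powr c) * Gt_fun \<gamma>' \<alpha> c n z"
    unfolding Ht_fun_def Gt_fun_def \<gamma>'_def
    by (subst loop_integral_translate_powr[OF z refl, where c = c and f = "\<lambda>u. Gamma (u - of_real c) * Gamma u *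
      Gamma (of_real (real n + \<alpha> + 1) - u) / (Gamma (of_real (\<alpha> + 1) - u) * Gamma (of_nat n + u)) * of_real z powr (- u)"])
      (simp_all add: algebra_simps)
  thus ?thesis using n z \<gamma>' by (simp add: Gt_fun_eq)
qed


section \<open>The incomplete Gamma function\<close>

text \<open>
  For $p>0$ the maximum of $w^pe^{-w}$ is attained at $w=p$.
\<close>

lemma powr_mult_exp_minus_bounded:
  fixes p :: real
  assumes "p \<ge> 0"
  shows "\<exists>C\<ge>0. \<forall>w>0. w powr p * exp (- w) \<le> C"
proof (cases "p = 0")
  case True
  thus ?thesis by (intro exI[of _ 1]) auto
next
  case False
  hence p: "p > 0" using assms by simp
  have "w powr p * exp (- w) \<le> p powr p" if w: "w > 0" for w
  proof -
    have "ln (w / p) \<le> w / p - 1" using w p by (intro ln_le_minus_one) auto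
    hence "p * (ln w - ln p) \<le> p * (w / p - 1)"
      using w p by (intro mult_left_mono) (auto simp: ln_div)
    hence "p * ln w - w \<le> p * ln p" using p by (simp add: algebra_simps)
    hence "exp (p * ln w - w) \<le> exp (p * ln p)" by simp
    thus ?thesis using w p by (simp add: powr_def exp_diff exp_minus divide_inverse)
  qed
  thus ?thesis by (intro exI[of _ "p powr p"]) auto
qed

text \<open>
  Both facts come from comparing the integrand with a multiple of $w^{-r-1}$, whose integral is explicit.
\<close>

lemma
  fixes s r :: real
  assumes r: "r > 0" "s + r \<ge> 0"
  shows upper_Gamma_integrable_if_dominated: "\<And>z. z > 0 \<Longrightarrow> set_integrable lborel {z<..} (\<lambda>w. w powr (s - 1) * exp (- w))"
    and upper_Gamma_bound: "\<exists>C\<ge>0. \<forall>z>0. \<bar>upper_Gamma s z\<bar> \<le> C * z powr (- r)"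
proof -
  obtain C where C: "C \<ge> 0" "\<And>w. w > 0 \<Longrightarrow> w powr (s + r) * exp (- w) \<le> C"
    using powr_mult_exp_minus_bounded[OF r(2)] by blast
  have le: "w powr (s - 1) * exp (- w) \<le> C * w powr (- r - 1)" if "w > 0" for w
  proof -
    have "w powr (s - 1) * exp (- w) = (w powr (s + r) * exp (- w)) * w powr (- r - 1)"
      by (simp flip: powr_add)
    also have "\<dots> \<le> C * w powr (- r - 1)"
      using C(2)[OF that] by (intro mult_right_mono) auto
    finally show ?thesis .
  qed
  have tail: "set_integrable lborel {z<..} (\<lambda>w. C * w powr (- r - 1))" if "z > 0" for z
    using powr_tail_integral(1)[of "of_real r" z] r that by simp
  show int: "set_integrable lborel {z<..} (\<lambda>w. w powr (s - 1) * exp (- w))" if z: "z > 0" for z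
  proof (rule set_integrable_bound[OF tail[OF z]])
    show "set_borel_measurable lborel {z<..} (\<lambda>w. w powr (s - 1) * exp (- w))"
      unfolding set_borel_measurable_def by measurable
  qed (use z le C(1) in \<open>auto simp: abs_mult\<close>)
  have "\<bar>upper_Gamma s z\<bar> \<le> C / r * z powr (- r)" if z: "z > 0" for z
  proof -
    have "0 \<le> upper_Gamma s z"
      unfolding upper_Gamma_def set_lebesgue_integral_def by (intro integral_nonneg_AE) auto
    moreover have "upper_Gamma s z \<le> (LBINT w:{z<..}. C * w powr (- r - 1))"
      unfolding upper_Gamma_def using z le by (intro set_integral_mono int tail) auto
    moreover have "(LBINT w:{z<..}. w powr (- r - 1)) = z powr (- r) / r"
    proof -
      have "(LBINT w:{z<..}. of_real w powr (- of_real r - 1) :: complex) = of_real z powr (- of_real r) / of_real r"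
        using r z by (intro powr_tail_integral) auto
      also have "(LBINT w:{z<..}. of_real w powr (- of_real r - 1) :: complex) = (LBINT w:{z<..}. complex_of_real (w powr (- r - 1)))"
        using z powr_of_real[of _ "- r - 1"] by (intro set_lebesgue_integral_cong) auto
      also have "\<dots> = of_real (LBINT w:{z<..}. w powr (- r - 1))" by (rule set_integral_complex_of_real)
      also have "of_real z powr (- of_real r) / of_real r = complex_of_real (z powr (- r) / r)"
        using z powr_of_real[of z "- r"] by simp
      finally show ?thesis by (simp only: of_real_eq_iff)
    qed
    ultimately show ?thesis by simp
  qed
  thus "\<exists>C\<ge>0. \<forall>z>0. \<bar>upper_Gamma s z\<bar> \<le> C * z powr (- r)"
    using C(1) r by (intro exI[of _ "C / r"]) auto
qed

lemma upper_Gamma_integrable: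
  fixes s z :: real
  shows "z > 0 \<Longrightarrow> set_integrable lborel {z<..} (\<lambda>w. w powr (s - 1) * exp (- w))"
  by (rule upper_Gamma_integrable_if_dominated[of "\<bar>s\<bar> + 1"]) auto

lemma upper_Gamma_nonneg: "upper_Gamma s z \<ge> 0"
  unfolding upper_Gamma_def set_lebesgue_integral_def by (intro integral_nonneg_AE) auto

lemma nn_integral_upper_Gamma:
  assumes "z > 0"
  shows "(\<integral>\<^sup>+w. ennreal (indicator {z<..} w * (w powr (s - 1) * exp (- w))) \<partial>lborel) = ennreal (upper_Gamma s z)"
  using upper_Gamma_integrable[OF assms, of s]
  by (subst nn_integral_eq_integral) (auto simp: upper_Gamma_def set_integrable_def set_lebesgue_integral_def)

text \<open>
  Near $z$ the integral from $z$ is a constant minus the integral from $z/2$ over a compact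
  interval.
\<close>

lemma DERIV_upper_Gamma:
  assumes z: "z > 0"
  shows "(upper_Gamma s has_real_derivative - (z powr (s - 1) * exp (- z))) (at z)"
proof -
  define f where "f = (\<lambda>w::real. w powr (s - 1) * exp (- w))"
  have ein: "einterval (ereal y) \<infinity> = {y<..}" for y by (auto simp: einterval_def)
  have U: "upper_Gamma s y = (LBINT w=ereal y..\<infinity>. f w)" for y
    by (simp add: upper_Gamma_def f_def interval_lebesgue_integral_def ein)
  have cont: "continuous_on {z / 2..2 * z} f"
    using z unfolding f_def by (intro continuous_intros) auto
  have "((\<lambda>u. LBINT w=z / 2..u. f w) has_vector_derivative f z) (at z within {z / 2..2 * z})"
    using z cont by (intro interval_integral_FTC2[of "z / 2" "z / 2" "2 * z"]) auto
  hence D: "((\<lambda>u. LBINT w=z / 2..u. f w) has_real_derivative f z) (at z)"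
    using z at_within_Icc_at[of "z / 2" z "2 * z"] by (simp add: has_real_derivative_iff_has_vector_derivative)
  have "((\<lambda>u. upper_Gamma s (z / 2) - (LBINT w=z / 2..u. f w)) has_real_derivative - f z) (at z)"
    using DERIV_diff[OF DERIV_const D] by simp
  moreover have "\<forall>\<^sub>F u in nhds z. upper_Gamma s (z / 2) - (LBINT w=z / 2..u. f w) = upper_Gamma s u"
  proof -
    have "\<forall>\<^sub>F u in nhds z. u \<in> {z / 2<..}"
      using z by (intro eventually_nhds_in_open) auto
    thus ?thesis
    proof eventually_elim
      case (elim u)
      have "interval_lebesgue_integrable lborel (ereal (z / 2)) \<infinity> f"
        using upper_Gamma_integrable[of "z / 2" s] z by (simp add: interval_lebesgue_integrable_def ein f_def)
      hence "(LBINT w=ereal (z / 2)..ereal u. f w) + (LBINT w=ereal u..\<infinity>. f w) = (LBINT w=ereal (z / 2)..\<infinity>. f w)"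
        using elim by (intro interval_integral_sum) (simp add: min_def max_def)
      thus ?case by (simp add: U)
    qed
  qed
  ultimately show ?thesis
    using DERIV_cong_ev[OF refl] by (force simp: f_def)
qed


section \<open>Moments of the Cauchy--Laguerre weight\<close>

lemma nn_integral_Gamma_scaled:
  assumes \<beta>: "\<beta> > -1" and c: "c > 0"
  shows "(\<integral>\<^sup>+v. ennreal (indicator {0<..} v * (v powr \<beta> * exp (- (c * v)))) \<partial>lborel) =
          ennreal (Gamma (\<beta> + 1) * c powr (- \<beta> - 1))"
proof -
  let ?f = "\<lambda>v. ennreal (indicator {0<..} v * (v powr \<beta> * exp (- (c * v))))"
  have "(\<integral>\<^sup>+v. ?f v \<partial>lborel) = \<bar>1 / c\<bar> * (\<integral>\<^sup>+v. ?f (0 + 1 / c * v) \<partial>lborel)"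
    using c by (intro nn_integral_real_affine) auto
  also have "(\<lambda>v. ?f (0 + 1 / c * v)) = (\<lambda>v. ennreal (c powr (- \<beta>)) * ennreal (indicator {0..} v * v powr (\<beta> + 1 - 1) / exp v))"
  proof
    fix v
    have "indicator {0<..} (v / c) * ((v / c) powr \<beta> * exp (- v)) = c powr (- \<beta>) * (indicator {0..} v * v powr \<beta> / exp v)"
    proof (cases "v > 0")
      case True
      hence "(v / c) powr \<beta> = c powr (- \<beta>) * v powr \<beta>"
        using c powr_divide[of v c \<beta>] by (simp add: powr_minus field_simps)
      thus ?thesis using True c by (simp add: exp_minus divide_inverse)
    next
      case False
      hence "\<not> v / c > 0" using c by (simp add: zero_less_divide_iff)
      thus ?thesis using False by (cases "v = 0") auto
    qed
    thus "?f (0 + 1 / c * v) = ennreal (c powr (- \<beta>)) * ennreal (indicator {0..} v * v powr (\<beta> + 1 - 1) / exp v)"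
      using c by (subst ennreal_mult'[symmetric]) auto
  qed
  also have "(\<integral>\<^sup>+v. ennreal (c powr (- \<beta>)) * ennreal (indicator {0..} v * v powr (\<beta> + 1 - 1) / exp v) \<partial>lborel) =
      ennreal (c powr (- \<beta>)) * ennreal (Gamma (\<beta> + 1))"
    using \<beta> by (subst nn_integral_cmult) (auto simp: Gamma_conv_nn_integral_real)
  also have "ennreal \<bar>1 / c\<bar> * (ennreal (c powr (- \<beta>)) * ennreal (Gamma (\<beta> + 1))) = ennreal (1 / c * (c powr (- \<beta>) * Gamma (\<beta> + 1)))"
    using c \<beta> by (simp add: ennreal_mult'[symmetric] Gamma_real_pos less_imp_le)
  also have "1 / c * (c powr (- \<beta>) * Gamma (\<beta> + 1)) = Gamma (\<beta> + 1) * c powr (- \<beta> - 1)"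
    using c by (simp add: powr_diff)
  finally show ?thesis .
qed

lemma nn_integral_exp_tail:
  assumes "c > 0"
  shows "(\<integral>\<^sup>+w. ennreal (indicator {y<..} w * exp (- (c * w))) \<partial>lborel) = ennreal (exp (- (c * y)) / c)"
proof -
  have "(\<integral>\<^sup>+w. ennreal (indicator {y<..} w * exp (- (c * w))) \<partial>lborel) =
        (\<integral>\<^sup>+w. ennreal (indicator {y..} w * exp (- c * w)) \<partial>lborel)"
    using AE_lborel_singleton[of y] by (intro nn_integral_cong_AE) (auto simp: indicator_def elim!: eventually_mono)
  also have "\<dots> = ennreal (exp (- c * y) / c)"
    using assms by (intro nn_integral_has_integral_lebesgue has_integral_exp_minus_to_infinity) auto
  finally show ?thesis by simp
qed

text \<open>
  A closed form for $\int_0^\infty v^\beta e^{-v}/(y+v)\,dv$.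
\<close>

definition Stieltjes_moment :: "real \<Rightarrow> real \<Rightarrow> real" where
  "Stieltjes_moment \<beta> y = Gamma (\<beta> + 1) * y powr \<beta> * exp y * upper_Gamma (- \<beta>) y"

lemma Stieltjes_moment_nonneg: "\<beta> > -1 \<Longrightarrow> Stieltjes_moment \<beta> y \<ge> 0"
  by (simp add: Stieltjes_moment_def upper_Gamma_nonneg Gamma_real_pos less_imp_le)

text \<open>
  Write $1/(y+v)$ as $e^{y+v}/y$ times the integral of $e^{-w(y+v)/y}$ over $w>y$ and exchange the
  integrals; the inner one is then a scaled Euler integral and leaves the integrand of
  $\Gamma(-\beta,y)$ behind.
\<close>

lemma has_bochner_integral_Stieltjes_moment:
  assumes \<beta>: "\<beta> > -1" and y: "y > 0"
  shows "has_bochner_integral lborel (\<lambda>v. indicator {0<..} v * (v powr \<beta> * exp (- v) / (y + v))) (Stieltjes_moment \<beta> y)"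
proof -
  define F where "F = (\<lambda>v w. indicator {0<..} v * indicator {y<..} w * (exp y / y) * v powr \<beta> * exp (- (w * (y + v) / y)))"
  have [measurable]: "(\<lambda>(v, w). ennreal (F v w)) \<in> borel_measurable (lborel \<Otimes>\<^sub>M lborel)"
    unfolding F_def by measurable
  have w: "(\<integral>\<^sup>+w. ennreal (F v w) \<partial>lborel) = ennreal (indicator {0<..} v * (v powr \<beta> * exp (- v) / (y + v)))" for v
  proof (cases "v > 0")
    case True
    define c where "c = (y + v) / y"
    have c: "c > 0" "c * y = y + v" using True y by (auto simp: c_def)
    have "(\<integral>\<^sup>+w. ennreal (F v w) \<partial>lborel) = (\<integral>\<^sup>+w. ennreal (exp y / y * v powr \<beta>) * ennreal (indicator {y<..} w * exp (- (c * w))) \<partial>lborel)"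
      using True y by (intro nn_integral_cong) (subst ennreal_mult'[symmetric], auto simp: F_def c_def mult_ac)
    also have "\<dots> = ennreal (exp y / y * v powr \<beta>) * ennreal (exp (- (c * y)) / c)"
      by (subst nn_integral_cmult) (auto simp: nn_integral_exp_tail[OF c(1)])
    also have "\<dots> = ennreal (exp y / y * v powr \<beta> * (exp (- (c * y)) / c))"
      using y by (subst ennreal_mult') auto
    also have "exp y / y * v powr \<beta> * (exp (- (c * y)) / c) = v powr \<beta> * exp (- v) / (y + v)"
    proof -
      have "exp y / y * v powr \<beta> * (exp (- (c * y)) / c) = v powr \<beta> * (exp y * exp (- (c * y))) / (c * y)"
        by (simp add: mult_ac)
      also have "exp y * exp (- (c * y)) = exp (- v)" by (simp add: c(2) flip: exp_add)
      finally show ?thesis by (simp only: c(2))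
    qed
    finally show ?thesis using True by simp
  qed (simp add: F_def)
  have v: "(\<integral>\<^sup>+v. ennreal (F v w) \<partial>lborel) = ennreal (Gamma (\<beta> + 1) * y powr \<beta> * exp y) * ennreal (indicator {y<..} w * (w powr (- \<beta> - 1) * exp (- w)))" for w
  proof (cases "w > y")
    case True
    have "(\<integral>\<^sup>+v. ennreal (F v w) \<partial>lborel) = (\<integral>\<^sup>+v. ennreal (exp y / y * exp (- w)) * ennreal (indicator {0<..} v * (v powr \<beta> * exp (- (w / y * v)))) \<partial>lborel)"
    proof (intro nn_integral_cong)
      fix v :: real
      have "w * (y + v) / y = w + w / y * v" using y by (simp add: field_simps)
      hence "exp (- (w * (y + v) / y)) = exp (- w) * exp (- (w / y * v))" by (simp flip: exp_add)
      thus "ennreal (F v w) = ennreal (exp y / y * exp (- w)) * ennreal (indicator {0<..} v * (v powr \<beta> * exp (- (w / y * v))))"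
        using True y by (subst ennreal_mult'[symmetric]) (auto simp: F_def mult_ac)
    qed
    also have "\<dots> = ennreal (exp y / y * exp (- w)) * ennreal (Gamma (\<beta> + 1) * (w / y) powr (- \<beta> - 1))"
      using nn_integral_Gamma_scaled[OF \<beta>, of "w / y"] True y by (subst nn_integral_cmult) auto
    also have "\<dots> = ennreal (exp y / y * exp (- w) * (Gamma (\<beta> + 1) * (w / y) powr (- \<beta> - 1)))"
      using y by (subst ennreal_mult') auto
    also have "exp y / y * exp (- w) * (Gamma (\<beta> + 1) * (w / y) powr (- \<beta> - 1)) =
        Gamma (\<beta> + 1) * y powr \<beta> * exp y * (w powr (- \<beta> - 1) * exp (- w))"
    proof -
      have "(w / y) powr (- \<beta> - 1) = w powr (- \<beta> - 1) / y powr (- \<beta> - 1)"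
        using True y by (simp add: powr_divide)
      also have "y powr (- \<beta> - 1) = inverse (y powr \<beta> * y)"
        using y by (simp add: powr_diff powr_minus divide_inverse)
      finally show ?thesis using y by (simp add: field_simps)
    qed
    also have "ennreal \<dots> = ennreal (Gamma (\<beta> + 1) * y powr \<beta> * exp y) * ennreal (w powr (- \<beta> - 1) * exp (- w))"
      using \<beta> by (subst ennreal_mult') (auto simp: Gamma_real_pos less_imp_le)
    finally show ?thesis using True by simp
  qed (simp add: F_def)
  have "(\<integral>\<^sup>+v. ennreal (indicator {0<..} v * (v powr \<beta> * exp (- v) / (y + v))) \<partial>lborel) = (\<integral>\<^sup>+v. (\<integral>\<^sup>+w. ennreal (F v w) \<partial>lborel) \<partial>lborel)"
    by (simp add: w)
  also have "\<dots> = (\<integral>\<^sup>+w. (\<integral>\<^sup>+v. ennreal (F v w) \<partial>lborel) \<partial>lborel)"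
    by (rule lborel_pair.Fubini'[symmetric]) measurable
  also have "\<dots> = ennreal (Gamma (\<beta> + 1) * y powr \<beta> * exp y) * ennreal (upper_Gamma (- \<beta>) y)"
    unfolding v by (subst nn_integral_cmult) (auto simp: nn_integral_upper_Gamma[OF y, of "- \<beta>", simplified])
  also have "\<dots> = ennreal (Stieltjes_moment \<beta> y)"
    unfolding Stieltjes_moment_def using \<beta> by (subst ennreal_mult') (auto simp: Gamma_real_pos less_imp_le)
  finally show ?thesis
    using \<beta> y by (intro has_bochner_integral_nn_integral) (auto simp: Stieltjes_moment_nonneg indicator_def)
qed

lemma upper_Gamma_measurable: "(\<lambda>y. indicator {0<..} y * upper_Gamma s y) \<in> borel_measurable borel"
proof -
  have "continuous_on {0<..} (upper_Gamma s)"
    using DERIV_upper_Gamma by (intro DERIV_continuous_on[of _ _ "\<lambda>z. - (z powr (s - 1) * exp (- z))"])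
      (auto intro: has_field_derivative_at_within)
  from borel_measurable_continuous_on_indicator[OF _ this] show ?thesis by simp
qed

text \<open>
  In $\int_0^\infty y^{\beta+\beta'}\,\Gamma(-\beta,y)\,dy$ the exchange of integrals leaves
  $\int_0^w y^{\beta+\beta'}dy$ inside and an Euler integral outside. The condition
  $\beta+\beta'>-1$ makes the inner integral converge.
\<close>

lemma has_bochner_integral_Cauchy_Laguerre_moment:
  assumes \<beta>: "\<beta> > -1" and \<beta>': "\<beta>' > -1" and sum: "\<beta> + \<beta>' > -1"
  shows "has_bochner_integral lborel (\<lambda>y. indicator {0<..} y * (y powr \<beta>' * exp (- y) * Stieltjes_moment \<beta> y))
           (Gamma (\<beta> + 1) * Gamma (\<beta>' + 1) / (\<beta> + \<beta>' + 1))"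
proof -
  define p where "p = \<beta> + \<beta>'"
  define G where "G = Gamma (\<beta> + 1)"
  have G: "G > 0" using \<beta> by (simp add: G_def Gamma_real_pos)
  have G': "Gamma (\<beta>' + 1) > 0" using \<beta>' by (simp add: Gamma_real_pos)
  have p: "p > -1" using sum by (simp add: p_def)
  define F where "F = (\<lambda>y w. indicator {0<..} y * y powr p * (indicator {y<..} w * (w powr (- \<beta> - 1) * exp (- w))))"
  have [measurable]: "(\<lambda>(y, w). ennreal (F y w)) \<in> borel_measurable (lborel \<Otimes>\<^sub>M lborel)"
  proof -
    have "(\<lambda>(y, w). ennreal (F y w)) = (\<lambda>(y, w). ennreal (indicator {0<..} y * y powr p * ((if y < w then 1 else 0) * (w powr (- \<beta> - 1) * exp (- w)))))"
      by (auto simp: F_def indicator_def fun_eq_iff)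
    also have "\<dots> \<in> borel_measurable (lborel \<Otimes>\<^sub>M lborel)" by measurable
    finally show ?thesis .
  qed
  have w: "ennreal G * (\<integral>\<^sup>+w. ennreal (F y w) \<partial>lborel) = ennreal (indicator {0<..} y * (y powr \<beta>' * exp (- y) * Stieltjes_moment \<beta> y))" for y
  proof (cases "y > 0")
    case True
    have "(\<integral>\<^sup>+w. ennreal (F y w) \<partial>lborel) = (\<integral>\<^sup>+w. ennreal (y powr p) * ennreal (indicator {y<..} w * (w powr (- \<beta> - 1) * exp (- w))) \<partial>lborel)"
      using True by (intro nn_integral_cong) (subst ennreal_mult'[symmetric], auto simp: F_def mult_ac)
    also have "\<dots> = ennreal (y powr p) * ennreal (upper_Gamma (- \<beta>) y)"
      by (subst nn_integral_cmult) (auto simp: nn_integral_upper_Gamma[OF True, of "- \<beta>", simplified])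
    finally have "ennreal G * (\<integral>\<^sup>+w. ennreal (F y w) \<partial>lborel) = ennreal (G * (y powr p * upper_Gamma (- \<beta>) y))"
      using G by (simp add: ennreal_mult')
    also have "G * (y powr p * upper_Gamma (- \<beta>) y) = y powr \<beta>' * exp (- y) * Stieltjes_moment \<beta> y"
      using True by (simp add: Stieltjes_moment_def G_def p_def powr_add exp_minus field_simps)
    finally show ?thesis using True by simp
  qed (simp add: F_def)
  have y: "(\<integral>\<^sup>+y. ennreal (F y w) \<partial>lborel) = ennreal (1 / (p + 1)) * ennreal (indicator {0<..} w * (w powr \<beta>' * exp (- w)))" for w
  proof (cases "w > 0")
    case True
    have "(\<integral>\<^sup>+y. ennreal (F y w) \<partial>lborel) = (\<integral>\<^sup>+y. ennreal (w powr (- \<beta> - 1) * exp (- w)) * ennreal (indicator {0..w} y * y powr p) \<partial>lborel)"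
      using AE_lborel_singleton[of w] AE_lborel_singleton[of 0]
      by (intro nn_integral_cong_AE, eventually_elim)
         (subst ennreal_mult'[symmetric], auto simp: F_def indicator_def)
    also have "\<dots> = ennreal (w powr (- \<beta> - 1) * exp (- w)) * ennreal (w powr (p + 1) / (p + 1))"
    proof (subst nn_integral_cmult)
      have "(\<integral>\<^sup>+y. ennreal (indicator {0..w} y * y powr p) \<partial>lborel) = ennreal (w powr (p + 1) / (p + 1))"
        using p True by (intro nn_integral_has_integral_lebesgue has_integral_powr_from_0) auto
      thus "ennreal (w powr (- \<beta> - 1) * exp (- w)) * (\<integral>\<^sup>+y. ennreal (indicator {0..w} y * y powr p) \<partial>lborel) =
        ennreal (w powr (- \<beta> - 1) * exp (- w)) * ennreal (w powr (p + 1) / (p + 1))" by simp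
    qed auto
    also have "\<dots> = ennreal (w powr (- \<beta> - 1) * exp (- w) * (w powr (p + 1) / (p + 1)))"
      by (subst ennreal_mult') auto
    also have "w powr (- \<beta> - 1) * exp (- w) * (w powr (p + 1) / (p + 1)) = 1 / (p + 1) * (w powr (- \<beta> - 1) * w powr (p + 1) * exp (- w))"
      by simp
    also have "w powr (- \<beta> - 1) * w powr (p + 1) = w powr \<beta>'" by (simp add: p_def flip: powr_add)
    also have "ennreal (1 / (p + 1) * (w powr \<beta>' * exp (- w))) = ennreal (1 / (p + 1)) * ennreal (w powr \<beta>' * exp (- w))"
      using p by (subst ennreal_mult') auto
    finally show ?thesis using True by simp
  next
    case False
    hence "F y w = 0" for y by (auto simp: F_def indicator_def)
    thus ?thesis using False by simp
  qed
  have "(\<integral>\<^sup>+y. ennreal (indicator {0<..} y * (y powr \<beta>' * exp (- y) * Stieltjes_moment \<beta> y)) \<partial>lborel) =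
        (\<integral>\<^sup>+y. ennreal G * (\<integral>\<^sup>+w. ennreal (F y w) \<partial>lborel) \<partial>lborel)"
    by (simp only: w)
  also have "\<dots> = ennreal G * (\<integral>\<^sup>+y. (\<integral>\<^sup>+w. ennreal (F y w) \<partial>lborel) \<partial>lborel)"
    by (rule nn_integral_cmult) measurable
  also have "(\<integral>\<^sup>+y. (\<integral>\<^sup>+w. ennreal (F y w) \<partial>lborel) \<partial>lborel) = (\<integral>\<^sup>+w. (\<integral>\<^sup>+y. ennreal (F y w) \<partial>lborel) \<partial>lborel)"
    by (rule lborel_pair.Fubini'[symmetric]) measurable
  also have "\<dots> = ennreal (1 / (p + 1)) * ennreal (Gamma (\<beta>' + 1))"
    unfolding y using nn_integral_Gamma_scaled[OF \<beta>', of 1] by (subst nn_integral_cmult) auto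
  also have "ennreal G * (ennreal (1 / (p + 1)) * ennreal (Gamma (\<beta>' + 1))) = ennreal (Gamma (\<beta> + 1) * Gamma (\<beta>' + 1) / (\<beta> + \<beta>' + 1))"
    using G G' p by (simp add: G_def p_def ennreal_mult'[symmetric])
  finally have nn: "(\<integral>\<^sup>+y. ennreal (indicator {0<..} y * (y powr \<beta>' * exp (- y) * Stieltjes_moment \<beta> y)) \<partial>lborel) = \<dots>" .
  have "(\<lambda>y. y powr \<beta>' * exp (- y) * (Gamma (\<beta> + 1) * y powr \<beta> * exp y) * (indicator {0<..} y * upper_Gamma (- \<beta>) y)) \<in> borel_measurable borel"
    using upper_Gamma_measurable[of "- \<beta>"] by measurable
  hence "(\<lambda>y. indicator {0<..} y * (y powr \<beta>' * exp (- y) * Stieltjes_moment \<beta> y)) \<in> borel_measurable lborel"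
    by (simp add: Stieltjes_moment_def mult_ac)
  thus ?thesis
    using nn \<beta> G G' p by (intro has_bochner_integral_nn_integral) 
      (auto simp: Stieltjes_moment_nonneg G_def p_def add_ac)
qed


section \<open>The kernels as finite sums\<close>

lemma poly_eq_sum_lessThan:
  assumes "degree (f :: real poly) < n"
  shows "poly f x = (\<Sum>i<n. coeff f i * x ^ i)"
proof -
  have "poly f x = (\<Sum>i\<le>degree f. coeff f i * x ^ i)" by (rule poly_altdef)
  also have "\<dots> = (\<Sum>i<n. coeff f i * x ^ i)"
    using assms by (intro sum.mono_neutral_left) (auto simp: coeff_eq_0)
  finally show ?thesis .
qed

lemma has_bochner_integral_Stieltjes_sum:
  assumes a: "a > -1" and y: "y > 0"
  shows "has_bochner_integral lborel (\<lambda>v. indicator {0<..} v * ((\<Sum>i<n. C i * v ^ i) * (v powr a * exp (- v) / (y + v))))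
           (\<Sum>i<n. C i * Stieltjes_moment (a + real i) y)"
proof -
  have "has_bochner_integral lborel (\<lambda>v. \<Sum>i<n. C i * (indicator {0<..} v * (v powr (a + real i) * exp (- v) / (y + v))))
           (\<Sum>i<n. C i * Stieltjes_moment (a + real i) y)"
    using a y by (intro has_bochner_integral_sum has_bochner_integral_mult_right has_bochner_integral_Stieltjes_moment) auto
  also have "(\<lambda>v. \<Sum>i<n. C i * (indicator {0<..} v * (v powr (a + real i) * exp (- v) / (y + v)))) =
      (\<lambda>v. indicator {0<..} v * ((\<Sum>i<n. C i * v ^ i) * (v powr a * exp (- v) / (y + v))))"
  proof
    fix v :: real
    show "(\<Sum>i<n. C i * (indicator {0<..} v * (v powr (a + real i) * exp (- v) / (y + v)))) =
      indicator {0<..} v * ((\<Sum>i<n. C i * v ^ i) * (v powr a * exp (- v) / (y + v)))"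
      by (cases "v > 0") (auto simp: powr_add powr_realpow sum_distrib_left sum_distrib_right sum_divide_distrib mult_ac intro!: sum.cong)
  qed
  finally show ?thesis .
qed

lemma Stieltjes_sum_integral:
  assumes "a > -1" "y > 0"
  shows "(LBINT v:{0<..}. (\<Sum>i<n. C i * v ^ i) * (v powr a * exp (- v) / (y + v))) =
           (\<Sum>i<n. C i * Stieltjes_moment (a + real i) y)"
  using has_bochner_integral_integral_eq[OF has_bochner_integral_Stieltjes_sum[OF assms, of C n]]
  by (simp add: set_lebesgue_integral_def)

text \<open>
  The entries of the moment matrix of the weight $x^ay^be^{-x-y}/(x+y)$.
\<close>

definition Cauchy_Laguerre_moment :: "real \<Rightarrow> real \<Rightarrow> nat \<Rightarrow> nat \<Rightarrow> real" where
  "Cauchy_Laguerre_moment a b i j = Gamma (a + real i + 1) * Gamma (b + real j + 1) / (a + b + real i + real j + 1)"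

text \<open>
  Expanding both polynomials turns the inner integral into Stieltjes transforms of powers and the
  outer one into moments.
\<close>

lemma Cauchy_Laguerre_pairing:
  assumes a: "a > -1" and b: "b > -1" and ab: "a + b > -1"
    and f: "degree f < n" and g: "degree g < n"
  shows "(LBINT y:{0<..}. (LBINT x:{0<..}.
           x powr a * y powr b * exp (- x - y) / (x + y) * poly f x * poly g y)) =
         (\<Sum>i<n. \<Sum>j<n. coeff f i * coeff g j * Cauchy_Laguerre_moment a b i j)"
proof -
  have inner: "(LBINT x:{0<..}. x powr a * y powr b * exp (- x - y) / (x + y) * poly f x * poly g y) =
      (\<Sum>i<n. \<Sum>j<n. coeff f i * coeff g j * (y powr (b + real j) * exp (- y) * Stieltjes_moment (a + real i) y))"
    if y: "y > 0" for y
  proof -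
    have eq: "(\<lambda>x. x powr a * y powr b * exp (- x - y) / (x + y) * poly f x * poly g y) =
        (\<lambda>x. (y powr b * exp (- y) * poly g y) * ((\<Sum>i<n. coeff f i * x ^ i) * (x powr a * exp (- x) / (y + x))))"
      unfolding poly_eq_sum_lessThan[OF f, symmetric]
      by (simp add: fun_eq_iff exp_diff exp_minus divide_inverse mult_ac add_ac)
    have "(LBINT x:{0<..}. x powr a * y powr b * exp (- x - y) / (x + y) * poly f x * poly g y) =
       (y powr b * exp (- y) * poly g y) * (\<Sum>i<n. coeff f i * Stieltjes_moment (a + real i) y)"
      unfolding eq set_integral_mult_right Stieltjes_sum_integral[OF a y] ..
    also have "\<dots> = (\<Sum>i<n. \<Sum>j<n. coeff f i * coeff g j * (y powr (b + real j) * exp (- y) * Stieltjes_moment (a + real i) y))"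
      using y unfolding poly_eq_sum_lessThan[OF g]
      by (simp add: sum_distrib_left sum_distrib_right powr_add powr_realpow mult_ac) (rule sum.swap)
    finally show ?thesis .
  qed
  have "has_bochner_integral lborel (\<lambda>y. \<Sum>i<n. \<Sum>j<n. coeff f i * coeff g j *
          (indicator {0<..} y * (y powr (b + real j) * exp (- y) * Stieltjes_moment (a + real i) y)))
          (\<Sum>i<n. \<Sum>j<n. coeff f i * coeff g j * (Gamma (a + real i + 1) * Gamma (b + real j + 1) / (a + real i + (b + real j) + 1)))"
    using a b ab by (intro has_bochner_integral_sum has_bochner_integral_mult_right has_bochner_integral_Cauchy_Laguerre_moment) auto
  from has_bochner_integral_integral_eq[OF this]
  have "(LBINT y. \<Sum>i<n. \<Sum>j<n. coeff f i * coeff g j *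
          (indicator {0<..} y * (y powr (b + real j) * exp (- y) * Stieltjes_moment (a + real i) y))) =
        (\<Sum>i<n. \<Sum>j<n. coeff f i * coeff g j * Cauchy_Laguerre_moment a b i j)"
    by (simp add: Cauchy_Laguerre_moment_def add_ac)
  also have "(LBINT y. \<Sum>i<n. \<Sum>j<n. coeff f i * coeff g j *
          (indicator {0<..} y * (y powr (b + real j) * exp (- y) * Stieltjes_moment (a + real i) y))) =
       (LBINT y:{0<..}. (LBINT x:{0<..}. x powr a * y powr b * exp (- x - y) / (x + y) * poly f x * poly g y))"
    unfolding set_lebesgue_integral_def[of _ _ "\<lambda>y. LBINT x:{0<..}. x powr a * y powr b * exp (- x - y) / (x + y) * poly f x * poly g y"]
  proof (intro Bochner_Integration.integral_cong refl)
    fix y :: real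
    show "(\<Sum>i<n. \<Sum>j<n. coeff f i * coeff g j * (indicator {0<..} y * (y powr (b + real j) * exp (- y) * Stieltjes_moment (a + real i) y))) =
      indicator {0<..} y *\<^sub>R (LBINT x:{0<..}. x powr a * y powr b * exp (- x - y) / (x + y) * poly f x * poly g y)"
    proof (cases "y > 0")
      case True
      show ?thesis unfolding inner[OF True] using True by simp
    qed simp
  qed
  finally show ?thesis .
qed

lemma poly_expansion_by_degree:
  fixes p :: "nat \<Rightarrow> 'a :: field poly"
  assumes p: "\<And>j. degree (p j) = j" "\<And>j. p j \<noteq> 0"
    and f: "degree f < n"
  shows "\<exists>c. f = (\<Sum>j<n. smult (c j) (p j))"
  using f
proof (induction n arbitrary: f)
  case (Suc n)
  define d where "d = coeff f n / coeff (p n) n"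
  have pn: "coeff (p n) n \<noteq> 0" using p[of n] by (metis leading_coeff_0_iff)
  define g where "g = f - smult d (p n)"
  show ?case
  proof (cases "n = 0")
    case True
    have "degree g \<le> 0" unfolding g_def using Suc.prems p(1)[of n] True
      by (intro degree_diff_le) (auto intro: order_trans[OF degree_smult_le])
    moreover have "coeff g 0 = 0" using pn True by (simp add: g_def d_def)
    ultimately have "g = 0" by (metis leading_coeff_0_iff le_zero_eq)
    thus ?thesis using True by (intro exI[of _ "\<lambda>_. d"]) (simp add: g_def)
  next
    case False
    have "degree g \<le> n" unfolding g_def using Suc.prems p(1)[of n]
      by (intro degree_diff_le) (auto intro: order_trans[OF degree_smult_le])
    moreover have "coeff g n = 0" using pn by (simp add: g_def d_def)
    ultimately have "degree g < n" using False
      by (metis degree_0 leading_coeff_0_iff le_neq_implies_less neq0_conv)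
    from Suc.IH[OF this] obtain c where c: "g = (\<Sum>j<n. smult (c j) (p j))" by blast
    have "f = (\<Sum>j<Suc n. smult ((c(n := d)) j) (p j))"
      using c by (simp add: g_def algebra_simps)
    thus ?thesis by blast
  qed
qed simp

text \<open>
  The entries of the transposed inverse of the moment matrix: the coefficient of $x^ky^l$ in $K_{00}$.
\<close>

definition kernel_coeff :: "real \<Rightarrow> real \<Rightarrow> nat \<Rightarrow> nat \<Rightarrow> nat \<Rightarrow> real" where
  "kernel_coeff a b n k l = pf_coeff (a + b) n k * pf_coeff (a + b) n l /
     (Gamma (a + real k + 1) * Gamma (b + real l + 1) * (a + b + 1 + real k + real l))"

lemma kernel_coeff_inverse:
  assumes a: "a > -1" and b: "b > -1" and ab: "a + b > -1" and l: "l < n" and j: "j < n"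
  shows "(\<Sum>k<n. kernel_coeff a b n k l * Cauchy_Laguerre_moment a b k j) = (if l = j then 1 else 0)"
proof -
  have pos: "Gamma (a + real k + 1) > 0" "Gamma (b + real k + 1) > 0" for k
    using a b by (auto intro!: Gamma_real_pos)
  have "(\<Sum>k<n. kernel_coeff a b n k l * Cauchy_Laguerre_moment a b k j) =
    (\<Sum>k<n. Gamma (b + real j + 1) / Gamma (b + real l + 1) * (pf_coeff (a + b) n k * pf_coeff (a + b) n l / ((a + b + 1 + real k + real l) * (a + b + 1 + real k + real j))))"
  proof (intro sum.cong refl)
    fix k
    have "Gamma (a + real k + 1) \<noteq> 0" using pos(1)[of k] by simp
    thus "kernel_coeff a b n k l * Cauchy_Laguerre_moment a b k j = Gamma (b + real j + 1) / Gamma (b + real l + 1) * (pf_coeff (a + b) n k * pf_coeff (a + b) n l / ((a + b + 1 + real k + real l) * (a + b + 1 + real k + real j)))"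
      by (simp add: kernel_coeff_def Cauchy_Laguerre_moment_def add_ac mult_ac)
  qed
  also have "\<dots> = Gamma (b + real j + 1) / Gamma (b + real l + 1) * (if l = j then 1 else 0)"
    unfolding sum_distrib_left[symmetric] using ab l j by (subst sum_pf_coeff_orthogonal) auto
  also have "\<dots> = (if l = j then 1 else 0)" using pos(2)[of j] by auto
  finally show ?thesis .
qed

text \<open>
  For fixed $y$ the right-hand side is a polynomial $f$ in $x$ of degree less than $n$, so
  $f=\sum_j c_jp_j$. Pairing with $q_m$ gives $c_m$ by biorthogonality, and $q_m(y)$ because the
  coefficients of the sum invert the moment matrix.
\<close>

lemma K00_eq_kernel_sum:
  assumes a: "a > -1" and b: "b > -1" and ab: "a + b > -1"
    and pq: "cauchy_laguerre_biorthogonal a b p q"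
  shows "K00 p q n x y = (\<Sum>k<n. \<Sum>l<n. kernel_coeff a b n k l * x ^ k * y ^ l)"
proof -
  define B where "B = (\<lambda>f g. \<Sum>i<n. \<Sum>j<n. coeff f i * coeff g j * Cauchy_Laguerre_moment a b i j)"
  have deg: "degree (p j) = j" "degree (q j) = j" and "lead_coeff (p j) > 0" for j
    using pq unfolding cauchy_laguerre_biorthogonal_def by blast+
  hence nz: "p j \<noteq> 0" for j by (metis leading_coeff_0_iff less_irrefl)
  have orth: "B (p l) (q m) = (if l = m then 1 else 0)" if "l < n" "m < n" for l m
    using Cauchy_Laguerre_pairing[OF a b ab, of "p l" n "q m"] that pq
    by (simp add: B_def deg cauchy_laguerre_biorthogonal_def)
  define r where "r = (\<lambda>k. \<Sum>l<n. kernel_coeff a b n k l * y ^ l)"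
  define f where "f = (\<Sum>k<n. monom (r k) k)"
  have coeff_f: "coeff f i = r i" if "i < n" for i
    using that by (simp add: f_def coeff_sum)
  have "degree f < n \<or> n = 0"
  proof (cases "n = 0")
    case False
    have "degree f \<le> n - 1" unfolding f_def
      by (intro degree_sum_le) (auto intro: order_trans[OF degree_monom_le])
    thus ?thesis using False by simp
  qed auto
  then obtain c where c: "f = (\<Sum>j<n. smult (c j) (p j))"
    using poly_expansion_by_degree[of p f n] deg(1) nz by (auto simp: f_def)
  have cm: "c m = poly (q m) y" if m: "m < n" for m
  proof -
    have "B f (q m) = (\<Sum>i<n. \<Sum>j<n. \<Sum>l<n. c l * (coeff (p l) i * coeff (q m) j * Cauchy_Laguerre_moment a b i j))"
      by (simp add: B_def c coeff_sum sum_distrib_right mult.assoc)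
    also have "\<dots> = (\<Sum>l<n. \<Sum>i<n. \<Sum>j<n. c l * (coeff (p l) i * coeff (q m) j * Cauchy_Laguerre_moment a b i j))"
      by (subst sum.swap[of _ "{..<n}" "{..<n}"], subst (2) sum.swap) (intro sum.cong refl sum.swap)
    also have "\<dots> = (\<Sum>l<n. c l * B (p l) (q m))" by (simp add: B_def sum_distrib_left)
    also have "\<dots> = (\<Sum>l<n. if l = m then c m else 0)"
      using m by (intro sum.cong) (auto simp: orth)
    also have "\<dots> = c m" using m by simp
    finally have 1: "B f (q m) = c m" .
    have "B f (q m) = (\<Sum>k<n. \<Sum>j<n. \<Sum>l<n. y ^ l * coeff (q m) j * (kernel_coeff a b n k l * Cauchy_Laguerre_moment a b k j))"
      unfolding B_def
      by (intro sum.cong refl) (simp add: coeff_f r_def sum_distrib_left sum_distrib_right mult_ac)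
    also have "\<dots> = (\<Sum>j<n. \<Sum>l<n. \<Sum>k<n. y ^ l * coeff (q m) j * (kernel_coeff a b n k l * Cauchy_Laguerre_moment a b k j))"
      by (subst sum.swap) (intro sum.cong refl sum.swap)
    also have "\<dots> = (\<Sum>j<n. \<Sum>l<n. y ^ l * coeff (q m) j * (\<Sum>k<n. kernel_coeff a b n k l * Cauchy_Laguerre_moment a b k j))"
      by (simp add: sum_distrib_left)
    also have "\<dots> = (\<Sum>j<n. \<Sum>l<n. if l = j then y ^ j * coeff (q m) j else 0)"
      using kernel_coeff_inverse[OF a b ab] by (intro sum.cong refl) auto
    also have "\<dots> = (\<Sum>j<n. coeff (q m) j * y ^ j)"
      by (intro sum.cong refl) (simp add: mult.commute)
    also have "\<dots> = poly (q m) y" using m by (intro poly_eq_sum_lessThan[symmetric]) (simp add: deg)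
    finally show ?thesis using 1 by simp
  qed
  have "(\<Sum>k<n. \<Sum>l<n. kernel_coeff a b n k l * x ^ k * y ^ l) = poly f x"
    by (simp add: f_def r_def poly_sum poly_monom sum_distrib_left sum_distrib_right mult_ac)
  also have "\<dots> = (\<Sum>j<n. c j * poly (p j) x)" by (simp add: c poly_sum)
  also have "\<dots> = K00 p q n x y"
    unfolding K00_def by (intro sum.cong) (auto simp: cm)
  finally show ?thesis ..
qed

lemma K01_eq_kernel_sum:
  assumes ab: "a > -1" "b > -1" "a + b > -1" and y: "y > 0"
    and pq: "cauchy_laguerre_biorthogonal a b p q"
  shows "K01 b p q n x y = (\<Sum>k<n. \<Sum>l<n. kernel_coeff a b n k l * x ^ k * Stieltjes_moment (b + real l) y)"
proof -
  have "K00 p q n x v = (\<Sum>l<n. (\<Sum>k<n. kernel_coeff a b n k l * x ^ k) * v ^ l)" for v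
    unfolding K00_eq_kernel_sum[OF ab pq] by (subst sum.swap) (simp add: sum_distrib_right)
  hence "K01 b p q n x y = (\<Sum>l<n. (\<Sum>k<n. kernel_coeff a b n k l * x ^ k) * Stieltjes_moment (b + real l) y)"
    unfolding K01_def using Stieltjes_sum_integral[OF ab(2) y] by simp
  also have "\<dots> = (\<Sum>k<n. \<Sum>l<n. kernel_coeff a b n k l * x ^ k * Stieltjes_moment (b + real l) y)"
    unfolding sum_distrib_right by (rule sum.swap)
  finally show ?thesis .
qed

lemma K10_eq_kernel_sum:
  assumes ab: "a > -1" "b > -1" "a + b > -1" and x: "x > 0"
    and pq: "cauchy_laguerre_biorthogonal a b p q"
  shows "K10 a p q n x y = (\<Sum>k<n. \<Sum>l<n. kernel_coeff a b n k l * Stieltjes_moment (a + real k) x * y ^ l)"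
proof -
  have "K00 p q n v y = (\<Sum>k<n. (\<Sum>l<n. kernel_coeff a b n k l * y ^ l) * v ^ k)" for v
    unfolding K00_eq_kernel_sum[OF ab pq] by (simp add: sum_distrib_left sum_distrib_right mult_ac)
  hence "K10 a p q n x y = (\<Sum>k<n. (\<Sum>l<n. kernel_coeff a b n k l * y ^ l) * Stieltjes_moment (a + real k) x)"
    unfolding K10_def using Stieltjes_sum_integral[OF ab(1) x] by simp
  thus ?thesis by (simp add: sum_distrib_left sum_distrib_right mult_ac)
qed

lemma K11_eq_kernel_sum:
  assumes ab: "a > -1" "b > -1" "a + b > -1" and x: "x > 0" and y: "y > 0"
    and pq: "cauchy_laguerre_biorthogonal a b p q"
  shows "K11 a b p q n x y = (\<Sum>k<n. \<Sum>l<n. kernel_coeff a b n k l *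
           Stieltjes_moment (a + real k) x * Stieltjes_moment (b + real l) y) - 1 / (x + y)"
proof -
  have "(LBINT x':{0<..}. K00 p q n x' v * (x' powr a * exp (- x') / (x + x')) * (v powr b * exp (- v) / (y + v))) =
      (\<Sum>l<n. (\<Sum>k<n. kernel_coeff a b n k l * Stieltjes_moment (a + real k) x) * v ^ l) * (v powr b * exp (- v) / (y + v))" for v
  proof -
    have "(LBINT x':{0<..}. K00 p q n x' v * (x' powr a * exp (- x') / (x + x')) * (v powr b * exp (- v) / (y + v))) =
        K10 a p q n x v * (v powr b * exp (- v) / (y + v))"
      unfolding K10_def by (rule set_integral_mult_left)
    also have "K10 a p q n x v = (\<Sum>l<n. (\<Sum>k<n. kernel_coeff a b n k l * Stieltjes_moment (a + real k) x) * v ^ l)"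
      unfolding K10_eq_kernel_sum[OF ab x pq] by (subst sum.swap) (simp add: sum_distrib_right)
    finally show ?thesis .
  qed
  hence "K11 a b p q n x y = (\<Sum>l<n. (\<Sum>k<n. kernel_coeff a b n k l * Stieltjes_moment (a + real k) x) * Stieltjes_moment (b + real l) y) - 1 / (x + y)"
    unfolding K11_def using Stieltjes_sum_integral[OF ab(2) y] by simp
  also have "(\<Sum>l<n. (\<Sum>k<n. kernel_coeff a b n k l * Stieltjes_moment (a + real k) x) * Stieltjes_moment (b + real l) y) =
      (\<Sum>k<n. \<Sum>l<n. kernel_coeff a b n k l * Stieltjes_moment (a + real k) x * Stieltjes_moment (b + real l) y)"
    unfolding sum_distrib_right by (rule sum.swap)
  finally show ?thesis .
qed


section \<open>Behaviour at the origin\<close>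

text \<open>
  A bound of order $t^{-\mu}$ as $t\to 0$, stated on all of $(0,1]$ so that it also decides
  integrability on the unit interval.
\<close>

definition power_bounded :: "real \<Rightarrow> (real \<Rightarrow> real) \<Rightarrow> bool" where
  "power_bounded \<mu> g \<longleftrightarrow> (\<exists>C\<ge>0. \<forall>t\<in>{0<..1}. \<bar>g t\<bar> \<le> C * t powr (- \<mu>))"

lemma power_boundedI:
  assumes "\<And>t. 0 < t \<Longrightarrow> t \<le> 1 \<Longrightarrow> \<bar>g t\<bar> \<le> C * t powr (- \<mu>)"
  shows "power_bounded \<mu> g"
  unfolding power_bounded_def using assms[of 1] assms by (intro exI[of _ C]) auto

lemma power_boundedD:
  "power_bounded \<mu> g \<Longrightarrow> \<exists>C\<ge>0. \<forall>t. 0 < t \<and> t \<le> 1 \<longrightarrow> \<bar>g t\<bar> \<le> C * t powr (- \<mu>)"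
  unfolding power_bounded_def by auto

lemma power_bounded_add:
  assumes "power_bounded \<mu> g" "power_bounded \<mu> g'"
  shows "power_bounded \<mu> (\<lambda>t. g t + g' t)"
proof -
  obtain C C' where C: "\<And>t. 0 < t \<Longrightarrow> t \<le> 1 \<Longrightarrow> \<bar>g t\<bar> \<le> C * t powr (- \<mu>)"
    "\<And>t. 0 < t \<Longrightarrow> t \<le> 1 \<Longrightarrow> \<bar>g' t\<bar> \<le> C' * t powr (- \<mu>)"
    using power_boundedD[OF assms(1)] power_boundedD[OF assms(2)] by blast
  show ?thesis
  proof (rule power_boundedI)
    fix t :: real assume t: "0 < t" "t \<le> 1"
    show "\<bar>g t + g' t\<bar> \<le> (C + C') * t powr (- \<mu>)" using C[OF t] by (simp add: distrib_right)
  qed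
qed

lemma power_bounded_mult:
  assumes "power_bounded \<mu> g" "power_bounded \<nu> g'"
  shows "power_bounded (\<mu> + \<nu>) (\<lambda>t. g t * g' t)"
proof -
  obtain C where C: "C \<ge> 0" "\<And>t. 0 < t \<Longrightarrow> t \<le> 1 \<Longrightarrow> \<bar>g t\<bar> \<le> C * t powr (- \<mu>)"
    using power_boundedD[OF assms(1)] by blast
  obtain C' where C': "C' \<ge> 0" "\<And>t. 0 < t \<Longrightarrow> t \<le> 1 \<Longrightarrow> \<bar>g' t\<bar> \<le> C' * t powr (- \<nu>)"
    using power_boundedD[OF assms(2)] by blast
  show ?thesis
  proof (rule power_boundedI)
    fix t :: real assume t: "0 < t" "t \<le> 1"
    have "\<bar>g t * g' t\<bar> \<le> (C * t powr (- \<mu>)) * (C' * t powr (- \<nu>))"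
      unfolding abs_mult using C C' t by (intro mult_mono) auto
    also have "\<dots> = (C * C') * (t powr (- \<mu>) * t powr (- \<nu>))" by simp
    also have "t powr (- \<mu>) * t powr (- \<nu>) = t powr (- (\<mu> + \<nu>))" by (simp flip: powr_add)
    finally show "\<bar>g t * g' t\<bar> \<le> (C * C') * t powr (- (\<mu> + \<nu>))" .
  qed
qed

lemma power_bounded_cmult:
  assumes "power_bounded \<mu> g"
  shows "power_bounded \<mu> (\<lambda>t. c * g t)"
proof -
  have "power_bounded 0 (\<lambda>_. c)" by (rule power_boundedI[of _ "\<bar>c\<bar>"]) auto
  from power_bounded_mult[OF this assms] show ?thesis by simp
qed

lemma power_bounded_sum:
  fixes m :: nat
  assumes "\<And>k. power_bounded \<mu> (g k)"
  shows "power_bounded \<mu> (\<lambda>t. \<Sum>k<m. g k t)"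
proof (induction m)
  case 0 show ?case by (rule power_boundedI[of _ 0]) auto
qed (simp add: power_bounded_add assms)

lemma powr_mult_power_bounded:
  assumes "power_bounded \<mu> g"
  obtains C where "C \<ge> 0" "\<And>t. 0 < t \<Longrightarrow> t \<le> 1 \<Longrightarrow> \<bar>t powr \<beta> * g t\<bar> \<le> C * t powr (\<beta> - \<mu>)"
proof -
  obtain C where C: "C \<ge> 0" "\<And>t. 0 < t \<Longrightarrow> t \<le> 1 \<Longrightarrow> \<bar>g t\<bar> \<le> C * t powr (- \<mu>)"
    using power_boundedD[OF assms] by blast
  have "\<bar>t powr \<beta> * g t\<bar> \<le> C * t powr (\<beta> - \<mu>)" if t: "0 < t" "t \<le> 1" for t
  proof -
    have "\<bar>t powr \<beta> * g t\<bar> \<le> t powr \<beta> * (C * t powr (- \<mu>))"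
      unfolding abs_mult using C(2)[OF t] by (intro mult_mono) auto
    also have "\<dots> = C * (t powr \<beta> * t powr (- \<mu>))" by simp
    also have "t powr \<beta> * t powr (- \<mu>) = t powr (\<beta> - \<mu>)" by (simp flip: powr_add)
    finally show ?thesis .
  qed
  with C(1) that show thesis by blast
qed

lemma set_integrable_powr_mult:
  assumes g: "power_bounded \<mu> g" "continuous_on {0<..} g" and \<mu>: "\<mu> < \<alpha> + 1"
  shows "set_integrable lborel {0<..<1} (\<lambda>t. t powr \<alpha> * g t)"
proof -
  obtain C where C: "\<And>t. 0 < t \<Longrightarrow> t \<le> 1 \<Longrightarrow> \<bar>t powr \<alpha> * g t\<bar> \<le> C * t powr (\<alpha> - \<mu>)"
    using powr_mult_power_bounded[OF g(1)] by blast
  have "(\<lambda>t. t powr (\<alpha> - \<mu>)) absolutely_integrable_on {0..1}"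
    using has_integral_powr_from_0[of "\<alpha> - \<mu>" 1] \<mu> by (intro nonnegative_absolutely_integrable_1) auto
  hence "(\<lambda>t. t powr (\<alpha> - \<mu>)) absolutely_integrable_on {0<..<1}"
    by (rule set_integrable_subset) auto
  hence "set_integrable lborel {0<..<1} (\<lambda>t. t powr (\<alpha> - \<mu>))"
    unfolding set_integrable_def by (subst (asm) integrable_completion) auto
  hence "set_integrable lborel {0<..<1} (\<lambda>t. C * t powr (\<alpha> - \<mu>))" by simp
  thus ?thesis
  proof (rule set_integrable_bound)
    have "continuous_on {0<..<1} (\<lambda>t. t powr \<alpha> * g t)"
      by (intro continuous_intros continuous_on_subset[OF g(2)]) auto
    from borel_measurable_continuous_on_indicator[OF _ this]
    show "set_borel_measurable lborel {0<..<1} (\<lambda>t. t powr \<alpha> * g t)" by (simp add: set_borel_measurable_def)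
    have "norm (t powr \<alpha> * g t) \<le> norm (C * t powr (\<alpha> - \<mu>))" if "t \<in> {0<..<1}" for t
      using C[of t] that by (auto intro: order_trans)
    thus "AE t in lborel. t \<in> {0<..<1} \<longrightarrow> norm (t powr \<alpha> * g t) \<le> norm (C * t powr (\<alpha> - \<mu>))" by auto
  qed
qed

lemma tendsto_powr_mult_0:
  assumes g: "power_bounded \<mu> g" and \<mu>: "\<mu> < \<beta>"
  shows "((\<lambda>t. t powr \<beta> * g t) \<longlongrightarrow> 0) (at_right 0)"
proof -
  obtain C where C: "\<And>t. 0 < t \<Longrightarrow> t \<le> 1 \<Longrightarrow> \<bar>t powr \<beta> * g t\<bar> \<le> C * t powr (\<beta> - \<mu>)"
    using powr_mult_power_bounded[OF g] by blast
  have ev: "\<forall>\<^sub>F t in at_right 0. norm (t powr \<beta> * g t) \<le> C * t powr (\<beta> - \<mu>)"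
    using eventually_at_right_real[of 0 1, OF zero_less_one] by eventually_elim (use C in auto)
  have "((\<lambda>t::real. t powr (\<beta> - \<mu>)) \<longlongrightarrow> 0 powr (\<beta> - \<mu>)) (at_right 0)"
    using \<mu> by (intro tendsto_powr') (auto simp: eventually_at_right_less less_imp_le intro: eventually_mono[OF eventually_at_right_less])
  hence "((\<lambda>t. C * t powr (\<beta> - \<mu>)) \<longlongrightarrow> 0) (at_right 0)"
    using tendsto_mult_left[of _ 0 "at_right 0" C] by simp
  from Lim_null_comparison[OF ev this] show ?thesis .
qed


section \<open>Products of modes integrated over the unit interval\<close>

text \<open>
  What the two families $(tx)^k/\Gamma(c+1+k)$ and $(tx)^k\,\Gamma(-c-k,tx)$ have in common. The
  defect $p$ in the differential equation $t f_k' = k f_k - p$ does not depend on $k$.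
\<close>

definition kernel_mode :: "real \<Rightarrow> (nat \<Rightarrow> real \<Rightarrow> real) \<Rightarrow> (real \<Rightarrow> real) \<Rightarrow> bool" where
  "kernel_mode \<mu> f p \<longleftrightarrow>
     (\<forall>k. \<forall>t>0. (f k has_real_derivative (real k * f k t - p t) / t) (at t)) \<and>
     continuous_on {0<..} p \<and> (\<forall>k. power_bounded \<mu> (f k)) \<and> power_bounded \<mu> p"

lemma kernel_mode_G:
  assumes x: "x > 0" and \<mu>: "\<mu> > 0"
  shows "kernel_mode \<mu> (\<lambda>k t. G_mode c k (t * x)) (\<lambda>_. 0)"
  unfolding kernel_mode_def G_mode_def
proof (intro conjI allI impI)
  fix k and t :: real assume t: "t > 0"
  have "((\<lambda>t. (t * x) ^ k * rGamma (c + 1 + real k)) has_real_derivative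
          real k * (t * x) ^ (k - 1) * x * rGamma (c + 1 + real k)) (at t)"
    by (auto intro!: derivative_eq_intros simp: mult_ac)
  also have "real k * (t * x) ^ (k - 1) * x * rGamma (c + 1 + real k) =
      (real k * ((t * x) ^ k * rGamma (c + 1 + real k)) - 0) / t"
    using t by (cases k) (auto simp: field_simps)
  finally show "((\<lambda>t. (t * x) ^ k * rGamma (c + 1 + real k)) has_real_derivative \<dots>) (at t)" .
next
  fix k :: nat
  show "power_bounded \<mu> (\<lambda>t. (t * x) ^ k * rGamma (c + 1 + real k))"
  proof (rule power_boundedI)
    fix t :: real assume t: "0 < t" "t \<le> 1"
    have "t ^ k \<le> 1" using t by (auto intro!: power_le_one)
    also have "1 \<le> t powr (- \<mu>)"
      using t \<mu> powr_mono2'[of "- \<mu>" t 1] by auto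
    finally have "t ^ k * (x ^ k * \<bar>rGamma (c + 1 + real k)\<bar>) \<le> t powr (- \<mu>) * (x ^ k * \<bar>rGamma (c + 1 + real k)\<bar>)"
      using x by (intro mult_right_mono) auto
    thus "\<bar>(t * x) ^ k * rGamma (c + 1 + real k)\<bar> \<le> x ^ k * \<bar>rGamma (c + 1 + real k)\<bar> * t powr (- \<mu>)"
      using t x by (simp add: abs_mult power_mult_distrib mult_ac)
  qed
qed (auto intro!: power_boundedI[of _ 0])

text \<open>
  The recurrence is that of the incomplete Gamma function. For the bound, note that
  $\Gamma(s,z)=O(z^{-r})$ for every $r>0$ with $r\ge -s$; for $c>0$ this includes the true order
  $z^{-c}$, and for $c\le 0$ it loses an arbitrarily small power, which covers the logarithm at
  $c=0$.
\<close>

lemma kernel_mode_Gt: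
  assumes x: "x > 0" and \<mu>: "\<mu> > 0" "c \<le> \<mu>"
  shows "kernel_mode \<mu> (\<lambda>k t. Gt_mode c k (t * x)) (\<lambda>t. (t * x) powr (- c) * exp (- (t * x)))"
  unfolding kernel_mode_def Gt_mode_def
proof (intro conjI allI impI)
  fix k and t :: real assume t: "t > 0"
  define z where "z = t * x"
  have z: "z > 0" using t x by (simp add: z_def)
  have U: "((\<lambda>t. upper_Gamma (- c - real k) (t * x)) has_real_derivative - (z powr (- c - real k - 1) * exp (- z)) * x) (at t)"
  proof (rule DERIV_chain2[where g = "\<lambda>t. t * x" and x = t])
    show "(upper_Gamma (- c - real k) has_real_derivative - (z powr (- c - real k - 1) * exp (- z))) (at (t * x))"
      using DERIV_upper_Gamma[OF z] by (simp add: z_def)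
  qed (auto intro!: derivative_eq_intros)
  have "((\<lambda>t. (t * x) ^ k) has_real_derivative real k * z ^ (k - 1) * x) (at t)"
    by (auto intro!: derivative_eq_intros simp: mult_ac z_def)
  from DERIV_mult[OF this U]
  have "((\<lambda>t. (t * x) ^ k * upper_Gamma (- c - real k) (t * x)) has_real_derivative
      real k * z ^ (k - 1) * x * upper_Gamma (- c - real k) z - (z powr (- c - real k - 1) * exp (- z)) * x * z ^ k) (at t)"
    by (simp add: z_def)
  also have "real k * z ^ (k - 1) * x * upper_Gamma (- c - real k) z - (z powr (- c - real k - 1) * exp (- z)) * x * z ^ k =
     (real k * (z ^ k * upper_Gamma (- c - real k) z) - z powr (- c) * exp (- z)) / t"
  proof -
    have "z powr (- c) = z powr (- c - real k - 1) * z ^ k * z"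
    proof -
      have "z powr (- c) = z powr (- c - real k - 1) * z powr real k * z powr 1"
        by (simp only: powr_add[symmetric]) simp
      thus ?thesis using z by (simp add: powr_realpow)
    qed
    note zc = this
    have kz: "real k * z ^ (k - 1) * z = real k * z ^ k" by (cases k) auto
    have "t * (r * P * x * U - E * e * x * Q) = r * P * (t * x) * U - E * Q * (t * x) * e"
      for r P U E e Q :: real by (simp add: algebra_simps)
    hence "t * (real k * z ^ (k - 1) * x * upper_Gamma (- c - real k) z - (z powr (- c - real k - 1) * exp (- z)) * x * z ^ k) =
      real k * z ^ (k - 1) * (t * x) * upper_Gamma (- c - real k) z - z powr (- c - real k - 1) * z ^ k * (t * x) * exp (- z)" .
    also have "\<dots> = real k * z ^ k * upper_Gamma (- c - real k) z - z powr (- c) * exp (- z)"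
      unfolding z_def[symmetric] kz zc[symmetric] ..
    finally have "t * (real k * z ^ (k - 1) * x * upper_Gamma (- c - real k) z - (z powr (- c - real k - 1) * exp (- z)) * x * z ^ k) =
      real k * (z ^ k * upper_Gamma (- c - real k) z) - z powr (- c) * exp (- z)" by (simp only: mult.assoc)
    thus ?thesis using t by (simp add: field_simps)
  qed
  finally show "((\<lambda>t. (t * x) ^ k * upper_Gamma (- c - real k) (t * x)) has_real_derivative
      (real k * ((t * x) ^ k * upper_Gamma (- c - real k) (t * x)) - (t * x) powr (- c) * exp (- (t * x))) / t) (at t)"
    by (simp add: z_def)
next
  show "continuous_on {0<..} (\<lambda>t. (t * x) powr (- c) * exp (- (t * x)))"
    using x by (intro continuous_intros) auto
next
  fix k :: nat
  have "\<exists>C\<ge>0. \<forall>z>0. \<bar>upper_Gamma (- c - real k) z\<bar> \<le> C * z powr (- (\<mu> + real k))"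
    using \<mu> by (intro upper_Gamma_bound) auto
  then obtain C where C: "C \<ge> 0" "\<And>z. z > 0 \<Longrightarrow> \<bar>upper_Gamma (- c - real k) z\<bar> \<le> C * z powr (- (\<mu> + real k))" by blast
  show "power_bounded \<mu> (\<lambda>t. (t * x) ^ k * upper_Gamma (- c - real k) (t * x))"
  proof (rule power_boundedI)
    fix t :: real assume t: "0 < t" "t \<le> 1"
    hence z: "t * x > 0" using x by simp
    have "\<bar>(t * x) ^ k * upper_Gamma (- c - real k) (t * x)\<bar> \<le> (t * x) ^ k * (C * (t * x) powr (- (\<mu> + real k)))"
      unfolding abs_mult using C(2)[OF z] z by (intro mult_mono) auto
    also have "\<dots> = C * ((t * x) powr real k * (t * x) powr (- (\<mu> + real k)))"
      using z by (simp add: powr_realpow)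
    also have "(t * x) powr real k * (t * x) powr (- (\<mu> + real k)) = (t * x) powr (- \<mu>)"
      by (simp flip: powr_add)
    also have "(t * x) powr (- \<mu>) = t powr (- \<mu>) * x powr (- \<mu>)" by (rule powr_mult)
    finally show "\<bar>(t * x) ^ k * upper_Gamma (- c - real k) (t * x)\<bar> \<le> C * x powr (- \<mu>) * t powr (- \<mu>)"
      by (simp add: mult_ac)
  qed
next
  show "power_bounded \<mu> (\<lambda>t. (t * x) powr (- c) * exp (- (t * x)))"
  proof (rule power_boundedI)
    fix t :: real assume t: "0 < t" "t \<le> 1"
    have "t powr (- c) \<le> t powr (- \<mu>)" using t \<mu> by (intro powr_mono') auto
    moreover have "exp (- (t * x)) \<le> 1" using t x by simp
    ultimately have "(x powr (- c) * t powr (- c)) * exp (- (t * x)) \<le> (x powr (- c) * t powr (- \<mu>)) * 1"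
      by (intro mult_mono mult_left_mono) auto
    moreover have "(t * x) powr (- c) = x powr (- c) * t powr (- c)"
      using t x powr_mult[of t x "- c"] by simp
    ultimately show "\<bar>(t * x) powr (- c) * exp (- (t * x))\<bar> \<le> x powr (- c) * t powr (- \<mu>)" by simp
  qed
qed

text \<open>
  The first term has lost its denominator and factorises. In each of the other two, one of the sums
  is that of \<open>sum_pf_coeff\<close>, with value $-(-1)^n$. The three terms complete to the product on the
  right, except for $pq$.
\<close>

lemma pf_coeff_bilinear_identity:
  fixes f h :: "nat \<Rightarrow> real" and p q \<alpha> :: real and n :: nat
  assumes \<alpha>: "\<alpha> > -1"
  defines "A \<equiv> pf_coeff \<alpha> n" and "e \<equiv> (- 1) ^ n"
  shows "(\<Sum>k<n. \<Sum>l<n. A k * A l / (\<alpha> + 1 + real k + real l) *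
           ((\<alpha> + 1 + real k + real l) * (f k * h l) - p * h l - q * f k)) =
         ((\<Sum>k<n. A k * f k) + e * p) * ((\<Sum>l<n. A l * h l) + e * q) - p * q"
proof -
  have nz: "\<alpha> + 1 + real k + real l \<noteq> 0" for k l using \<alpha> by linarith
  have ee: "e * e = 1" by (simp add: e_def flip: power_mult_distrib)
  define X Y where "X = (\<Sum>k<n. A k * f k)" and "Y = (\<Sum>l<n. A l * h l)"
  have "(\<Sum>k<n. \<Sum>l<n. A k * A l / (\<alpha> + 1 + real k + real l) *
      ((\<alpha> + 1 + real k + real l) * (f k * h l) - p * h l - q * f k)) =
    (\<Sum>k<n. \<Sum>l<n. (A k * f k) * (A l * h l))
    - (\<Sum>k<n. \<Sum>l<n. (p * (A l * h l)) * (A k / (\<alpha> + 1 + real k + real l)))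
    - (\<Sum>k<n. \<Sum>l<n. (q * (A k * f k)) * (A l / (\<alpha> + 1 + real l + real k)))"
    unfolding sum_subtractf[symmetric]
    by (intro sum.cong refl) (use nz in \<open>simp add: right_diff_distrib add_ac mult_ac\<close>)
  also have "(\<Sum>k<n. \<Sum>l<n. (A k * f k) * (A l * h l)) = X * Y"
    by (simp add: X_def Y_def sum_product)
  also have "(\<Sum>k<n. \<Sum>l<n. (p * (A l * h l)) * (A k / (\<alpha> + 1 + real k + real l))) =
      (\<Sum>l<n. (p * (A l * h l)) * (\<Sum>k<n. A k / (\<alpha> + 1 + real k + real l)))"
    by (subst sum.swap) (simp add: sum_distrib_left)
  also have "\<dots> = (\<Sum>l<n. (p * (A l * h l)) * (- e))"
    unfolding A_def e_def by (intro sum.cong refl arg_cong2[where f = "(*)"] sum_pf_coeff \<alpha>) auto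
  also have "\<dots> = - e * p * Y" by (simp add: Y_def sum_distrib_left mult_ac)
  also have "(\<Sum>k<n. \<Sum>l<n. (q * (A k * f k)) * (A l / (\<alpha> + 1 + real l + real k))) =
      (\<Sum>k<n. (q * (A k * f k)) * (\<Sum>l<n. A l / (\<alpha> + 1 + real l + real k)))"
    by (simp add: sum_distrib_left)
  also have "\<dots> = (\<Sum>k<n. (q * (A k * f k)) * (- e))"
    unfolding A_def e_def by (intro sum.cong refl arg_cong2[where f = "(*)"] sum_pf_coeff \<alpha>) auto
  also have "\<dots> = - e * q * X" by (simp add: X_def sum_distrib_left mult_ac)
  also have "X * Y - - e * p * Y - - e * q * X = (X + e * p) * (Y + e * q) - (e * e) * (p * q)"
    by (simp add: algebra_simps)
  finally show ?thesis by (simp add: ee X_def Y_def)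
qed

text \<open>
  The integrand on the left minus that on the right is the derivative of $t^{\alpha+1}\Phi(t)$ by the
  preceding identity. The hypothesis on $\mu+\nu$ makes both integrals converge and the boundary term
  at 0 vanish.
\<close>

lemma integral_product_of_mode_sums:
  fixes f h :: "nat \<Rightarrow> real \<Rightarrow> real" and p q :: "real \<Rightarrow> real" and n :: nat
  assumes \<alpha>: "\<alpha> > -1"
    and fp: "kernel_mode \<mu> f p" and hq: "kernel_mode \<nu> h q"
    and \<mu>\<nu>: "\<mu> + \<nu> < \<alpha> + 1"
  defines "F \<equiv> \<lambda>t. (\<Sum>k<n. pf_coeff \<alpha> n k * f k t) + (- 1) ^ n * p t"
    and "H \<equiv> \<lambda>t. (\<Sum>k<n. pf_coeff \<alpha> n k * h k t) + (- 1) ^ n * q t"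
  shows "(LBINT t:{0..1}. t powr \<alpha> * (F t * H t)) =
     (\<Sum>k<n. \<Sum>l<n. pf_coeff \<alpha> n k * pf_coeff \<alpha> n l / (\<alpha> + 1 + real k + real l) * (f k 1 * h l 1)) +
     (LBINT t:{0..1}. t powr \<alpha> * (p t * q t))"
proof -
  have f: "\<And>k t. t > 0 \<Longrightarrow> (f k has_real_derivative (real k * f k t - p t) / t) (at t)"
    and h: "\<And>k t. t > 0 \<Longrightarrow> (h k has_real_derivative (real k * h k t - q t) / t) (at t)"
    and pq: "continuous_on {0<..} p" "continuous_on {0<..} q"
    and bounds: "\<And>k. power_bounded \<mu> (f k)" "power_bounded \<mu> p" "\<And>k. power_bounded \<nu> (h k)" "power_bounded \<nu> q"
    using fp hq unfolding kernel_mode_def by simp_all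
  define A where "A = pf_coeff \<alpha> n"
  have ein: "einterval 0 1 = {0<..<1::real}" by (auto simp: einterval_def)
  have cont_f: "continuous_on {0<..} (f k)" for k
    by (intro continuous_at_imp_continuous_on ballI DERIV_isCont[OF f]) simp
  have cont_h: "continuous_on {0<..} (h k)" for k
    by (intro continuous_at_imp_continuous_on ballI DERIV_isCont[OF h]) simp
  have cF: "continuous_on {0<..} F" and cH: "continuous_on {0<..} H"
    unfolding F_def H_def by (intro continuous_intros cont_f cont_h pq)+
  have bF: "power_bounded \<mu> F" and bH: "power_bounded \<nu> H"
    unfolding F_def H_def by (intro power_bounded_add power_bounded_cmult power_bounded_sum bounds)+
  define w where "w = (\<lambda>k l. A k * A l / (\<alpha> + 1 + real k + real l))"
  define \<Phi> where "\<Phi> = (\<lambda>t. \<Sum>k<n. \<Sum>l<n. w k l * (f k t * h l t))"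
  have bPhi: "power_bounded (\<mu> + \<nu>) \<Phi>"
    unfolding \<Phi>_def by (intro power_bounded_sum power_bounded_cmult power_bounded_mult bounds)
  have iFH: "set_integrable lborel {0<..<1} (\<lambda>t. t powr \<alpha> * (F t * H t))"
    by (intro set_integrable_powr_mult[OF _ _ \<mu>\<nu>] power_bounded_mult bF bH continuous_intros cF cH)
  have ipq: "set_integrable lborel {0<..<1} (\<lambda>t. t powr \<alpha> * (p t * q t))"
    by (intro set_integrable_powr_mult[OF _ _ \<mu>\<nu>] power_bounded_mult bounds continuous_intros pq)
  have alg: "(\<Sum>k<n. \<Sum>l<n. w k l *
        ((\<alpha> + 1 + real k + real l) * (f k t * h l t) - p t * h l t - q t * f k t)) = F t * H t - p t * q t" for t
    unfolding w_def A_def F_def H_def by (rule pf_coeff_bilinear_identity[OF \<alpha>])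
  have D: "((\<lambda>t. t powr (\<alpha> + 1) * \<Phi> t) has_real_derivative (t powr \<alpha> * (F t * H t) - t powr \<alpha> * (p t * q t))) (at t)"
    if t: "t > 0" for t
  proof -
    have "((\<lambda>t. t powr (\<alpha> + 1) * \<Phi> t) has_real_derivative
       ((\<alpha> + 1) * t powr \<alpha> * \<Phi> t + t powr (\<alpha> + 1) * (\<Sum>k<n. \<Sum>l<n. w k l *
         ((real k * f k t - p t) / t * h l t + f k t * ((real l * h l t - q t) / t))))) (at t)"
    proof -
      have 1: "((\<lambda>t. t powr (\<alpha> + 1)) has_real_derivative ((\<alpha> + 1) * t powr \<alpha>)) (at t)"
        using t by (auto intro!: derivative_eq_intros)
      have 2: "(\<Phi> has_real_derivative (\<Sum>k<n. \<Sum>l<n. w k l *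
         ((real k * f k t - p t) / t * h l t + f k t * ((real l * h l t - q t) / t)))) (at t)"
        unfolding \<Phi>_def
        by (intro DERIV_sum DERIV_cmult DERIV_cong[OF DERIV_mult[OF f[OF t] h[OF t]]]) (simp add: mult_ac)
      show ?thesis using DERIV_mult[OF 1 2] by (simp add: mult_ac add_ac)
    qed
    also have "t powr (\<alpha> + 1) = t powr \<alpha> * t" using t by (simp add: powr_add)
    also have "(\<alpha> + 1) * t powr \<alpha> * \<Phi> t + t powr \<alpha> * t * (\<Sum>k<n. \<Sum>l<n. w k l *
         ((real k * f k t - p t) / t * h l t + f k t * ((real l * h l t - q t) / t))) =
       t powr \<alpha> * (\<Sum>k<n. \<Sum>l<n. w k l *
        ((\<alpha> + 1 + real k + real l) * (f k t * h l t) - p t * h l t - q t * f k t))"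
    proof -
      have "(\<alpha> + 1) * \<Phi> t + t * (\<Sum>k<n. \<Sum>l<n. w k l *
         ((real k * f k t - p t) / t * h l t + f k t * ((real l * h l t - q t) / t))) =
       (\<Sum>k<n. \<Sum>l<n. w k l *
        ((\<alpha> + 1 + real k + real l) * (f k t * h l t) - p t * h l t - q t * f k t))"
        unfolding \<Phi>_def sum_distrib_left sum.distrib[symmetric]
      proof (intro sum.cong refl)
        fix k l
        have "t * (w k l * ((real k * f k t - p t) / t * h l t + f k t * ((real l * h l t - q t) / t))) =
            w k l * ((real k * f k t - p t) * h l t + f k t * (real l * h l t - q t))"
          using t by (simp add: field_simps)
        thus "(\<alpha> + 1) * (w k l * (f k t * h l t)) +
           t * (w k l * ((real k * f k t - p t) / t * h l t + f k t * ((real l * h l t - q t) / t))) =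
           w k l * ((\<alpha> + 1 + real k + real l) * (f k t * h l t) - p t * h l t - q t * f k t)"
          by (simp add: algebra_simps)
      qed
      moreover have "(\<alpha> + 1) * u * v + u * t * w = u * ((\<alpha> + 1) * v + t * w)" for u v w :: real
        by (simp add: algebra_simps)
      ultimately show ?thesis by (simp only:)
    qed
    also have "\<dots> = t powr \<alpha> * (F t * H t) - t powr \<alpha> * (p t * q t)" unfolding alg by (simp add: right_diff_distrib)
    finally show ?thesis .
  qed
  have "(LBINT t=0..1. t powr \<alpha> * (F t * H t) - t powr \<alpha> * (p t * q t)) = \<Phi> 1 - 0"
  proof (rule interval_integral_FTC_integrable[where F = "\<lambda>t. t powr (\<alpha> + 1) * \<Phi> t"])
    fix t :: real assume "0 < ereal t" "ereal t < 1"
    hence t: "t > 0" by simp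
    show "((\<lambda>t. t powr (\<alpha> + 1) * \<Phi> t) has_vector_derivative (t powr \<alpha> * (F t * H t) - t powr \<alpha> * (p t * q t))) (at t)"
      using D[OF t] by (simp add: has_real_derivative_iff_has_vector_derivative)
    have "continuous_on {0<..} (\<lambda>t. t powr \<alpha> * (F t * H t) - t powr \<alpha> * (p t * q t))"
      by (intro continuous_intros cF cH pq) auto
    thus "isCont (\<lambda>t. t powr \<alpha> * (F t * H t) - t powr \<alpha> * (p t * q t)) t"
      using t by (simp add: continuous_on_eq_continuous_at)
  next
    show "set_integrable lborel (einterval 0 1) (\<lambda>t. t powr \<alpha> * (F t * H t) - t powr \<alpha> * (p t * q t))"
      unfolding ein using iFH ipq by (rule set_integral_diff(1))
    show "(((\<lambda>t. t powr (\<alpha> + 1) * \<Phi> t) \<circ> real_of_ereal) \<longlongrightarrow> 0) (at_right 0)"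
      using tendsto_powr_mult_0[OF bPhi \<mu>\<nu>] by (simp add: zero_ereal_def ereal_tendsto_simps)
    have "isCont (\<lambda>t. t powr (\<alpha> + 1) * \<Phi> t) 1" using DERIV_isCont[OF D[of 1]] by simp
    hence "((\<lambda>t. t powr (\<alpha> + 1) * \<Phi> t) \<longlongrightarrow> 1 powr (\<alpha> + 1) * \<Phi> 1) (at 1)" by (rule isContD)
    hence "((\<lambda>t. t powr (\<alpha> + 1) * \<Phi> t) \<longlongrightarrow> \<Phi> 1) (at_left 1)"
      using tendsto_within_subset[OF _ subset_UNIV] by fastforce
    thus "(((\<lambda>t. t powr (\<alpha> + 1) * \<Phi> t) \<circ> real_of_ereal) \<longlongrightarrow> \<Phi> 1) (at_left 1)"
      by (simp add: one_ereal_def ereal_tendsto_simps)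
  qed simp
  hence "(LBINT t:{0<..<1}. t powr \<alpha> * (F t * H t) - t powr \<alpha> * (p t * q t)) = \<Phi> 1"
    by (simp add: interval_lebesgue_integral_def ein)
  hence "(LBINT t:{0<..<1}. t powr \<alpha> * (F t * H t)) = \<Phi> 1 + (LBINT t:{0<..<1}. t powr \<alpha> * (p t * q t))"
    using set_integral_diff(2)[OF iFH ipq] by simp
  moreover have "(LBINT t:{0..1}. g t) = (LBINT t:{0<..<1}. g t)" for g :: "real \<Rightarrow> real"
    by (rule set_integral_discrete_difference[where X = "{0, 1}"]) auto
  ultimately show ?thesis unfolding \<Phi>_def w_def A_def by simp
qed


section \<open>The integral representations\<close>

text \<open>
  Admissible exponents for \<open>kernel_mode_Gt\<close> at $a$ and $b$ that still leave room below
  $\alpha+1$: the exponents $a$ and $b$ themselves, raised to a small $\varepsilon>0$ where they lie below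
  it.
\<close>

lemma boundary_exponents:
  fixes a b :: real
  assumes "a > -1" "b > -1" "a + b > -1"
  shows "\<exists>\<mu> \<nu>. \<mu> > 0 \<and> a \<le> \<mu> \<and> \<nu> > 0 \<and> b \<le> \<nu> \<and> \<mu> + \<nu> < a + b + 1"
proof -
  define \<epsilon> where "\<epsilon> = min 1 (min (a + 1) (min (b + 1) (a + b + 1))) / 4"
  have \<epsilon>: "\<epsilon> > 0" "4 * \<epsilon> \<le> 1" "4 * \<epsilon> \<le> a + 1" "4 * \<epsilon> \<le> b + 1" "4 * \<epsilon> \<le> a + b + 1"
    using assms by (auto simp: \<epsilon>_def min_def)
  thus ?thesis by (intro exI[of _ "max a \<epsilon>"] exI[of _ "max b \<epsilon>"]) (auto simp: max_def)
qed

lemma kernel_coeff_rGamma: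
  "kernel_coeff a b n k l = pf_coeff (a + b) n k * pf_coeff (a + b) n l / (a + b + 1 + real k + real l) *
     (rGamma (a + 1 + real k) * rGamma (b + 1 + real l))"
  by (simp add: kernel_coeff_def rGamma_inverse_Gamma divide_inverse add_ac mult_ac)

text \<open>
  The Stieltjes transform of a power has the same form as the loop integral \<^const>\<open>Gt_mode\<close>; this is
  how the two sides of the theorem meet.
\<close>

lemma rGamma_mult_Stieltjes_moment:
  assumes "c > -1" "y > 0"
  shows "rGamma (c + 1 + real l) * Stieltjes_moment (c + real l) y =
           y powr c * exp y * Gt_mode c l y"
proof -
  have "c + real l + 1 > 0" using assms(1) of_nat_0_le_iff[of l] by linarith
  hence "Gamma (c + real l + 1) \<noteq> 0" using Gamma_real_pos by fastforce
  hence "rGamma (c + 1 + real l) * Gamma (c + real l + 1) = 1"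
    by (simp add: rGamma_inverse_Gamma add_ac)
  hence "rGamma (c + 1 + real l) * Stieltjes_moment (c + real l) y =
      1 * (y powr (c + real l) * exp y * upper_Gamma (- (c + real l)) y)"
    unfolding Stieltjes_moment_def by (metis mult.assoc)
  also have "y powr (c + real l) = y powr c * y ^ l" using assms(2) by (simp add: powr_add powr_realpow)
  finally show ?thesis by (simp add: Gt_mode_def mult_ac)
qed

context
  fixes a b x y :: real and n :: nat and p q :: "nat \<Rightarrow> real poly"
  assumes ab: "a > -1" "b > -1" "a + b > -1" and x: "x > 0" and y: "y > 0"
    and pq: "cauchy_laguerre_biorthogonal a b p q"
begin

lemma K00_integral:
  "K00 p q n x y = (LBINT t:{0..1}. t powr (a + b) * (G_val (a + b) a n (t * x) * G_val (a + b) b n (t * y)))"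
proof -
  obtain \<mu> \<nu> where mn: "\<mu> > 0" "a \<le> \<mu>" "\<nu> > 0" "b \<le> \<nu>" "\<mu> + \<nu> < a + b + 1"
    using boundary_exponents[OF ab] by blast
  show ?thesis
    using integral_product_of_mode_sums[OF ab(3) kernel_mode_G[OF x mn(1), of a] kernel_mode_G[OF y mn(3), of b] mn(5), of n]
    unfolding K00_eq_kernel_sum[OF ab pq] G_val_def kernel_coeff_rGamma
    by (simp add: G_mode_def mult_ac)
qed

lemma K01_integral:
  "K01 b p q n x y = y powr b * exp y *
     (LBINT t:{0..1}. t powr (a + b) * (G_val (a + b) a n (t * x) * Gt_val (a + b) b n (t * y)))"
proof -
  obtain \<mu> \<nu> where mn: "\<mu> > 0" "a \<le> \<mu>" "\<nu> > 0" "b \<le> \<nu>" "\<mu> + \<nu> < a + b + 1"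
    using boundary_exponents[OF ab] by blast
  let ?X = "\<lambda>k l. pf_coeff (a + b) n k * pf_coeff (a + b) n l / (a + b + 1 + real k + real l)"
  have "(LBINT t:{0..1}. t powr (a + b) * (G_val (a + b) a n (t * x) * Gt_val (a + b) b n (t * y))) =
     (\<Sum>k<n. \<Sum>l<n. ?X k l * (G_mode a k x * Gt_mode b l y))"
    using integral_product_of_mode_sums[OF ab(3) kernel_mode_G[OF x mn(1), of a] kernel_mode_Gt[OF y mn(3,4)] mn(5), of n]
    unfolding G_val_def Gt_val_def by simp
  moreover have "kernel_coeff a b n k l * x ^ k * Stieltjes_moment (b + real l) y =
      y powr b * exp y * (?X k l * (G_mode a k x * Gt_mode b l y))" for k l
  proof -
    have "kernel_coeff a b n k l * x ^ k * Stieltjes_moment (b + real l) y =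
      ?X k l * G_mode a k x * (rGamma (b + 1 + real l) * Stieltjes_moment (b + real l) y)"
      by (simp add: kernel_coeff_rGamma G_mode_def mult_ac)
    thus ?thesis unfolding rGamma_mult_Stieltjes_moment[OF ab(2) y] by (simp add: mult_ac)
  qed
  ultimately show ?thesis
    unfolding K01_eq_kernel_sum[OF ab y pq] by (simp only: sum_distrib_left)
qed

lemma K10_integral:
  "K10 a p q n x y = x powr a * exp x *
     (LBINT t:{0..1}. t powr (a + b) * (Gt_val (a + b) a n (t * x) * G_val (a + b) b n (t * y)))"
proof -
  obtain \<mu> \<nu> where mn: "\<mu> > 0" "a \<le> \<mu>" "\<nu> > 0" "b \<le> \<nu>" "\<mu> + \<nu> < a + b + 1"
    using boundary_exponents[OF ab] by blast
  let ?X = "\<lambda>k l. pf_coeff (a + b) n k * pf_coeff (a + b) n l / (a + b + 1 + real k + real l)"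
  have "(LBINT t:{0..1}. t powr (a + b) * (Gt_val (a + b) a n (t * x) * G_val (a + b) b n (t * y))) =
     (\<Sum>k<n. \<Sum>l<n. ?X k l * (Gt_mode a k x * G_mode b l y))"
    using integral_product_of_mode_sums[OF ab(3) kernel_mode_Gt[OF x mn(1,2)] kernel_mode_G[OF y mn(3), of b] mn(5), of n]
    unfolding G_val_def Gt_val_def by simp
  moreover have "kernel_coeff a b n k l * Stieltjes_moment (a + real k) x * y ^ l =
      x powr a * exp x * (?X k l * (Gt_mode a k x * G_mode b l y))" for k l
  proof -
    have "kernel_coeff a b n k l * Stieltjes_moment (a + real k) x * y ^ l =
      ?X k l * G_mode b l y * (rGamma (a + 1 + real k) * Stieltjes_moment (a + real k) x)"
      by (simp add: kernel_coeff_rGamma G_mode_def mult_ac)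
    thus ?thesis unfolding rGamma_mult_Stieltjes_moment[OF ab(1) x] by (simp add: mult_ac)
  qed
  ultimately show ?thesis
    unfolding K10_eq_kernel_sum[OF ab x pq] by (simp only: sum_distrib_left)
qed

lemma K11_integral:
  "K11 a b p q n x y = x powr a * y powr b * exp (x + y) *
     (LBINT t:{0..1}. t powr (a + b) * (Gt_val (a + b) a n (t * x) * Gt_val (a + b) b n (t * y))) - exp (x + y) / (x + y)"
proof -
  obtain \<mu> \<nu> where mn: "\<mu> > 0" "a \<le> \<mu>" "\<nu> > 0" "b \<le> \<nu>" "\<mu> + \<nu> < a + b + 1"
    using boundary_exponents[OF ab] by blast
  have "(LBINT t:{0..1}. t powr (a + b) * ((t * x) powr (- a) * exp (- (t * x)) * ((t * y) powr (- b) * exp (- (t * y))))) =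
        (LBINT t:{0<..1}. t powr (a + b) * ((t * x) powr (- a) * exp (- (t * x)) * ((t * y) powr (- b) * exp (- (t * y)))))"
    by (rule set_integral_discrete_difference[where X = "{0}"]) auto
  also have "\<dots> = (LBINT t:{0<..1}. x powr (- a) * y powr (- b) * exp (- (x + y) * t))"
  proof (intro set_lebesgue_integral_cong)
    show "\<forall>t. t \<in> {0<..1} \<longrightarrow> t powr (a + b) * ((t * x) powr (- a) * exp (- (t * x)) * ((t * y) powr (- b) * exp (- (t * y)))) =
        x powr (- a) * y powr (- b) * exp (- (x + y) * t)"
    proof (intro allI impI)
      fix t :: real assume t: "t \<in> {0<..1}"
      have "t powr (a + b) * ((t * x) powr (- a) * exp (- (t * x)) * ((t * y) powr (- b) * exp (- (t * y)))) =
        (t powr (a + b) * t powr (- a) * t powr (- b)) * (x powr (- a) * y powr (- b)) * (exp (- (t * x)) * exp (- (t * y)))"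
        using t x y by (simp add: powr_mult mult_ac)
      also have "t powr (a + b) * t powr (- a) * t powr (- b) = 1" using t by (simp flip: powr_add)
      also have "exp (- (t * x)) * exp (- (t * y)) = exp (- (x + y) * t)" by (simp add: algebra_simps flip: exp_add)
      finally show "t powr (a + b) * ((t * x) powr (- a) * exp (- (t * x)) * ((t * y) powr (- b) * exp (- (t * y)))) =
        x powr (- a) * y powr (- b) * exp (- (x + y) * t)" by simp
    qed
  qed auto
  also have "\<dots> = x powr (- a) * y powr (- b) * (LBINT t:{0<..1}. exp (- (x + y) * t))" by simp
  also have "(LBINT t:{0<..1}. exp (- (x + y) * t)) = (LBINT t:{0..1}. exp (- (x + y) * t))"
    by (rule set_integral_discrete_difference[where X = "{0}"]) auto
  also have "(LBINT t:{0..1}. exp (- (x + y) * t)) = (1 - exp (- (x + y))) / (x + y)"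
  proof -
    have "has_bochner_integral lborel (\<lambda>t. exp (- c * t) * indicator {0..1} t)
        (- exp (- c * 1) / c - (- exp (- c * 0) / c))" if "c > 0" for c :: real
      using that
      by (intro has_bochner_integral_FTC_Icc_nonneg) (auto intro!: derivative_eq_intros continuous_intros)
    from has_bochner_integral_integral_eq[OF this[of "x + y"]] show ?thesis
      using x y by (simp add: set_lebesgue_integral_def diff_divide_distrib mult.commute)
  qed
  finally have pq_int: "(LBINT t:{0..1}. t powr (a + b) * ((t * x) powr (- a) * exp (- (t * x)) * ((t * y) powr (- b) * exp (- (t * y))))) =
      x powr (- a) * y powr (- b) * ((1 - exp (- (x + y))) / (x + y))" .
  let ?X = "\<lambda>k l. pf_coeff (a + b) n k * pf_coeff (a + b) n l / (a + b + 1 + real k + real l)"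
  define J where "J = (\<Sum>k<n. \<Sum>l<n. ?X k l * (Gt_mode a k x * Gt_mode b l y))"
  have "(LBINT t:{0..1}. t powr (a + b) * (Gt_val (a + b) a n (t * x) * Gt_val (a + b) b n (t * y))) =
     J + x powr (- a) * y powr (- b) * ((1 - exp (- (x + y))) / (x + y))"
    using integral_product_of_mode_sums[OF ab(3) kernel_mode_Gt[OF x mn(1,2)] kernel_mode_Gt[OF y mn(3,4)] mn(5), of n]
    unfolding Gt_val_def pq_int J_def by simp
  moreover have "(\<Sum>k<n. \<Sum>l<n. kernel_coeff a b n k l * Stieltjes_moment (a + real k) x * Stieltjes_moment (b + real l) y) =
     x powr a * y powr b * exp (x + y) * J"
    unfolding J_def sum_distrib_left
  proof (intro sum.cong refl)
    fix k l
    have "kernel_coeff a b n k l * Stieltjes_moment (a + real k) x * Stieltjes_moment (b + real l) y =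
      ?X k l * (rGamma (a + 1 + real k) * Stieltjes_moment (a + real k) x) * (rGamma (b + 1 + real l) * Stieltjes_moment (b + real l) y)"
      by (simp add: kernel_coeff_rGamma mult_ac)
    thus "kernel_coeff a b n k l * Stieltjes_moment (a + real k) x * Stieltjes_moment (b + real l) y =
      x powr a * y powr b * exp (x + y) * (?X k l * (Gt_mode a k x * Gt_mode b l y))"
      unfolding rGamma_mult_Stieltjes_moment[OF ab(1) x] rGamma_mult_Stieltjes_moment[OF ab(2) y]
      by (simp add: exp_add mult_ac)
  qed
  moreover have "x powr a * y powr b * exp (x + y) * (x powr (- a) * y powr (- b) * ((1 - exp (- (x + y))) / (x + y))) =
     exp (x + y) / (x + y) - 1 / (x + y)"
  proof -
    have "x powr a * y powr b * exp (x + y) * (x powr (- a) * y powr (- b) * ((1 - exp (- (x + y))) / (x + y))) =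
      (x powr a * x powr (- a)) * (y powr b * y powr (- b)) * ((exp (x + y) - exp (x + y) * exp (- (x + y))) / (x + y))"
      by (simp add: right_diff_distrib mult_ac)
    moreover have "x powr a * x powr (- a) = 1" "y powr b * y powr (- b) = 1" "exp (x + y) * exp (- (x + y)) = 1"
      using x y by (simp_all flip: powr_add exp_add)
    ultimately show ?thesis by (simp only: mult_1 diff_divide_distrib)
  qed
  ultimately show ?thesis
    unfolding K11_eq_kernel_sum[OF ab x y pq] by (simp add: distrib_left)
qed

end

text \<open>
  The point $t=0$, at which the loop integrals would be evaluated at argument 0, is a null set.
\<close>

lemma set_integral_of_real_unit:
  fixes f :: "real \<Rightarrow> complex" and g :: "real \<Rightarrow> real"
  assumes "\<And>t. t > 0 \<Longrightarrow> f t = of_real (C * g t)"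
  shows "(LINT t:{0..1}|lborel. f t) = of_real (C * (LBINT t:{0..1}. g t))"
proof -
  have "(LINT t:{0..1}|lborel. f t) = (LINT t:{0<..1}|lborel. f t)"
    by (rule set_integral_discrete_difference[where X = "{0}"]) auto
  also have "\<dots> = (LINT t:{0<..1}|lborel. of_real (C * g t))"
    using assms by (intro set_lebesgue_integral_cong) auto
  also have "\<dots> = (LINT t:{0..1}|lborel. of_real (C * g t))"
    by (rule set_integral_discrete_difference[where X = "{0}"]) auto
  also have "\<dots> = of_real (LBINT t:{0..1}. C * g t)" by (rule set_integral_complex_of_real)
  finally show ?thesis by simp
qed

theorem theorem2p1:
  fixes a b \<alpha> x y :: real and n :: nat
    and p q :: "nat \<Rightarrow> real poly"
    and \<gamma>H \<gamma>Ht \<gamma>G \<gamma>Gt :: "real \<Rightarrow> real \<Rightarrow> complex"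
  assumes "a > -1" and "b > -1" and "\<alpha> = a + b" and "\<alpha> > -1"
    and "n \<ge> 1" and "x > 0" and "y > 0"
    and "cauchy_laguerre_biorthogonal a b p q"
    and "\<And>c. c \<in> {a, b} \<Longrightarrow> H_contour \<alpha> c n (\<gamma>H c)"
    and "\<And>c. c \<in> {a, b} \<Longrightarrow> Ht_contour \<alpha> c n (\<gamma>Ht c)"
    and "\<And>c. c \<in> {a, b} \<Longrightarrow> G_contour \<alpha> c n (\<gamma>G c)"
    and "\<And>c. c \<in> {a, b} \<Longrightarrow> Gt_contour \<alpha> c n (\<gamma>Gt c)"
  shows
    "complex_of_real (H01 a b p q n x y) =
       of_real (exp (- x + y)) *
       (LINT t:{0..1}|lborel. H_fun (\<gamma>H a) \<alpha> a n (t * x) * Ht_fun (\<gamma>Ht b) \<alpha> b n (t * y))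
     \<and> complex_of_real (H00 a b p q n x y) =
       of_real (exp (- x - y)) *
       (LINT t:{0..1}|lborel. H_fun (\<gamma>H a) \<alpha> a n (t * x) * H_fun (\<gamma>H b) \<alpha> b n (t * y))
     \<and> complex_of_real (H11 a b p q n x y) =
       of_real (exp (x + y)) *
       (LINT t:{0..1}|lborel. Ht_fun (\<gamma>Ht a) \<alpha> a n (t * x) * Ht_fun (\<gamma>Ht b) \<alpha> b n (t * y))
       - of_real (exp (x + y) / (x + y))
     \<and> complex_of_real (H10 a b p q n x y) =
       of_real (exp (x - y)) *
       (LINT t:{0..1}|lborel. Ht_fun (\<gamma>Ht a) \<alpha> a n (t * x) * H_fun (\<gamma>H b) \<alpha> b n (t * y))
     \<and> complex_of_real (K00 p q n x y) =
       (LINT t:{0..1}|lborel. of_real (t powr \<alpha>) *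
          G_fun (\<gamma>G a) \<alpha> a n (t * x) * G_fun (\<gamma>G b) \<alpha> b n (t * y))
     \<and> complex_of_real (K01 b p q n x y) =
       of_real (y powr b * exp y) *
       (LINT t:{0..1}|lborel. of_real (t powr \<alpha>) *
          G_fun (\<gamma>G a) \<alpha> a n (t * x) * Gt_fun (\<gamma>Gt b) \<alpha> b n (t * y))
     \<and> complex_of_real (K10 a p q n x y) =
       of_real (x powr a * exp x) *
       (LINT t:{0..1}|lborel. of_real (t powr \<alpha>) *
          Gt_fun (\<gamma>Gt a) \<alpha> a n (t * x) * G_fun (\<gamma>G b) \<alpha> b n (t * y))
     \<and> complex_of_real (K11 a b p q n x y) =
       of_real (x powr a * y powr b * exp (x + y)) *
       (LINT t:{0..1}|lborel. of_real (t powr \<alpha>) *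
          Gt_fun (\<gamma>Gt a) \<alpha> a n (t * x) * Gt_fun (\<gamma>Gt b) \<alpha> b n (t * y))
       - of_real (exp (x + y) / (x + y))"
proof -
  have ab: "a > -1" "b > -1" "a + b > -1" and \<alpha>: "\<alpha> = a + b" using assms by auto
  note xy = \<open>x > 0\<close> \<open>y > 0\<close> and n = \<open>n \<ge> 1\<close> and pq = assms(8)
  have c: "a \<in> {a, b}" "b \<in> {a, b}" by auto
  let ?C = "x powr a * y powr b"
  have tz: "t * x > 0" "t * y > 0" if "t > 0" for t using that xy by auto
  have weight: "(t * x) powr a * g * ((t * y) powr b * h) = ?C * (t powr \<alpha> * (g * h))" if "t > 0" for t g h
    using that xy by (simp add: \<alpha> powr_mult powr_add mult_ac)
  note HG = H_fun_eq[OF assms(9)[OF c(1)] n tz(1)] H_fun_eq[OF assms(9)[OF c(2)] n tz(2)]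
    Ht_fun_eq[OF assms(10)[OF c(1)] n tz(1)] Ht_fun_eq[OF assms(10)[OF c(2)] n tz(2)]
  note GG = G_fun_eq[OF assms(11)[OF c(1)] n tz(1)] G_fun_eq[OF assms(11)[OF c(2)] n tz(2)]
    Gt_fun_eq[OF assms(12)[OF c(1)] n tz(1)] Gt_fun_eq[OF assms(12)[OF c(2)] n tz(2)]
  define J where "J = (\<lambda>F H. LBINT t:{0..1}. t powr \<alpha> * (F \<alpha> a n (t * x) * H \<alpha> b n (t * y)))"
  have K: "K00 p q n x y = J G_val G_val"
    "K01 b p q n x y = y powr b * exp y * J G_val Gt_val"
    "K10 a p q n x y = x powr a * exp x * J Gt_val G_val"
    "K11 a b p q n x y = ?C * exp (x + y) * J Gt_val Gt_val - exp (x + y) / (x + y)"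
    unfolding J_def \<alpha>
    by (rule K00_integral[OF ab xy pq] K01_integral[OF ab xy pq] K10_integral[OF ab xy pq] K11_integral[OF ab xy pq])+
  have hh: "(LINT t:{0..1}|lborel. H_fun (\<gamma>H a) \<alpha> a n (t * x) * Ht_fun (\<gamma>Ht b) \<alpha> b n (t * y)) = of_real (?C * J G_val Gt_val)"
    "(LINT t:{0..1}|lborel. H_fun (\<gamma>H a) \<alpha> a n (t * x) * H_fun (\<gamma>H b) \<alpha> b n (t * y)) = of_real (?C * J G_val G_val)"
    "(LINT t:{0..1}|lborel. Ht_fun (\<gamma>Ht a) \<alpha> a n (t * x) * Ht_fun (\<gamma>Ht b) \<alpha> b n (t * y)) = of_real (?C * J Gt_val Gt_val)"
    "(LINT t:{0..1}|lborel. Ht_fun (\<gamma>Ht a) \<alpha> a n (t * x) * H_fun (\<gamma>H b) \<alpha> b n (t * y)) = of_real (?C * J Gt_val G_val)"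
    unfolding J_def
    by (rule set_integral_of_real_unit, simp only: HG of_real_mult[symmetric] weight)+
  have gg: "(LINT t:{0..1}|lborel. of_real (t powr \<alpha>) * G_fun (\<gamma>G a) \<alpha> a n (t * x) * G_fun (\<gamma>G b) \<alpha> b n (t * y)) = of_real (1 * J G_val G_val)"
    "(LINT t:{0..1}|lborel. of_real (t powr \<alpha>) * G_fun (\<gamma>G a) \<alpha> a n (t * x) * Gt_fun (\<gamma>Gt b) \<alpha> b n (t * y)) = of_real (1 * J G_val Gt_val)"
    "(LINT t:{0..1}|lborel. of_real (t powr \<alpha>) * Gt_fun (\<gamma>Gt a) \<alpha> a n (t * x) * G_fun (\<gamma>G b) \<alpha> b n (t * y)) = of_real (1 * J Gt_val G_val)"
    "(LINT t:{0..1}|lborel. of_real (t powr \<alpha>) * Gt_fun (\<gamma>Gt a) \<alpha> a n (t * x) * Gt_fun (\<gamma>Gt b) \<alpha> b n (t * y)) = of_real (1 * J Gt_val Gt_val)"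
    unfolding J_def
    by (rule set_integral_of_real_unit, simp only: GG of_real_mult[symmetric] mult.assoc mult_1)+
  show ?thesis
    unfolding hh gg H01_def H00_def H11_def H10_def K of_real_mult[symmetric] of_real_diff[symmetric] of_real_eq_iff
    by (simp add: exp_diff exp_add exp_minus field_simps)
qed

end
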